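(* (i) For all fixed integers $t \geq 3$ and $r \geq 2$, the threshold for avoiding the cycle $C_t$ in the Achlioptas process with parameter $r$ is $n^{2-\frac{(t-2)r+2}{(t-1)r+1}}$. (ii) For all fixed integers $t \geq 4$ and $r \geq 2$, the threshold for avoiding the complete graph $K_t$ in the Achlioptas process with parameter $r$ is $n^{2-\theta}$, where $$s = \lfloor \log_r [(r-1)t + 1] \rfloor, \qquad \theta = \frac{r^s (t-2) + 2}{r^s\left[\binom{t}{2} - s\right] + \frac{r^s - 1}{r-1}}.$$ (iii) For all fixed integers $t \geq 3$ and $r \geq 2$, the threshold for avoiding the complete bipartite graph $K_{t,t}$ in the Achlioptas process with parameter $r$ is $n^{2-\theta}$, where $$s = \lfloor \log_r [(r-1)t + 1] \rfloor, \qquad \theta = \frac{r^s (2t-2) + 2}{r^s (t^2 - s) + \frac{r^s - 1}{r-1}}.$$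
   Context: Achlioptas process with parameter $r$ (with $r$ fixed and $n\to\infty$): start with the empty graph on $n$ labeled vertices. In the $i$-th round ($i=1,2,\dots$), a player is presented with $r$ independent random edges of $K_n$, each distributed uniformly over the $\binom n2-(i-1)$ edges not yet chosen for the graph, and must choose one of them, which is added to the graph. (An edge may be offered more than once, but is never chosen twice.) The player follows an online strategy: the choice in each round depends only on the edges offered up to and including that round and the previous choices; strategies may be randomized. For a fixed graph $H$, the player loses as soon as the graph contains a (not necessarily induced) subgraph isomorphic to $H$; otherwise the player survives. An event (depending on $n$) holds with high probability (whp) if its probability is $1-o(1)$ as $n\to\infty$. For functions of $n$, $f\ll g$ (equivalently $g\gg f$) means $f(n)/g(n)\to 0$ as $n\to\infty$. A function $m^*(n)$ is a threshold for avoiding $H$ (in the Achlioptas process with parameter $r$) if: (a) for any function $m(n)\ll m^*(n)$, there exists an online strategy by which the player survives through $m$ rounds whp; and (b) for any function $m(n)\gg m^*(n)$, the player loses by the end of $m$ rounds whp, regardless of the choice of online strategy. Here numbers of rounds $m=m(n)$ are integers with $0\le m\le\binom n2$. *)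

theory Defs
  imports
    "HOL-Probability.Probability"
    "HOL-Library.Ramsey"
    "HOL-Library.Landau_Symbols"
begin

section \<open>Finite simple graphs\<close>

text \<open>A graph is a pair of a vertex set and a set of edges, an edge being a two-element set
  of vertices. \<^term>\<open>nsets V 2\<close> is the set of all two-element subsets of \<^term>\<open>V\<close>.\<close>

type_synonym edge = "nat set"
type_synonym graph = "nat set \<times> edge set"

definition subgraph :: "graph \<Rightarrow> graph \<Rightarrow> bool" where
  "subgraph G' G \<longleftrightarrow>
     fst G' \<subseteq> fst G \<and> snd G' \<subseteq> snd G \<and> snd G' \<subseteq> nsets (fst G') 2"

definition graph_iso :: "graph \<Rightarrow> graph \<Rightarrow> bool" where
  "graph_iso G G' \<longleftrightarrow> (\<exists>f. bij_betw f (fst G) (fst G') \<and> (\<lambda>e. f ` e) ` snd G = snd G')"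

definition contains_copy :: "graph \<Rightarrow> graph \<Rightarrow> bool" where
  "contains_copy G H \<longleftrightarrow> (\<exists>H'. subgraph H' G \<and> graph_iso H H')"

text \<open>A cycle only for \<^term>\<open>t \<ge> 3\<close>.\<close>

definition cycle_graph :: "nat \<Rightarrow> graph" where
  "cycle_graph t = ({..<t}, {{i, Suc i mod t} | i. i < t})"

definition simple_complete_graph :: "nat \<Rightarrow> graph" where
  "simple_complete_graph t = ({..<t}, nsets {..<t} 2)"

definition complete_bipartite_graph :: "nat \<Rightarrow> nat \<Rightarrow> graph" where
  "complete_bipartite_graph a b = ({..<a + b}, {{i, a + j} | i j. i < a \<and> j < b})"


section \<open>The Achlioptas process\<close>

text \<open>A history lists, round by round, the offered edges together with the chosen edge.\<close>

type_synonym history = "(edge list \<times> edge) list"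

definition chosen :: "history \<Rightarrow> edge set" where
  "chosen h = snd ` set h"

definition graph_of :: "nat \<Rightarrow> history \<Rightarrow> graph" where
  "graph_of n h = ({..<n}, chosen h)"

text \<open>An online strategy sees the past and the currently offered edges, and picks one of the
  latter, possibly at random. Since the history includes all previous choices, any correlation
  between the randomness used in different rounds can be expressed in this form.\<close>

type_synonym strategy = "history \<Rightarrow> edge list \<Rightarrow> edge pmf"

definition online_strategy :: "strategy \<Rightarrow> bool" where
  "online_strategy \<sigma> \<longleftrightarrow> (\<forall>h os. os \<noteq> [] \<longrightarrow> set_pmf (\<sigma> h os) \<subseteq> set os)"

text \<open>Meaningful only while unchosen edges remain (the argument of \<^term>\<open>pmf_of_set\<close> must be
  nonempty), that is, for at most \<^term>\<open>n choose 2\<close> rounds.\<close>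

definition offer :: "nat \<Rightarrow> nat \<Rightarrow> history \<Rightarrow> edge list pmf" where
  "offer n r h = replicate_pmf r (pmf_of_set (nsets {..<n} 2 - chosen h))"

primrec achlioptas :: "nat \<Rightarrow> nat \<Rightarrow> strategy \<Rightarrow> nat \<Rightarrow> history pmf" where
  "achlioptas n r \<sigma> 0 = return_pmf []"
| "achlioptas n r \<sigma> (Suc i) =
     do {h \<leftarrow> achlioptas n r \<sigma> i;
         os \<leftarrow> offer n r h;
         e \<leftarrow> \<sigma> h os;
         return_pmf (h @ [(os, e)])}"

text \<open>Edges are never removed, so a copy of \<^term>\<open>H\<close> has appeared in some round so far iff
  there is one in the current graph.\<close>

definition lost :: "graph \<Rightarrow> nat \<Rightarrow> history \<Rightarrow> bool" where
  "lost H n h \<longleftrightarrow> contains_copy (graph_of n h) H"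

definition prob_survive :: "graph \<Rightarrow> nat \<Rightarrow> strategy \<Rightarrow> nat \<Rightarrow> nat \<Rightarrow> real" where
  "prob_survive H r \<sigma> m n = measure_pmf.prob (achlioptas n r \<sigma> m) {h. \<not> lost H n h}"

definition prob_lose :: "graph \<Rightarrow> nat \<Rightarrow> strategy \<Rightarrow> nat \<Rightarrow> nat \<Rightarrow> real" where
  "prob_lose H r \<sigma> m n = measure_pmf.prob (achlioptas n r \<sigma> m) {h. lost H n h}"


section \<open>Thresholds\<close>

text \<open>The strategy may depend on \<^term>\<open>n\<close>. The relation \<open>f \<ll> g\<close> is little-o rather than a limit
  of quotients because \<^term>\<open>m n = 0\<close> is allowed and \<open>x / 0 = 0\<close>.\<close>

definition avoidance_threshold :: "nat \<Rightarrow> graph \<Rightarrow> (nat \<Rightarrow> real) \<Rightarrow> bool" where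
  "avoidance_threshold r H mstar \<longleftrightarrow>
     (\<forall>m :: nat \<Rightarrow> nat. (\<forall>n. m n \<le> n choose 2) \<longrightarrow> (\<lambda>n. real (m n)) \<in> o(mstar) \<longrightarrow>
        (\<exists>\<sigma>. (\<forall>n. online_strategy (\<sigma> n)) \<and>
             (\<lambda>n. prob_survive H r (\<sigma> n) (m n) n) \<longlonglongrightarrow> 1)) \<and>
     (\<forall>m :: nat \<Rightarrow> nat. (\<forall>n. m n \<le> n choose 2) \<longrightarrow> mstar \<in> o(\<lambda>n. real (m n)) \<longrightarrow>
        (\<forall>\<sigma>. (\<forall>n. online_strategy (\<sigma> n)) \<longrightarrow>
             (\<lambda>n. prob_lose H r (\<sigma> n) (m n) n) \<longlonglongrightarrow> 1))"

end

theory Submission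
  imports Defs "HOL-Real_Asymp.Real_Asymp"
begin

text \<open>Let \<open>H\<close> have \<open>v\<close> vertices and \<open>k\<close> edges, and let \<open>p = m / n\<^sup>2\<close>. About \<open>w\<^sub>0 = n\<^sup>v p\<^sup>k\<^sup>-\<^sup>s\<close> copies of
  \<open>H\<close> minus \<open>s\<close> edges are present after \<open>m\<close> rounds. If \<open>w\<^sub>i\<close> pairs would complete a copy of \<open>H\<close> minus
  \<open>s - i - 1\<close> edges, the player is forced to complete one only when all \<open>r\<close> offers are among these
  pairs, so \<open>w\<^sub>i\<^sub>+\<^sub>1 = m (w\<^sub>i / n\<^sup>2)\<^sup>r\<close>. The threshold is where \<open>w\<^sub>s = 1\<close>.

  By first moments, a player who always takes an offered edge that completes as little as possible
  keeps the counts below the \<open>w\<^sub>i\<close> of a slightly larger \<open>m\<close>. Conversely, divide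
  the rounds into \<open>k\<close> phases, one for each edge of \<open>H\<close>, the \<open>s\<close> removed edges coming last. In the first
  \<open>k - s\<close> phases a positive fraction of all pairs extends the expected number of partial copies, by a
  second moment bound on overlapping copies, so even a round with all \<open>r\<close> offers in this
  set has positive probability. Before the last \<open>s\<close> phases one selects a positive fraction of the
  copies that do not share any of the \<open>s\<close> missing pairs; from then on the dangerous pairs are
  distinct and the recursion for \<open>w\<^sub>i\<close> is also a lower bound. For cliques and complete bipartite graphs
  the removed edges are a matching: then no subgraph of the remaining graph is too dense, and no
  partial overlap of its copies containing a removed pair is too frequent.\<close>

section \<open>Rounds of the process\<close>

text \<open>The number \<open>s\<close> of removed edges comes from comparing copies with pairs. Put
  \<open>l = k - s\<close>, \<open>G = 1 + r + ... + r^(s-1)\<close> and \<open>Q = r^s\<close>, and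
  take \<open>p = n powr (- \<theta>)\<close>. Solving for \<open>\<theta>\<close>, there are fewer
  than \<open>n^2\<close> copies of \<open>H\<close> minus \<open>s\<close> edges exactly when
  \<open>(v - 2) * G < 2 * l\<close>, and at least \<open>n^2\<close> copies of \<open>H\<close>
  minus \<open>s + 1\<close> edges exactly when \<open>2 * (l - 1) \<le> (v - 2) * (Q + G)\<close>.
  In the first range dangerous pairs are rare, so choosing among \<open>r\<close> offers pays; in
  the second they may be a constant fraction of all pairs, and choice is worth a constant factor at
  most. For \<open>K_t\<close> and \<open>K_{t,t}\<close> the quotient
  \<open>2 * l / (v - 2)\<close> is close to \<open>t + 1\<close>, so both conditions essentially
  read \<open>G \<le> t < Q + G\<close>, which is the logarithm in the theorem.\<close>

lemma nn_integral_replicate_pmf_Suc: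
  "(\<integral>\<^sup>+os. f os \<partial>replicate_pmf (Suc r) p) = (\<integral>\<^sup>+x. \<integral>\<^sup>+xs. f (x # xs) \<partial>replicate_pmf r p \<partial>p)"
  by (simp add: nn_integral_bind_pmf nn_integral_return_pmf)

lemma emeasure_replicate_pmf_subset:
  "emeasure (replicate_pmf r p) {os. set os \<subseteq> D} = emeasure p D ^ r"
proof (induction r)
  case 0
  show ?case by simp
next
  case (Suc r)
  have "emeasure (replicate_pmf (Suc r) p) {os. set os \<subseteq> D}
      = (\<integral>\<^sup>+os. indicator {os. set os \<subseteq> D} os \<partial>replicate_pmf (Suc r) p)"
    by simp
  also have "\<dots> = (\<integral>\<^sup>+x. \<integral>\<^sup>+xs. indicator D x * indicator {os. set os \<subseteq> D} xs \<partial>replicate_pmf r p \<partial>p)"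
    unfolding nn_integral_replicate_pmf_Suc
    by (intro nn_integral_cong) (auto simp: indicator_def)
  also have "\<dots> = emeasure p D ^ Suc r"
    by (simp add: nn_integral_cmult Suc.IH nn_integral_multc)
  finally show ?case .
qed

text \<open>Whichever offer is taken, its weight is at most the sum of all weights, so the choice
  itself does not enter. In each summand one offer carries the weight, and the other
  \<open>r - 1\<close> independent offers only have to fall into \<open>D\<close>.\<close>

lemma nn_integral_replicate_pmf_le:
  fixes d :: "'a \<Rightarrow> ennreal" and p :: "'a pmf"
  assumes \<alpha>: "(\<integral>\<^sup>+x. d x * indicator D x \<partial>p) \<le> \<alpha>" and \<beta>: "emeasure p D \<le> \<beta>"
  shows "(\<integral>\<^sup>+os. (\<Sum>x\<leftarrow>os. d x) * indicator {os. set os \<subseteq> D} os \<partial>replicate_pmf r p)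
          \<le> of_nat r * \<alpha> * \<beta> ^ (r - 1)"
proof (induction r)
  case 0
  show ?case by simp
next
  case (Suc r)
  have "(\<integral>\<^sup>+os. (\<Sum>x\<leftarrow>os. d x) * indicator {os. set os \<subseteq> D} os \<partial>replicate_pmf (Suc r) p)
     = (\<integral>\<^sup>+x. \<integral>\<^sup>+xs. d x * indicator D x * indicator {os. set os \<subseteq> D} xs +
         indicator D x * ((\<Sum>x\<leftarrow>xs. d x) * indicator {os. set os \<subseteq> D} xs) \<partial>replicate_pmf r p \<partial>p)"
    unfolding nn_integral_replicate_pmf_Suc
    by (intro nn_integral_cong) (auto simp: indicator_def)
  also have "\<dots> = (\<integral>\<^sup>+x. d x * indicator D x \<partial>p) * emeasure p D ^ r +
       emeasure p D * (\<integral>\<^sup>+os. (\<Sum>x\<leftarrow>os. d x) * indicator {os. set os \<subseteq> D} os \<partial>replicate_pmf r p)"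
    by (simp add: nn_integral_add nn_integral_cmult nn_integral_multc emeasure_replicate_pmf_subset)
  also have "\<dots> \<le> \<alpha> * \<beta> ^ r + \<beta> * (of_nat r * \<alpha> * \<beta> ^ (r - 1))"
    using \<alpha> \<beta> Suc.IH by (intro add_mono mult_mono power_mono) auto
  also have "\<dots> = of_nat (Suc r) * \<alpha> * \<beta> ^ (Suc r - 1)"
    by (cases r) (auto simp: algebra_simps)
  finally show ?case .
qed

section \<open>Reachable histories and a single round\<close>

abbreviation vertex_pairs :: "nat \<Rightarrow> edge set" where
  "vertex_pairs n \<equiv> nsets {..<n} 2"

definition round_pmf :: "nat \<Rightarrow> nat \<Rightarrow> strategy \<Rightarrow> history \<Rightarrow> history pmf" where
  "round_pmf n r \<sigma> h =
     do {os \<leftarrow> offer n r h; e \<leftarrow> \<sigma> h os; return_pmf (h @ [(os, e)])}"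

primrec continue :: "nat \<Rightarrow> nat \<Rightarrow> strategy \<Rightarrow> nat \<Rightarrow> history \<Rightarrow> history pmf" where
  "continue n r \<sigma> 0 h = return_pmf h"
| "continue n r \<sigma> (Suc i) h = continue n r \<sigma> i h \<bind> round_pmf n r \<sigma>"

text \<open>The Markov property: a bound valid for every history at the end of one phase can be
  integrated over that phase.\<close>

lemma achlioptas_add:
  "achlioptas n r \<sigma> (i + j) = achlioptas n r \<sigma> i \<bind> continue n r \<sigma> j"
proof (induction j)
  case 0
  show ?case by (simp add: bind_return_pmf')
next
  case (Suc j)
  have "achlioptas n r \<sigma> (i + Suc j) = achlioptas n r \<sigma> (i + j) \<bind> round_pmf n r \<sigma>"
    by (simp add: round_pmf_def[abs_def])
  then show ?case by (simp add: Suc.IH bind_assoc_pmf)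
qed

lemma achlioptas_Suc: "achlioptas n r \<sigma> (Suc i) = achlioptas n r \<sigma> i \<bind> round_pmf n r \<sigma>"
  by (simp add: round_pmf_def[abs_def])

declare achlioptas.simps(2) [simp del]

lemma chosen_simps [simp]: "chosen [] = {}" "chosen (h @ [(os, e)]) = insert e (chosen h)"
  by (auto simp: chosen_def)

lemma finite_chosen [simp]: "finite (chosen h)"
  by (simp add: chosen_def)

lemma card_vertex_pairs: "card (vertex_pairs n) = n choose 2"
  by (simp add: card_nsets)

lemma finite_vertex_pairs [simp]: "finite (vertex_pairs n)"
  by (simp add: finite_imp_finite_nsets)

definition reachable :: "nat \<Rightarrow> nat \<Rightarrow> history \<Rightarrow> bool" where
  "reachable n i h \<longleftrightarrow> length h = i \<and> chosen h \<subseteq> vertex_pairs n"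

lemma card_free_pairs:
  assumes "reachable n i h"
  shows "(n choose 2) - i \<le> card (vertex_pairs n - chosen h)"
proof -
  have "card (chosen h) \<le> i"
    using assms card_image_le[of "set h" snd] card_length[of h]
    by (simp add: reachable_def chosen_def)
  then show ?thesis
    using diff_card_le_card_Diff[of "chosen h" "vertex_pairs n"] by (simp add: card_vertex_pairs)
qed

lemma free_pairs_nonempty:
  assumes "reachable n i h" "i < n choose 2"
  shows "vertex_pairs n - chosen h \<noteq> {}"
  using card_free_pairs[OF assms(1)] assms(2) by (metis card.empty diff_is_0_eq le_zero_eq not_le)

lemma set_pmf_offer:
  assumes "reachable n i h" "i < n choose 2" "os \<in> set_pmf (offer n r h)"
  shows "length os = r \<and> set os \<subseteq> vertex_pairs n - chosen h"
  using assms free_pairs_nonempty[OF assms(1,2)]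
  by (auto simp: offer_def set_replicate_pmf set_pmf_of_set)

lemma nn_integral_pmf_mono:
  "(\<And>x. x \<in> set_pmf p \<Longrightarrow> f x \<le> g x) \<Longrightarrow> (\<integral>\<^sup>+x. f x \<partial>measure_pmf p) \<le> (\<integral>\<^sup>+x. g x \<partial>measure_pmf p)"
  by (intro nn_integral_mono_AE) (simp add: AE_measure_pmf_iff)

text \<open>The set \<open>A\<close> allows truncation: a count will be controlled only on histories
  where the count one level up is already small.\<close>

lemma markov_pmf:
  fixes X :: "'a \<Rightarrow> real" and p :: "'a pmf"
  assumes "b > 0" "c \<ge> 0" "(\<integral>\<^sup>+x. ennreal (X x) * indicator A x \<partial>p) \<le> ennreal c"
  shows "measure p {x \<in> A. b \<le> X x} \<le> c / b"
proof -
  have "emeasure p {x \<in> A. b \<le> X x} \<le> emeasure p {x \<in> A. 1 \<le> ennreal (1 / b) * ennreal (X x)}"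
  proof (intro emeasure_mono Collect_mono)
    fix x show "x \<in> A \<and> b \<le> X x \<longrightarrow> x \<in> A \<and> 1 \<le> ennreal (1 / b) * ennreal (X x)"
      using assms(1) by (auto simp: ennreal_mult'[symmetric] simp flip: ennreal_1 intro!: ennreal_leI)
  qed simp
  also have "\<dots> \<le> ennreal (1 / b) * (\<integral>\<^sup>+x. ennreal (X x) * indicator A x \<partial>p)"
    by (rule nn_integral_Markov_inequality) auto
  also have "\<dots> \<le> ennreal (1 / b) * ennreal c"
    using assms by (intro mult_left_mono) auto
  also have "\<dots> = ennreal (c / b)" using assms by (simp add: ennreal_mult'[symmetric])
  finally show ?thesis using assms by (simp add: measure_pmf.emeasure_eq_measure)
qed

lemma nn_integral_offer_le:
  fixes d :: "edge \<Rightarrow> ennreal"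
  assumes h: "reachable n i h" "i < n choose 2"
  defines "U \<equiv> vertex_pairs n - chosen h"
  assumes \<alpha>: "(\<Sum>f\<in>U \<inter> D. d f) / of_nat (card U) \<le> \<alpha>"
    and \<beta>: "of_nat (card (U \<inter> D)) / of_nat (card U) \<le> \<beta>"
  shows "(\<integral>\<^sup>+os. (\<Sum>x\<leftarrow>os. d x) * indicator {os. set os \<subseteq> D} os \<partial>offer n r h)
          \<le> of_nat r * \<alpha> * \<beta> ^ (r - 1)"
  unfolding offer_def
proof (rule nn_integral_replicate_pmf_le)
  have U: "U \<noteq> {}" "finite U"
    using free_pairs_nonempty[OF h] by (auto simp: U_def)
  have "(\<Sum>x\<in>U. d x * indicator D x) = (\<Sum>f\<in>U \<inter> D. d f)"
    using U by (simp add: sum.inter_restrict indicator_def if_distrib cong: if_cong)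
  with U \<alpha> show "(\<integral>\<^sup>+x. d x * indicator D x \<partial>pmf_of_set (vertex_pairs n - chosen h)) \<le> \<alpha>"
    unfolding U_def[symmetric] by (simp add: nn_integral_pmf_of_set)
  have "(\<integral>\<^sup>+x. indicator D x \<partial>pmf_of_set U) = of_nat (card (U \<inter> D)) / of_nat (card U)"
    using U by (subst nn_integral_pmf_of_set) (auto simp: sum.inter_restrict[symmetric] indicator_def
        sum.If_cases Int_def)
  with \<beta> show "emeasure (pmf_of_set (vertex_pairs n - chosen h)) D \<le> \<beta>"
    unfolding U_def[symmetric] by simp
qed

text \<open>In \<open>emeasure_subset_chosen_le\<close> the two terms are the cases that the last
  round supplies none or exactly one edge of the set.\<close>

lemma binomial_two_terms_le:
  fixes x y :: real
  assumes "x \<ge> 0" "y \<ge> 0"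
  shows "x ^ k + real k * y * x ^ (k - 1) \<le> (x + y) ^ k"
proof (induction k)
  case (Suc k)
  have "x ^ Suc k + real (Suc k) * y * x ^ (Suc k - 1) \<le> (x + y) * (x ^ k + real k * y * x ^ (k - 1))"
    using assms by (cases k) (auto simp: algebra_simps)
  also have "\<dots> \<le> (x + y) * (x + y) ^ k"
    using Suc assms by (intro mult_left_mono) auto
  finally show ?case by simp
qed simp

section \<open>Upper bounds valid for every online strategy\<close>

context
  fixes n r :: nat and \<sigma> :: strategy
  assumes r: "r > 0" and online: "online_strategy \<sigma>"
begin

lemma set_pmf_strategy: "length os = r \<Longrightarrow> e \<in> set_pmf (\<sigma> h os) \<Longrightarrow> e \<in> set os"
  using online r by (auto simp: online_strategy_def)

lemma set_pmf_round:
  assumes "reachable n i h" "i < n choose 2" "h' \<in> set_pmf (round_pmf n r \<sigma> h)"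
  shows "\<exists>os e. h' = h @ [(os, e)] \<and> e \<in> set os \<and> length os = r \<and>
           set os \<subseteq> vertex_pairs n - chosen h"
proof -
  obtain os e where 1: "os \<in> set_pmf (offer n r h)" "e \<in> set_pmf (\<sigma> h os)" "h' = h @ [(os, e)]"
    using assms(3) by (auto simp: round_pmf_def)
  note 2 = set_pmf_offer[OF assms(1,2) 1(1)]
  then have "e \<in> set os" using set_pmf_strategy 1 by blast
  with 1 2 show ?thesis by blast
qed

lemma set_pmf_continue:
  assumes "reachable n i h" "i + j \<le> n choose 2" "h' \<in> set_pmf (continue n r \<sigma> j h)"
  shows "reachable n (i + j) h' \<and> chosen h \<subseteq> chosen h'"
  using assms(2,3)
proof (induction j arbitrary: h')
  case 0
  with assms(1) show ?case by simp
next
  case (Suc j)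
  from Suc.prems(2) obtain h1 where h1: "h1 \<in> set_pmf (continue n r \<sigma> j h)"
    "h' \<in> set_pmf (round_pmf n r \<sigma> h1)" by auto
  with Suc have IH: "reachable n (i + j) h1" "chosen h \<subseteq> chosen h1" by auto
  from set_pmf_round[OF IH(1) _ h1(2)] Suc.prems(1) IH show ?case
    by (auto simp: reachable_def)
qed

lemma set_pmf_achlioptas:
  assumes "i \<le> n choose 2" "h \<in> set_pmf (achlioptas n r \<sigma> i)"
  shows "reachable n i h"
  using set_pmf_continue[of 0 "[]" i h] achlioptas_add[of n r \<sigma> 0 i] assms
  by (simp add: reachable_def bind_return_pmf)

text \<open>Here the strategy disappears: a bound for every choice it may make among the offers
  leaves an expectation over independent offers.\<close>

lemma nn_integral_round_le:
  assumes h: "reachable n i h" "i < n choose 2"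
    and F: "\<And>os e. set os \<subseteq> vertex_pairs n - chosen h \<Longrightarrow> e \<in> set os \<Longrightarrow> e \<in> set_pmf (\<sigma> h os) \<Longrightarrow>
        F (h @ [(os, e)]) \<le> G os"
  shows "(\<integral>\<^sup>+h'. F h' \<partial>round_pmf n r \<sigma> h) \<le> (\<integral>\<^sup>+os. G os \<partial>offer n r h)"
proof -
  have "(\<integral>\<^sup>+h'. F h' \<partial>round_pmf n r \<sigma> h) =
      (\<integral>\<^sup>+os. \<integral>\<^sup>+e. F (h @ [(os, e)]) \<partial>\<sigma> h os \<partial>offer n r h)"
    by (simp add: round_pmf_def nn_integral_bind_pmf nn_integral_return_pmf)
  also have "\<dots> \<le> (\<integral>\<^sup>+os. G os \<partial>offer n r h)"
  proof (rule nn_integral_pmf_mono)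
    fix os assume os: "os \<in> set_pmf (offer n r h)"
    note os' = set_pmf_offer[OF h os]
    have "(\<integral>\<^sup>+e. F (h @ [(os, e)]) \<partial>\<sigma> h os) \<le> (\<integral>\<^sup>+e. G os \<partial>\<sigma> h os)"
      using os' set_pmf_strategy by (intro nn_integral_mono_AE) (auto simp: AE_measure_pmf_iff intro!: F)
    then show "(\<integral>\<^sup>+e. F (h @ [(os, e)]) \<partial>\<sigma> h os) \<le> G os" by simp
  qed
  finally show ?thesis .
qed

text \<open>Union bound: \<open>f\<close> can be taken only if one of the \<open>r\<close> offers
  equals \<open>f\<close>, and each offer does so with probability at most one over the number of
  free pairs. The general estimate is used with weight \<open>indicator {f}\<close> and no
  restriction on the other offers.\<close>

lemma emeasure_chosen_round_le:
  assumes h: "reachable n i h" "i < m" "m < n choose 2"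
  shows "emeasure (round_pmf n r \<sigma> h) {h'. f \<in> chosen h' - chosen h}
     \<le> ennreal (real r / real ((n choose 2) - m))"
proof -
  let ?U = "vertex_pairs n - chosen h"
  let ?L = "(n choose 2) - m"
  have L: "?L \<le> card ?U" "0 < ?L" using card_free_pairs[OF h(1)] h by auto
  have "emeasure (round_pmf n r \<sigma> h) {h'. f \<in> chosen h' - chosen h} =
     (\<integral>\<^sup>+h'. indicator {h'. f \<in> chosen h' - chosen h} h' \<partial>round_pmf n r \<sigma> h)" by simp
  also have "\<dots> \<le> (\<integral>\<^sup>+os. (\<Sum>x\<leftarrow>os. indicator {f} x) * indicator {os. set os \<subseteq> UNIV} os \<partial>offer n r h)"
  proof (rule nn_integral_round_le[OF h(1)])
    fix os :: "edge list" and e assume "e \<in> set os"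
    then have "indicator {f} e \<le> (\<Sum>x\<leftarrow>os. indicator {f} x :: ennreal)"
      by (intro member_le_sum_list) auto
    then show "indicator {h'. f \<in> chosen h' - chosen h} (h @ [(os, e)])
        \<le> (\<Sum>x\<leftarrow>os. indicator {f} x) * (indicator {os. set os \<subseteq> UNIV} os :: ennreal)"
      by (auto simp: indicator_def split: if_splits)
  qed (use h in auto)
  also have "\<dots> \<le> of_nat r * ennreal (1 / real ?L) * 1 ^ (r - 1)"
  proof (rule nn_integral_offer_le[OF h(1)])
    have "(\<Sum>x\<in>?U \<inter> UNIV. indicator {f} x :: ennreal) \<le> 1"
      using card_mono[of "{f}" "?U \<inter> {f}"] by (simp add: indicator_def sum.If_cases)
    then have "(\<Sum>x\<in>?U \<inter> UNIV. indicator {f} x :: ennreal) / of_nat (card ?U) \<le> 1 / of_nat (card ?U)"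
      by (rule divide_right_mono_ennreal)
    also have "\<dots> = ennreal (1 / real (card ?U))"
      using L by (subst divide_ennreal[symmetric]) (auto simp: ennreal_of_nat_eq_real_of_nat)
    also have "\<dots> \<le> ennreal (1 / real ?L)"
      using L by (intro ennreal_leI divide_left_mono) (auto simp: of_nat_diff)
    finally show "(\<Sum>x\<in>?U \<inter> UNIV. indicator {f} x) / of_nat (card ?U) \<le> ennreal (1 / real ?L)" .
    have "of_nat (card (?U \<inter> UNIV)) / of_nat (card ?U) = (1 :: ennreal)"
      using ennreal_divide_self[of "of_nat (card ?U)"] L(2) order.strict_trans2[OF L(2,1)]
      by (simp only: Int_UNIV_right of_nat_eq_0_iff of_nat_less_top)
    then show "of_nat (card (?U \<inter> UNIV)) / of_nat (card ?U) \<le> (1 :: ennreal)" by simp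
  qed (use h in auto)
  also have "\<dots> = ennreal (real r / real ?L)"
    by (simp add: ennreal_of_nat_eq_real_of_nat ennreal_mult[symmetric])
  finally show ?thesis .
qed

text \<open>For upper bounds, every strategy behaves like a random graph whose edge probability is
  \<open>r\<close> times the natural one. In the induction the last round adds at most one
  \<open>f\<close> of \<open>A\<close>, so before it either \<open>A\<close> or
  \<open>A - {f}\<close> was already chosen.\<close>

lemma emeasure_subset_chosen_le:
  assumes m: "i \<le> m" "m < n choose 2" and "finite A"
  shows "emeasure (achlioptas n r \<sigma> i) {h. A \<subseteq> chosen h}
     \<le> ennreal ((real i * (real r / real ((n choose 2) - m))) ^ card A)"
  using assms(1,3)
proof (induction i arbitrary: A)
  case 0
  show ?case
  proof (cases "A = {}")
    case False
    with 0 show ?thesis by (simp add: card_gt_0_iff)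
  qed simp
next
  case (Suc i)
  define \<rho> where "\<rho> = real r / real ((n choose 2) - m)"
  have \<rho>: "\<rho> \<ge> 0" by (simp add: \<rho>_def)
  have step: "emeasure (round_pmf n r \<sigma> h) {h'. A \<subseteq> chosen h'} \<le>
      indicator {h. A \<subseteq> chosen h} h + (\<Sum>f\<in>A. ennreal \<rho> * indicator {h. A - {f} \<subseteq> chosen h} h)"
    if h: "reachable n i h" for h
  proof -
    have "emeasure (round_pmf n r \<sigma> h) {h'. A \<subseteq> chosen h'} =
      (\<integral>\<^sup>+h'. indicator {h'. A \<subseteq> chosen h'} h' \<partial>round_pmf n r \<sigma> h)" by simp
    also have "\<dots> \<le> (\<integral>\<^sup>+h'. indicator {h. A \<subseteq> chosen h} h + (\<Sum>f\<in>A. indicator {h. A - {f} \<subseteq> chosen h} h *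
        indicator {h'. f \<in> chosen h' - chosen h} h') \<partial>round_pmf n r \<sigma> h)"
    proof (rule nn_integral_pmf_mono)
      fix h' assume "h' \<in> set_pmf (round_pmf n r \<sigma> h)"
      then obtain os e where e: "h' = h @ [(os, e)]" using set_pmf_round[OF h] Suc.prems m by force
      show "(indicator {h'. A \<subseteq> chosen h'} h' :: ennreal) \<le> indicator {h. A \<subseteq> chosen h} h +
         (\<Sum>f\<in>A. indicator {h. A - {f} \<subseteq> chosen h} h * indicator {h'. f \<in> chosen h' - chosen h} h')"
      proof (cases "A \<subseteq> chosen h' \<and> \<not> A \<subseteq> chosen h")
        case True
        then have "e \<in> A" "e \<notin> chosen h" "A - {e} \<subseteq> chosen h" using e by auto
        then have "1 = (\<Sum>f\<in>{e}. indicator {h. A - {f} \<subseteq> chosen h} h * indicator {h'. f \<in> chosen h' - chosen h} h' :: ennreal)"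
          using e by simp
        also have "\<dots> \<le> (\<Sum>f\<in>A. indicator {h. A - {f} \<subseteq> chosen h} h * indicator {h'. f \<in> chosen h' - chosen h} h' :: ennreal)"
          using \<open>e \<in> A\<close> Suc.prems by (intro sum_mono2) auto
        finally show ?thesis using True by simp
      qed (auto simp: indicator_def)
    qed
    also have "\<dots> = indicator {h. A \<subseteq> chosen h} h + (\<Sum>f\<in>A. indicator {h. A - {f} \<subseteq> chosen h} h *
        emeasure (round_pmf n r \<sigma> h) {h'. f \<in> chosen h' - chosen h})"
      by (simp add: nn_integral_add nn_integral_sum nn_integral_cmult)
    also have "\<dots> \<le> indicator {h. A \<subseteq> chosen h} h + (\<Sum>f\<in>A. indicator {h. A - {f} \<subseteq> chosen h} h * ennreal \<rho>)"
      unfolding \<rho>_def using h m Suc.prems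
      by (intro add_left_mono sum_mono mult_left_mono emeasure_chosen_round_le) auto
    finally show ?thesis by (simp add: mult.commute)
  qed
  have "emeasure (achlioptas n r \<sigma> (Suc i)) {h. A \<subseteq> chosen h} =
     (\<integral>\<^sup>+h. indicator {h. A \<subseteq> chosen h} h \<partial>achlioptas n r \<sigma> (Suc i))" by simp
  also have "\<dots> = (\<integral>\<^sup>+h. emeasure (round_pmf n r \<sigma> h) {h'. A \<subseteq> chosen h'} \<partial>achlioptas n r \<sigma> i)"
    unfolding achlioptas_Suc nn_integral_bind_pmf by simp
  also have "\<dots> \<le> (\<integral>\<^sup>+h. indicator {h. A \<subseteq> chosen h} h +
       (\<Sum>f\<in>A. ennreal \<rho> * indicator {h. A - {f} \<subseteq> chosen h} h) \<partial>achlioptas n r \<sigma> i)"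
    using Suc.prems m
    by (intro nn_integral_pmf_mono step set_pmf_achlioptas) auto
  also have "\<dots> = emeasure (achlioptas n r \<sigma> i) {h. A \<subseteq> chosen h} +
       (\<Sum>f\<in>A. ennreal \<rho> * emeasure (achlioptas n r \<sigma> i) {h. A - {f} \<subseteq> chosen h})"
    by (simp add: nn_integral_add nn_integral_sum nn_integral_cmult)
  also have "\<dots> \<le> ennreal ((real i * \<rho>) ^ card A) + (\<Sum>f\<in>A. ennreal \<rho> * ennreal ((real i * \<rho>) ^ (card A - 1)))"
  proof (intro add_mono sum_mono mult_left_mono)
    show "emeasure (achlioptas n r \<sigma> i) {h. A \<subseteq> chosen h} \<le> ennreal ((real i * \<rho>) ^ card A)"
      using Suc.IH[of A] Suc.prems by (simp add: \<rho>_def)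
    fix f assume "f \<in> A"
    then show "emeasure (achlioptas n r \<sigma> i) {h. A - {f} \<subseteq> chosen h} \<le> ennreal ((real i * \<rho>) ^ (card A - 1))"
      using Suc.IH[of "A - {f}"] Suc.prems by (simp add: \<rho>_def)
  qed auto
  also have "\<dots> = ennreal ((real i * \<rho>) ^ card A + real (card A) * \<rho> * (real i * \<rho>) ^ (card A - 1))"
    using \<rho> by (simp add: ennreal_of_nat_eq_real_of_nat ennreal_mult[symmetric] ennreal_plus[symmetric] mult.assoc
        del: ennreal_plus)
  also have "\<dots> \<le> ennreal ((real i * \<rho> + \<rho>) ^ card A)"
    using \<rho> by (intro ennreal_leI binomial_two_terms_le) auto
  also have "real i * \<rho> + \<rho> = real (Suc i) * \<rho>" by (simp add: algebra_simps)
  finally show ?case by (simp add: \<rho>_def)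
qed

end

section \<open>Exponential moments of forced choices\<close>

context
  fixes n r :: nat and \<sigma> :: strategy
  assumes r: "r > 0" and online: "online_strategy \<sigma>"
begin

context
  fixes A :: "edge set" and y :: real
  assumes A: "A \<subseteq> vertex_pairs n" and y: "y \<le> real (card A) / 2"
begin

definition deficit_weight :: "history \<Rightarrow> real" where
  "deficit_weight h = (if real (card (A \<inter> chosen h)) < y then exp (- real (card (A \<inter> chosen h))) else 0)"

text \<open>With probability \<open>P \<ge> q\<close> all offers are unchosen edges of
  \<open>A\<close>, and the weight shrinks by the factor \<open>exp (-1)\<close> or more; in any
  other round it does not grow. Hence the factor
  \<open>1 - P * (1 - exp (-1)) \<le> 1 - q / 2 \<le> exp (- (q / 2))\<close>. The 2 inside
  \<open>q\<close> accounts for the half of \<open>A\<close> that may already be chosen.\<close>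

lemma nn_integral_round_deficit:
  assumes h: "reachable n i h" "i < n choose 2"
  shows "(\<integral>\<^sup>+h'. deficit_weight h' \<partial>round_pmf n r \<sigma> h)
     \<le> ennreal (exp (- ((real (card A) / (2 * real (n choose 2))) ^ r / 2)) * deficit_weight h)"
proof -
  define Y where "Y = card (A \<inter> chosen h)"
  define U where "U = vertex_pairs n - chosen h"
  define N where "N = n choose 2"
  define q where "q = (real (card A) / (2 * real N)) ^ r"
  have finA: "finite A" using finite_subset[OF A] by simp
  show ?thesis
  proof (cases "real Y < y")
    case False
    have "(\<integral>\<^sup>+h'. deficit_weight h' \<partial>round_pmf n r \<sigma> h) \<le> (\<integral>\<^sup>+os. 0 \<partial>offer n r h)"
    proof (rule nn_integral_round_le[OF r online h])
      fix os :: "edge list" and e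
      have "Y \<le> card (A \<inter> chosen (h @ [(os, e)]))"
        unfolding Y_def by (intro card_mono) auto
      with False show "ennreal (deficit_weight (h @ [(os, e)])) \<le> 0"
        by (simp add: deficit_weight_def)
    qed
    then show ?thesis by simp
  next
    case True
    define B where "B = {os. set os \<subseteq> A - chosen h}"
    define P where "P = measure (offer n r h) B"
    have U: "U \<noteq> {}" "finite U" "card U \<le> N"
      using free_pairs_nonempty[OF h] card_mono[of "vertex_pairs n" U]
      by (auto simp: U_def N_def card_vertex_pairs)
    have P01: "0 \<le> P" "P \<le> 1" by (auto simp: P_def)
    have AU: "U \<inter> (A - chosen h) = A - chosen h" using A by (auto simp: U_def)
    have "ennreal P = emeasure (pmf_of_set U) (A - chosen h) ^ r"
      unfolding P_def B_def offer_def U_def[symmetric] measure_pmf.emeasure_eq_measure[symmetric]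
      by (rule emeasure_replicate_pmf_subset)
    also have "\<dots> = ennreal ((real (card (A - chosen h)) / real (card U)) ^ r)"
      using U AU by (simp add: emeasure_pmf_of_set ennreal_power)
    finally have P: "P = (real (card (A - chosen h)) / real (card U)) ^ r"
      using P01 by (simp add: ennreal_inj)
    have "card (A - chosen h) = card A - Y"
      by (simp add: Y_def card_Diff_subset_Int)
    then have *: "real (card A) / 2 \<le> real (card (A - chosen h))"
      using True y by linarith
    have q: "q \<le> P"
      unfolding P q_def
    proof (rule power_mono)
      have "real (card A) / (2 * real N) = (real (card A) / 2) / real N" by simp
      also have "\<dots> \<le> real (card (A - chosen h)) / real (card U)"
        using U * by (intro frac_le) (auto simp: card_gt_0_iff)
      finally show "real (card A) / (2 * real N) \<le> real (card (A - chosen h)) / real (card U)" .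
    qed auto
    have "(\<integral>\<^sup>+h'. deficit_weight h' \<partial>round_pmf n r \<sigma> h) \<le>
      (\<integral>\<^sup>+os. ennreal (exp (- real Y) * exp (-1)) * indicator B os + ennreal (exp (- real Y)) * indicator (- B) os
         \<partial>offer n r h)"
    proof (rule nn_integral_round_le[OF r online h])
      fix os e assume os: "set os \<subseteq> vertex_pairs n - chosen h" and e: "e \<in> set os"
      show "ennreal (deficit_weight (h @ [(os, e)])) \<le>
        ennreal (exp (- real Y) * exp (-1)) * indicator B os + ennreal (exp (- real Y)) * indicator (- B) os"
      proof (cases "os \<in> B")
        case True
        then have "e \<in> A" "e \<notin> chosen h" using e os by (auto simp: B_def)
        then have "card (A \<inter> chosen (h @ [(os, e)])) = Suc Y" by (simp add: Y_def)
        with True show ?thesis by (simp add: deficit_weight_def exp_add[symmetric])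
      next
        case False
        have "Y \<le> card (A \<inter> chosen (h @ [(os, e)]))"
          unfolding Y_def by (intro card_mono) auto
        with False show ?thesis by (simp add: deficit_weight_def)
      qed
    qed
    also have "\<dots> = ennreal (exp (- real Y) * exp (-1)) * ennreal P + ennreal (exp (- real Y)) * ennreal (1 - P)"
      using measure_pmf.prob_compl[of B "offer n r h"]
      by (simp add: nn_integral_add nn_integral_cmult measure_pmf.emeasure_eq_measure P_def Compl_eq_Diff_UNIV)
    also have "\<dots> = ennreal (exp (- real Y) * (1 - P * (1 - exp (-1))))"
      using P01 by (simp add: ennreal_mult[symmetric] ennreal_plus[symmetric] algebra_simps del: ennreal_plus)
    also have "\<dots> \<le> ennreal (exp (- real Y) * exp (- (q / 2)))"
    proof (intro ennreal_leI mult_left_mono)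
      have "exp (-1) \<le> (1 / 2 :: real)"
        using exp_ge_add_one_self[of "1::real"] by (simp add: exp_minus inverse_eq_divide)
      then have "P * (1 / 2) \<le> P * (1 - exp (-1))"
        using P01 by (intro mult_left_mono) auto
      then have "1 - P * (1 - exp (-1)) \<le> 1 + (- (q / 2))" using q by linarith
      also have "\<dots> \<le> exp (- (q / 2))" by (rule exp_ge_add_one_self)
      finally show "1 - P * (1 - exp (-1)) \<le> exp (- (q / 2))" .
    qed simp
    finally show ?thesis
      using True by (simp add: deficit_weight_def Y_def q_def N_def mult.commute)
  qed
qed

lemma nn_integral_continue_deficit:
  assumes h: "reachable n i h" and "i + j \<le> n choose 2"
  shows "(\<integral>\<^sup>+h'. deficit_weight h' \<partial>continue n r \<sigma> j h)
     \<le> ennreal (exp (- (real j * (real (card A) / (2 * real (n choose 2))) ^ r / 2)))"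
  using assms(2)
proof (induction j)
  case 0
  show ?case by (simp add: deficit_weight_def)
next
  case (Suc j)
  define q where "q = (real (card A) / (2 * real (n choose 2))) ^ r"
  have "(\<integral>\<^sup>+h'. deficit_weight h' \<partial>continue n r \<sigma> (Suc j) h) =
     (\<integral>\<^sup>+h1. \<integral>\<^sup>+h'. deficit_weight h' \<partial>round_pmf n r \<sigma> h1 \<partial>continue n r \<sigma> j h)"
    by simp
  also have "\<dots> \<le> (\<integral>\<^sup>+h1. ennreal (exp (- (q / 2))) * deficit_weight h1 \<partial>continue n r \<sigma> j h)"
  proof (rule nn_integral_pmf_mono)
    fix h1 assume h1: "h1 \<in> set_pmf (continue n r \<sigma> j h)"
    have "reachable n (i + j) h1" using set_pmf_continue[OF r online h _ h1] Suc.prems by simp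
    then show "(\<integral>\<^sup>+h'. deficit_weight h' \<partial>round_pmf n r \<sigma> h1) \<le> ennreal (exp (- (q / 2))) * deficit_weight h1"
      using nn_integral_round_deficit[of "i + j" h1] Suc.prems
      by (simp add: q_def ennreal_mult')
  qed
  also have "\<dots> = ennreal (exp (- (q / 2))) * (\<integral>\<^sup>+h1. deficit_weight h1 \<partial>continue n r \<sigma> j h)"
    by (simp add: nn_integral_cmult)
  also have "\<dots> \<le> ennreal (exp (- (q / 2))) * ennreal (exp (- (real j * q / 2)))"
    using Suc by (intro mult_left_mono) (auto simp: q_def)
  also have "\<dots> = ennreal (exp (- (real (Suc j) * q / 2)))"
  proof -
    have "- (q / 2) + - (real j * q / 2) = - (real (Suc j) * q / 2)" by (simp add: field_simps)
    then show ?thesis by (subst ennreal_mult[symmetric]) (auto simp only: exp_add[symmetric] exp_ge_zero)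
  qed
  finally show ?case by (simp only: q_def)
qed

text \<open>Even a player who avoids \<open>A\<close> has to choose from it when all offered edges lie in \<open>A\<close>.
  The deviation bound comes from the exponential moment of the number of chosen edges of \<open>A\<close>,
  cut off at \<open>y\<close> because then at least half of \<open>A\<close> is still available.\<close>

lemma emeasure_few_chosen_le:
  assumes h: "reachable n i h" and "i + j \<le> n choose 2"
    and yj: "y \<le> real j * (real (card A) / (2 * real (n choose 2))) ^ r / 4"
  shows "emeasure (continue n r \<sigma> j h) {h'. real (card (A \<inter> chosen h')) < y} \<le> ennreal (exp (- y))"
proof -
  have "emeasure (continue n r \<sigma> j h) {h'. real (card (A \<inter> chosen h')) < y}
     = (\<integral>\<^sup>+h'. indicator {h'. real (card (A \<inter> chosen h')) < y} h' \<partial>continue n r \<sigma> j h)" by simp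
  also have "\<dots> \<le> (\<integral>\<^sup>+h'. ennreal (exp y) * deficit_weight h' \<partial>continue n r \<sigma> j h)"
    by (intro nn_integral_mono)
      (simp add: indicator_def deficit_weight_def flip: ennreal_mult exp_add)
  also have "\<dots> = ennreal (exp y) * (\<integral>\<^sup>+h'. deficit_weight h' \<partial>continue n r \<sigma> j h)"
    by (simp add: nn_integral_cmult)
  also have "\<dots> \<le> ennreal (exp y) * ennreal (exp (- (real j * (real (card A) / (2 * real (n choose 2))) ^ r / 2)))"
    by (intro mult_left_mono nn_integral_continue_deficit[OF assms(1,2)]) simp
  also have "\<dots> = ennreal (exp (y + - (real j * (real (card A) / (2 * real (n choose 2))) ^ r / 2)))"
    by (simp only: exp_add exp_ge_zero ennreal_mult)
  also have "\<dots> \<le> ennreal (exp (- y))"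
    using yj by (intro ennreal_leI iffD2[OF exp_le_cancel_iff]) linarith
  finally show ?thesis .
qed

end
end

section \<open>A cautious player\<close>

text \<open>Copies are counted with labels, which overcounts by a constant factor only;
  extensionality makes the set finite.\<close>

definition embeddings :: "nat \<Rightarrow> nat \<Rightarrow> (nat \<Rightarrow> nat) set" where
  "embeddings v n = {\<phi> \<in> {..<v} \<rightarrow>\<^sub>E {..<n}. inj_on \<phi> {..<v}}"

lemma finite_embeddings [simp]: "finite (embeddings v n)"
  by (rule finite_subset[of _ "{..<v} \<rightarrow>\<^sub>E {..<n}"]) (auto simp: embeddings_def intro!: finite_PiE)

lemma card_embeddings_le: "card (embeddings v n) \<le> n ^ v"
proof -
  have "card (embeddings v n) \<le> card ({..<v} \<rightarrow>\<^sub>E {..<n})"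
    by (intro card_mono finite_PiE) (auto simp: embeddings_def)
  also have "\<dots> = n ^ v" by (simp add: card_PiE)
  finally show ?thesis .
qed

section \<open>Copies lacking some edges and the pairs that complete them\<close>

locale pattern =
  fixes v :: nat and E :: "edge set"
  assumes E: "E \<subseteq> nsets {..<v} 2"
begin

lemma finite_E [simp]: "finite E"
  using E finite_subset[of E "nsets {..<v} 2"] by (simp add: finite_imp_finite_nsets)

lemma inj_on_edges: "\<phi> \<in> embeddings v n \<Longrightarrow> inj_on ((`) \<phi>) E"
  by (rule inj_on_subset[OF inj_on_image_Pow[of \<phi> "{..<v}"]])
    (use E in \<open>auto simp: embeddings_def nsets_def\<close>)

lemma edge_image_in_pairs:
  assumes "\<phi> \<in> embeddings v n" "e \<in> E"
  shows "\<phi> ` e \<in> vertex_pairs n"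
proof -
  have e: "e \<subseteq> {..<v}" "finite e" "card e = 2" using assms E by (auto simp: nsets_def)
  moreover have "inj_on \<phi> e" using assms e by (auto simp: embeddings_def intro: inj_on_subset)
  ultimately show ?thesis
    using assms by (auto simp: nsets_def embeddings_def card_image PiE_def Pi_def)
qed

lemma lost_iff: "lost ({..<v}, E) n h \<longleftrightarrow> (\<exists>\<phi>\<in>embeddings v n. (`) \<phi> ` E \<subseteq> chosen h)"
proof
  assume "lost ({..<v}, E) n h"
  then obtain H' f where H': "subgraph H' ({..<n}, chosen h)"
    and f: "bij_betw f {..<v} (fst H')" "(`) f ` E = snd H'"
    unfolding lost_def contains_copy_def graph_iso_def graph_of_def by auto
  let ?\<phi> = "restrict f {..<v}"
  have "?\<phi> ` e = f ` e" if "e \<in> E" for e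
  proof (rule image_cong)
    fix x assume "x \<in> e"
    then show "?\<phi> x = f x" using that E by (auto simp: nsets_def)
  qed simp
  then have "(`) ?\<phi> ` E = (`) f ` E" by (rule image_cong[OF refl])
  moreover have "?\<phi> \<in> embeddings v n"
    using f(1) H' by (auto simp: embeddings_def bij_betw_def subgraph_def inj_on_def)
  ultimately show "\<exists>\<phi>\<in>embeddings v n. (`) \<phi> ` E \<subseteq> chosen h"
    using H' f(2) by (intro bexI[of _ ?\<phi>]) (auto simp: subgraph_def)
next
  assume "\<exists>\<phi>\<in>embeddings v n. (`) \<phi> ` E \<subseteq> chosen h"
  then obtain \<phi> where \<phi>: "\<phi> \<in> embeddings v n" "(`) \<phi> ` E \<subseteq> chosen h" by blast
  have "(`) \<phi> ` E \<subseteq> nsets (\<phi> ` {..<v}) 2"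
  proof (rule image_subsetI)
    fix e assume "e \<in> E"
    then show "\<phi> ` e \<in> nsets (\<phi> ` {..<v}) 2"
      using E edge_image_in_pairs[OF \<phi>(1), of e] by (auto simp: nsets_def)
  qed
  then have "subgraph (\<phi> ` {..<v}, (`) \<phi> ` E) ({..<n}, chosen h)"
    using \<phi> by (auto simp: subgraph_def embeddings_def)
  moreover have "graph_iso ({..<v}, E) (\<phi> ` {..<v}, (`) \<phi> ` E)"
    using \<phi> by (auto simp: graph_iso_def embeddings_def bij_betw_def intro!: exI[of _ \<phi>])
  ultimately show "lost ({..<v}, E) n h"
    unfolding lost_def contains_copy_def graph_of_def by blast
qed

text \<open>The edges of \<open>S\<close> may be present or absent; nothing is required of them. So
  the count increases with \<open>C\<close>, at the price of counting one embedding for several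
  \<open>S\<close>.\<close>

definition partial_copies :: "nat \<Rightarrow> nat \<Rightarrow> edge set \<Rightarrow> ((nat \<Rightarrow> nat) \<times> edge set) set" where
  "partial_copies n i C =
     {(\<phi>, S). \<phi> \<in> embeddings v n \<and> S \<subseteq> E \<and> card S = i \<and> (`) \<phi> ` (E - S) \<subseteq> C}"

definition completing :: "nat \<Rightarrow> nat \<Rightarrow> edge set \<Rightarrow> edge \<Rightarrow> ((nat \<Rightarrow> nat) \<times> edge set) set" where
  "completing n i C f = partial_copies n i (insert f C) - partial_copies n i C"

definition dangerous :: "nat \<Rightarrow> nat \<Rightarrow> edge set \<Rightarrow> edge set" where
  "dangerous n i C = {f. completing n i C f \<noteq> {}}"

lemma partial_copies_subset: "partial_copies n i C \<subseteq> embeddings v n \<times> Pow E"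
  by (auto simp: partial_copies_def)

lemma finite_partial_copies [simp]: "finite (partial_copies n i C)"
  by (rule finite_subset[OF partial_copies_subset]) auto

lemma partial_copies_mono: "C \<subseteq> D \<Longrightarrow> partial_copies n i C \<subseteq> partial_copies n i D"
  by (auto simp: partial_copies_def)

lemma completingE:
  assumes "(\<phi>, S) \<in> completing n i C f"
  obtains e where "e \<in> E" "e \<notin> S" "\<phi> ` e = f" "f \<notin> C" "S \<subseteq> E" "card S = i"
    "\<phi> \<in> embeddings v n" "(`) \<phi> ` (E - insert e S) \<subseteq> C"
proof -
  from assms obtain e where e: "e \<in> E - S" "\<phi> ` e \<notin> C"
    by (auto simp: completing_def partial_copies_def)
  with assms have e2: "\<phi> ` e = f" "\<phi> \<in> embeddings v n" "S \<subseteq> E" "card S = i"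
    and sub: "(`) \<phi> ` (E - S) \<subseteq> insert f C"
    by (auto simp: completing_def partial_copies_def)
  have "(`) \<phi> ` (E - insert e S) \<subseteq> C"
  proof (rule image_subsetI)
    fix e' assume e': "e' \<in> E - insert e S"
    then have "\<phi> ` e' \<noteq> \<phi> ` e" using inj_on_edges[OF e2(2)] e by (auto simp: inj_on_eq_iff)
    with sub e' e2 show "\<phi> ` e' \<in> C" by blast
  qed
  with e e2 show ?thesis by (intro that[of e]) auto
qed

text \<open>Double counting: a pair \<open>f\<close> completing \<open>(\<phi>, S)\<close> is the
  image of an edge \<open>e\<close>, and \<open>(\<phi>, insert e S)\<close> was a partial copy
  lacking one edge more. Conversely \<open>e\<close> and this larger partial copy determine
  \<open>f\<close> and \<open>S\<close>, which gives the factor \<open>card E\<close>.\<close>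

lemma sum_card_completing_le:
  assumes "finite U"
  shows "(\<Sum>f\<in>U. card (completing n i C f)) \<le> card E * card (partial_copies n (Suc i) C)"
proof -
  have "(\<Sum>f\<in>U. card (completing n i C f)) = card (SIGMA f:U. completing n i C f)"
    using assms by (subst card_SigmaI) (auto simp: completing_def)
  also have "\<dots> \<le> card (E \<times> partial_copies n (Suc i) C)"
  proof (rule surj_card_le[where f = "\<lambda>(e, \<phi>, S). (\<phi> ` e, \<phi>, S - {e})"])
    show "(SIGMA f:U. completing n i C f) \<subseteq> (\<lambda>(e, \<phi>, S). (\<phi> ` e, \<phi>, S - {e})) ` (E \<times> partial_copies n (Suc i) C)"
    proof clarify
      fix f \<phi> S assume "(\<phi>, S) \<in> completing n i C f"
      then obtain e where e: "e \<in> E" "e \<notin> S" "\<phi> ` e = f" "f \<notin> C" "S \<subseteq> E" "card S = i"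
        "\<phi> \<in> embeddings v n" "(`) \<phi> ` (E - insert e S) \<subseteq> C" by (rule completingE)
      then have "finite S" using finite_subset[of S E] by simp
      with e have "(e, \<phi>, insert e S) \<in> E \<times> partial_copies n (Suc i) C"
        by (auto simp: partial_copies_def)
      moreover have "(f, \<phi>, S) = (\<lambda>(e, \<phi>, S). (\<phi> ` e, \<phi>, S - {e})) (e, \<phi>, insert e S)"
        using e by simp
      ultimately show "(f, \<phi>, S) \<in> (\<lambda>(e, \<phi>, S). (\<phi> ` e, \<phi>, S - {e})) ` (E \<times> partial_copies n (Suc i) C)"
        by (rule rev_image_eqI)
    qed
  qed simp
  also have "\<dots> = card E * card (partial_copies n (Suc i) C)" by (simp add: card_cartesian_product)
  finally show ?thesis .
qed

text \<open>Declare one further edge \<open>e'\<close> missing in the completed copy. This needs an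
  edge outside \<open>insert e S\<close>, which is what \<open>Suc i < card E\<close>
  provides.\<close>

lemma dangerous_Suc:
  assumes "Suc i < card E"
  shows "dangerous n i C \<subseteq> dangerous n (Suc i) C"
proof
  fix f assume "f \<in> dangerous n i C"
  then obtain \<phi> S where \<phi>S: "(\<phi>, S) \<in> completing n i C f" by (auto simp: dangerous_def)
  then obtain e where e: "e \<in> E" "e \<notin> S" "\<phi> ` e = f" "f \<notin> C" "S \<subseteq> E" "card S = i"
    "\<phi> \<in> embeddings v n" by (rule completingE)
  have fin: "finite S" using e finite_subset[of S E] by simp
  have "card (E - insert e S) > 0"
    using e fin assms by (subst card_Diff_subset) auto
  then obtain e' where e': "e' \<in> E - insert e S" by (metis card.empty less_irrefl ex_in_conv)
  have "(\<phi>, insert e' S) \<in> completing n (Suc i) C f"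
    using \<phi>S e e' fin by (auto simp: completing_def partial_copies_def)
  then show "f \<in> dangerous n (Suc i) C" by (auto simp: dangerous_def)
qed

text \<open>Nestedness lets one offer be best at all levels at once: take the largest set that does
  not contain all offers and an offer outside it. The smaller sets miss this offer too, and the
  larger ones contain every offer.\<close>

lemma exists_safest:
  assumes "X \<noteq> {}" "\<And>i. Suc i < s \<Longrightarrow> D i \<subseteq> D (Suc i)"
  shows "\<exists>e\<in>X. \<forall>i<s. e \<in> D i \<longrightarrow> X \<subseteq> D i"
  using assms
proof (induction s)
  case (Suc s)
  show ?case
  proof (cases "X \<subseteq> D s")
    case True
    then show ?thesis using Suc by (fastforce simp: less_Suc_eq)
  next
    case False
    then obtain x where x: "x \<in> X" "x \<notin> D s" by blast
    have "D i \<subseteq> D s" if "i \<le> s" for i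
      using that by (induction rule: inc_induct) (use Suc.prems in force)+
    with x show ?thesis by (intro bexI[of _ x]) (auto simp: less_Suc_eq_le)
  qed
qed auto

definition safest :: "nat \<Rightarrow> nat \<Rightarrow> edge set \<Rightarrow> edge list \<Rightarrow> edge" where
  "safest n s C os =
     (SOME e. e \<in> set os \<and> (\<forall>i<s. e \<in> dangerous n i C \<longrightarrow> set os \<subseteq> dangerous n i C))"

definition cautious_strategy :: "nat \<Rightarrow> nat \<Rightarrow> strategy" where
  "cautious_strategy n s h os = return_pmf (safest n s (chosen h) os)"

lemma safest:
  assumes "s < card E" "os \<noteq> []"
  shows "safest n s C os \<in> set os"
    and "\<And>i. i < s \<Longrightarrow> safest n s C os \<in> dangerous n i C \<Longrightarrow> set os \<subseteq> dangerous n i C"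
proof -
  have "\<exists>e\<in>set os. \<forall>i<s. e \<in> dangerous n i C \<longrightarrow> set os \<subseteq> dangerous n i C"
    using assms by (intro exists_safest dangerous_Suc) auto
  then have "\<exists>e. e \<in> set os \<and> (\<forall>i<s. e \<in> dangerous n i C \<longrightarrow> set os \<subseteq> dangerous n i C)"
    by blast
  from someI_ex[OF this]
  show "safest n s C os \<in> set os"
    and "\<And>i. i < s \<Longrightarrow> safest n s C os \<in> dangerous n i C \<Longrightarrow> set os \<subseteq> dangerous n i C"
    unfolding safest_def[symmetric] by auto
qed

lemma online_cautious_strategy: "s < card E \<Longrightarrow> online_strategy (cautious_strategy n s)"
  using safest(1) by (auto simp: online_strategy_def cautious_strategy_def)

section \<open>First moments under the cautious strategy\<close>

context
  fixes n r s m :: nat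
  assumes r: "r > 0" and s: "s < card E" and m: "m < n choose 2"
begin

abbreviation "free_pairs \<equiv> real ((n choose 2) - m)"
abbreviation "npartial i h \<equiv> real (card (partial_copies n i (chosen h)))"
abbreviation "cautious \<equiv> cautious_strategy n s"

lemma npartial_mono: "chosen h \<subseteq> chosen h' \<Longrightarrow> npartial i h \<le> npartial i h'"
  by (auto intro!: card_mono partial_copies_mono)

text \<open>If the chosen edge completes anything at level \<open>i\<close>, then by
  \<open>safest\<close> all offers lie in \<open>D\<close>. Summed over the free pairs of
  \<open>D\<close>, the number of completed copies divided by the number of free pairs is at most
  \<open>\<beta>\<close>; so is the fraction of free pairs in \<open>D\<close>, as each of them
  completes at least one copy. One weighted offer and \<open>r - 1\<close> plain ones give
  \<open>r * \<beta> ^ r\<close>.\<close>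

lemma nn_integral_round_npartial:
  assumes h: "reachable n j h" "j < m" and i: "i < s"
  shows "(\<integral>\<^sup>+h'. npartial i h' \<partial>round_pmf n r cautious h)
     \<le> ennreal (npartial i h + real r * (real (card E) * npartial (Suc i) h / free_pairs) ^ r)"
proof -
  define C where "C = chosen h"
  define U where "U = vertex_pairs n - C"
  define D where "D = dangerous n i C"
  define d where "d = (\<lambda>f. card (completing n i C f))"
  define \<beta> where "\<beta> = real (card E) * npartial (Suc i) h / free_pairs"
  have jN: "j < n choose 2" using h m by simp
  have L: "0 < free_pairs" "free_pairs \<le> real (card U)" using m card_free_pairs[OF h(1)] h by (auto simp: U_def C_def)
  have \<beta>: "0 \<le> \<beta>" by (simp add: \<beta>_def)
  have div_le: "ennreal x / of_nat (card U) \<le> ennreal \<beta>" if "0 \<le> x" "x \<le> real (card E) * npartial (Suc i) h" for x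
  proof -
    have "ennreal x / of_nat (card U) = ennreal (x / real (card U))"
      using that L by (simp add: divide_ennreal ennreal_of_nat_eq_real_of_nat)
    also have "\<dots> \<le> ennreal \<beta>"
      unfolding \<beta>_def using that L by (intro ennreal_leI frac_le) auto
    finally show ?thesis .
  qed
  have sum_d: "(\<Sum>f\<in>U \<inter> D. d f) \<le> card E * card (partial_copies n (Suc i) C)"
    unfolding d_def by (rule sum_card_completing_le) (simp add: U_def)
  have "card (U \<inter> D) = (\<Sum>f\<in>U \<inter> D. 1)" by simp
  also have "\<dots> \<le> (\<Sum>f\<in>U \<inter> D. d f)"
    by (intro sum_mono) (auto simp: d_def D_def dangerous_def completing_def Suc_le_eq card_gt_0_iff)
  finally have card_D: "card (U \<inter> D) \<le> card E * card (partial_copies n (Suc i) C)" using sum_d by simp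
  have "(\<integral>\<^sup>+h'. npartial i h' \<partial>round_pmf n r cautious h) \<le>
    (\<integral>\<^sup>+os. ennreal (npartial i h) + (\<Sum>x\<leftarrow>os. ennreal (d x)) * indicator {os. set os \<subseteq> D} os \<partial>offer n r h)"
  proof (rule nn_integral_round_le[OF r online_cautious_strategy[OF s] h(1) jN])
    fix os e assume os: "e \<in> set os" and e: "e \<in> set_pmf (cautious h os)"
    have ne: "os \<noteq> []" using os by auto
    have e: "e = safest n s C os" using e by (simp add: cautious_strategy_def C_def)
    have "partial_copies n i (insert e C) \<subseteq> partial_copies n i C \<union> completing n i C e"
      by (auto simp: completing_def)
    then have "card (partial_copies n i (insert e C)) \<le> card (partial_copies n i C) + d e"
      unfolding d_def by (intro order_trans[OF card_mono card_Un_le]) (auto simp: completing_def)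
    then have 1: "ennreal (npartial i (h @ [(os, e)])) \<le> ennreal (npartial i h) + ennreal (d e)"
      by (simp add: C_def ennreal_plus[symmetric] del: ennreal_plus)
    have "ennreal (d e) \<le> (\<Sum>x\<leftarrow>os. ennreal (d x)) * indicator {os. set os \<subseteq> D} os"
    proof (cases "e \<in> D")
      case True
      then have "set os \<subseteq> D" using safest(2)[OF s ne i, of n C] e by (simp add: D_def)
      moreover have "ennreal (d e) \<le> (\<Sum>x\<leftarrow>os. ennreal (d x))"
        using os by (intro member_le_sum_list) auto
      ultimately show ?thesis by simp
    next
      case False
      then show ?thesis by (simp add: D_def dangerous_def d_def)
    qed
    then show "ennreal (npartial i (h @ [(os, e)])) \<le>
        ennreal (npartial i h) + (\<Sum>x\<leftarrow>os. ennreal (d x)) * indicator {os. set os \<subseteq> D} os"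
      by (intro order_trans[OF 1] add_left_mono)
  qed
  also have "\<dots> = ennreal (npartial i h) +
      (\<integral>\<^sup>+os. (\<Sum>x\<leftarrow>os. ennreal (d x)) * indicator {os. set os \<subseteq> D} os \<partial>offer n r h)"
    by (simp add: nn_integral_add)
  also have "\<dots> \<le> ennreal (npartial i h) + of_nat r * ennreal \<beta> * ennreal \<beta> ^ (r - 1)"
  proof (intro add_left_mono nn_integral_offer_le[OF h(1) jN])
    have "(\<Sum>f\<in>U \<inter> D. ennreal (real (d f))) = ennreal (real (\<Sum>f\<in>U \<inter> D. d f))"
      by (simp add: sum_ennreal)
    moreover have "real (\<Sum>f\<in>U \<inter> D. d f) \<le> real (card E) * npartial (Suc i) h"
      using sum_d unfolding C_def[symmetric] of_nat_mult[symmetric] of_nat_le_iff .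
    ultimately show "(\<Sum>f\<in>(vertex_pairs n - chosen h) \<inter> D. ennreal (real (d f))) / of_nat (card (vertex_pairs n - chosen h)) \<le> ennreal \<beta>"
      using div_le[of "real (\<Sum>f\<in>U \<inter> D. d f)"] unfolding U_def[symmetric] C_def[symmetric]
      by (simp del: of_nat_sum)
    have "real (card (U \<inter> D)) \<le> real (card E) * npartial (Suc i) h"
      using card_D unfolding C_def[symmetric] of_nat_mult[symmetric] of_nat_le_iff .
    then show "of_nat (card ((vertex_pairs n - chosen h) \<inter> D)) / of_nat (card (vertex_pairs n - chosen h)) \<le> ennreal \<beta>"
      using div_le[of "real (card (U \<inter> D))"] unfolding U_def[symmetric] C_def[symmetric]
      by (simp add: ennreal_of_nat_eq_real_of_nat)
  qed
  also have "\<dots> = ennreal (npartial i h + real r * \<beta> ^ r)"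
    using r \<beta> by (cases r) (simp_all add: ennreal_of_nat_eq_real_of_nat ennreal_power ennreal_mult[symmetric]
        ennreal_plus[symmetric] mult.assoc del: ennreal_plus)
  finally show ?thesis by (simp add: \<beta>_def)
qed

text \<open>Counts never decrease, so the truncation event can only be lost, and its indicator may
  be evaluated before the round. The increments then add up from zero, since in the empty graph no
  copy lacks as few as \<open>i < card E\<close> edges.\<close>

lemma nn_integral_truncated_npartial:
  assumes "j \<le> m" "i < s" "B \<ge> 0"
  shows "(\<integral>\<^sup>+h. ennreal (npartial i h) * indicator {h. npartial (Suc i) h < B} h \<partial>achlioptas n r cautious j)
     \<le> ennreal (real j * (real r * (real (card E) * B / free_pairs) ^ r))"
  using assms(1)
proof (induction j)
  case 0
  have "partial_copies n i {} = {}"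
  proof (safe, goal_cases)
    case (1 \<phi> S)
    then have "E \<subseteq> S" "S \<subseteq> E" "card S = i" by (auto simp: partial_copies_def)
    with assms s show ?case by auto
  qed
  then show ?case by (simp add: nn_integral_return_pmf)
next
  case (Suc j)
  define \<kappa> where "\<kappa> = real r * (real (card E) * B / free_pairs) ^ r"
  let ?I = "indicator {h. npartial (Suc i) h < B} :: history \<Rightarrow> ennreal"
  have \<kappa>: "\<kappa> \<ge> 0" using assms by (simp add: \<kappa>_def)
  have "(\<integral>\<^sup>+h. ennreal (npartial i h) * ?I h \<partial>achlioptas n r cautious (Suc j)) =
     (\<integral>\<^sup>+h. \<integral>\<^sup>+h'. ennreal (npartial i h') * ?I h' \<partial>round_pmf n r cautious h \<partial>achlioptas n r cautious j)"
    by (simp add: achlioptas_Suc)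
  also have "\<dots> \<le> (\<integral>\<^sup>+h. ennreal (npartial i h) * ?I h + ennreal \<kappa> \<partial>achlioptas n r cautious j)"
  proof (rule nn_integral_pmf_mono)
    fix h assume "h \<in> set_pmf (achlioptas n r cautious j)"
    then have h: "reachable n j h"
      using set_pmf_achlioptas[OF r online_cautious_strategy[OF s]] Suc.prems m by simp
    have jm: "j < m" "j < n choose 2" using Suc.prems m by auto
    have "(\<integral>\<^sup>+h'. ennreal (npartial i h') * ?I h' \<partial>round_pmf n r cautious h) \<le>
       (\<integral>\<^sup>+h'. ennreal (npartial i h') * ?I h \<partial>round_pmf n r cautious h)"
    proof (rule nn_integral_pmf_mono)
      fix h' assume "h' \<in> set_pmf (round_pmf n r cautious h)"
      then obtain os e where "h' = h @ [(os, e)]"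
        using set_pmf_round[OF r online_cautious_strategy[OF s] h jm(2)] by blast
      then have "npartial (Suc i) h \<le> npartial (Suc i) h'" by (intro npartial_mono) auto
      then show "ennreal (npartial i h') * ?I h' \<le> ennreal (npartial i h') * ?I h"
        by (intro mult_left_mono) (auto simp: indicator_def)
    qed
    also have "\<dots> = (\<integral>\<^sup>+h'. npartial i h' \<partial>round_pmf n r cautious h) * ?I h"
      by (simp add: nn_integral_multc)
    also have "\<dots> \<le> ennreal (npartial i h + real r * (real (card E) * npartial (Suc i) h / free_pairs) ^ r) * ?I h"
      by (intro mult_right_mono nn_integral_round_npartial[OF h jm(1) assms(2)]) simp
    also have "\<dots> \<le> ennreal (npartial i h + \<kappa>) * ?I h"
    proof (cases "npartial (Suc i) h < B")
      case True
      then show ?thesis unfolding \<kappa>_def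
        by (intro mult_right_mono ennreal_leI add_left_mono mult_left_mono power_mono divide_right_mono) auto
    qed simp
    also have "\<dots> \<le> ennreal (npartial i h) * ?I h + ennreal \<kappa>"
      using \<kappa> by (simp add: indicator_def)
    finally show "(\<integral>\<^sup>+h'. ennreal (npartial i h') * ?I h' \<partial>round_pmf n r cautious h)
        \<le> ennreal (npartial i h) * ?I h + ennreal \<kappa>" .
  qed
  also have "\<dots> = (\<integral>\<^sup>+h. ennreal (npartial i h) * ?I h \<partial>achlioptas n r cautious j) + ennreal \<kappa>"
    by (simp add: nn_integral_add)
  also have "\<dots> \<le> ennreal (real j * \<kappa>) + ennreal \<kappa>"
    using Suc by (intro add_right_mono) (simp add: \<kappa>_def)
  also have "\<dots> = ennreal (real (Suc j) * \<kappa>)"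
    using \<kappa> by (simp add: ennreal_plus[symmetric] distrib_right add.commute del: ennreal_plus)
  finally show ?case by (simp only: \<kappa>_def)
qed

text \<open>At the top level caution does not help, and the bound for arbitrary strategies is used.
  The factor \<open>2 ^ card E\<close> bounds the number of sets of \<open>s\<close> missing
  edges.\<close>

lemma nn_integral_npartial_s:
  "(\<integral>\<^sup>+h. npartial s h \<partial>achlioptas n r cautious m)
     \<le> ennreal (2 ^ card E * real n ^ v * (real m * (real r / free_pairs)) ^ (card E - s))"
proof -
  define X where "X = embeddings v n \<times> {S. S \<subseteq> E \<and> card S = s}"
  define \<rho> where "\<rho> = (real m * (real r / free_pairs)) ^ (card E - s)"
  have fin: "finite X" unfolding X_def by (intro finite_cartesian_product) auto
  have "card {S. S \<subseteq> E \<and> card S = s} \<le> card (Pow E)" by (intro card_mono) auto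
  then have "card X \<le> n ^ v * 2 ^ card E"
    unfolding X_def card_cartesian_product
    by (intro mult_mono card_embeddings_le) (auto simp: card_Pow)
  then have "real (card X) \<le> real (n ^ v * 2 ^ card E)" by (rule of_nat_mono)
  then have cX: "real (card X) \<le> real n ^ v * 2 ^ card E" by simp
  have "(\<integral>\<^sup>+h. npartial s h \<partial>achlioptas n r cautious m) =
    (\<integral>\<^sup>+h. (\<Sum>(\<phi>, S)\<in>X. indicator {h. (`) \<phi> ` (E - S) \<subseteq> chosen h} h) \<partial>achlioptas n r cautious m)"
  proof (rule nn_integral_cong)
    fix h
    have "partial_copies n s (chosen h) = {x \<in> X. case x of (\<phi>, S) \<Rightarrow> (`) \<phi> ` (E - S) \<subseteq> chosen h}"
      by (auto simp: partial_copies_def X_def)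
    moreover have "(\<Sum>(\<phi>, S)\<in>X. indicator {h. (`) \<phi> ` (E - S) \<subseteq> chosen h} h :: ennreal) =
      of_nat (card {x \<in> X. case x of (\<phi>, S) \<Rightarrow> (`) \<phi> ` (E - S) \<subseteq> chosen h})"
      using fin by (simp add: indicator_def case_prod_unfold sum.If_cases Int_def)
    ultimately show "ennreal (npartial s h) = (\<Sum>(\<phi>, S)\<in>X. indicator {h. (`) \<phi> ` (E - S) \<subseteq> chosen h} h)"
      by (simp add: ennreal_of_nat_eq_real_of_nat)
  qed
  also have "\<dots> = (\<Sum>(\<phi>, S)\<in>X. emeasure (achlioptas n r cautious m) {h. (`) \<phi> ` (E - S) \<subseteq> chosen h})"
    by (simp add: nn_integral_sum case_prod_unfold)
  also have "\<dots> \<le> (\<Sum>(\<phi>, S)\<in>X. ennreal \<rho>)"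
  proof (intro sum_mono, clarify)
    fix \<phi> S assume "(\<phi>, S) \<in> X"
    then have "\<phi> \<in> embeddings v n" "S \<subseteq> E" "card S = s" by (auto simp: X_def)
    then have "card ((`) \<phi> ` (E - S)) = card E - s"
      by (subst card_image[OF inj_on_subset[OF inj_on_edges]])
        (auto intro!: card_Diff_subset finite_subset[of S E])
    then show "emeasure (achlioptas n r cautious m) {h. (`) \<phi> ` (E - S) \<subseteq> chosen h} \<le> ennreal \<rho>"
      using emeasure_subset_chosen_le[OF r online_cautious_strategy[OF s] order_refl m, of "(`) \<phi> ` (E - S)"]
      by (simp add: \<rho>_def)
  qed
  also have "\<dots> = ennreal (real (card X) * \<rho>)"
    by (simp add: \<rho>_def ennreal_of_nat_eq_real_of_nat ennreal_mult'')
  also have "\<dots> \<le> ennreal (2 ^ card E * real n ^ v * \<rho>)"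
    using cX by (intro ennreal_leI mult_right_mono) (auto simp: \<rho>_def mult.commute)
  finally show ?thesis unfolding \<rho>_def .
qed

text \<open>Descend from level \<open>s\<close>: at each level apply Markov's inequality on the
  event that the level above has stayed below its bound, and add the failure probabilities.\<close>

lemma prob_npartial_ge_le:
  assumes b: "\<And>i. i \<le> s \<Longrightarrow> b i > 0" and j: "j \<le> s"
  shows "measure (achlioptas n r cautious m) {h. b (s - j) \<le> npartial (s - j) h}
     \<le> 2 ^ card E * real n ^ v * (real m * (real r / free_pairs)) ^ (card E - s) / b s
       + (\<Sum>i<j. real m * (real r * (real (card E) * b (s - i) / free_pairs) ^ r) / b (s - Suc i))"
  using j
proof (induction j)
  case 0
  show ?case
    using markov_pmf[where b = "b s" and c = "2 ^ card E * real n ^ v * (real m * (real r / free_pairs)) ^ (card E - s)"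
        and X = "npartial s" and A = UNIV and p = "achlioptas n r cautious m"] nn_integral_npartial_s b[OF order_refl]
    by (simp del: times_divide_eq_right)
next
  case (Suc j)
  let ?i = "s - Suc j"
  have i: "Suc ?i = s - j" using Suc.prems by simp
  have "measure (achlioptas n r cautious m) {h. b ?i \<le> npartial ?i h} \<le>
    measure (achlioptas n r cautious m) ({h \<in> {h. npartial (s - j) h < b (s - j)}. b ?i \<le> npartial ?i h} \<union>
      {h. b (s - j) \<le> npartial (s - j) h})"
    by (rule measure_pmf.finite_measure_mono) auto
  also have "\<dots> \<le> measure (achlioptas n r cautious m) {h \<in> {h. npartial (s - j) h < b (s - j)}. b ?i \<le> npartial ?i h} +
      measure (achlioptas n r cautious m) {h. b (s - j) \<le> npartial (s - j) h}"
    by (rule measure_subadditive) (auto simp: measure_pmf.emeasure_eq_measure)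
  also have "\<dots> \<le> real m * (real r * (real (card E) * b (s - j) / free_pairs) ^ r) / b ?i +
      measure (achlioptas n r cautious m) {h. b (s - j) \<le> npartial (s - j) h}"
    using nn_integral_truncated_npartial[of m ?i "b (s - j)"] b[of ?i] b[of "s - j"] Suc.prems
    unfolding i by (intro add_right_mono markov_pmf) auto
  finally show ?case using Suc by simp
qed

lemma prob_lost_cautious_le:
  assumes b: "\<And>i. i \<le> s \<Longrightarrow> b i > 0" and b0: "b 0 \<le> 1"
  shows "measure (achlioptas n r cautious m) {h. lost ({..<v}, E) n h}
     \<le> 2 ^ card E * real n ^ v * (real m * (real r / free_pairs)) ^ (card E - s) / b s
       + (\<Sum>i<s. real m * (real r * (real (card E) * b (s - i) / free_pairs) ^ r) / b (s - Suc i))"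
proof -
  have "b 0 \<le> npartial 0 h" if "lost ({..<v}, E) n h" for h
  proof -
    from that obtain \<phi> where "\<phi> \<in> embeddings v n" "(`) \<phi> ` E \<subseteq> chosen h" by (auto simp: lost_iff)
    then have "(\<phi>, {}) \<in> partial_copies n 0 (chosen h)" by (auto simp: partial_copies_def)
    then have "card (partial_copies n 0 (chosen h)) > 0" by (auto simp: card_gt_0_iff)
    with b0 show ?thesis by linarith
  qed
  then have "measure (achlioptas n r cautious m) {h. lost ({..<v}, E) n h} \<le>
      measure (achlioptas n r cautious m) {h. b (s - s) \<le> npartial (s - s) h}"
    by (intro measure_pmf.finite_measure_mono) auto
  also note prob_npartial_ge_le[OF b order_refl]
  finally show ?thesis .
qed

end
end

text \<open>With \<open>g x powr (2 - \<theta>)\<close> rounds on \<open>x = n\<close> vertices, stage \<open>0\<close> is the expected number of copies of a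
  graph with \<open>v\<close> vertices and \<open>l\<close> edges, and stage \<open>i + 1\<close> is the number of rounds in which all \<open>r\<close>
  offered edges complete a copy counted by stage \<open>i\<close>. The last stage is constant exactly at the
  threshold.\<close>

primrec stage :: "nat \<Rightarrow> real \<Rightarrow> nat \<Rightarrow> nat \<Rightarrow> real \<Rightarrow> real \<Rightarrow> nat \<Rightarrow> real" where
  "stage r \<theta> v l x g 0 = x ^ v * (g * x powr (- \<theta>)) ^ l"
| "stage r \<theta> v l x g (Suc i) = g * x powr (2 - \<theta>) * (stage r \<theta> v l x g i / x ^ 2) ^ r"

lemma stage_pos: "x > 0 \<Longrightarrow> g > 0 \<Longrightarrow> stage r \<theta> v l x g i > 0"
  by (induction i) auto

text \<open>The exponent of \<open>x\<close> obeys
  \<open>e (i + 1) = (2 - \<theta>) + r * (e i - 2)\<close> with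
  \<open>e 0 = v - \<theta> * l\<close>, and that of \<open>g\<close> obeys
  \<open>a (i + 1) = r * a i + 1\<close> with \<open>a 0 = l\<close>; both recursions are solved
  here.\<close>

lemma stage_eq:
  assumes "x > 0" "g > 0"
  shows "stage r \<theta> v l x g i = g ^ (l * r ^ i + (\<Sum>j<i. r ^ j)) *
    x powr (real r ^ i * (real v - \<theta> * real l) - \<theta> * (\<Sum>j<i. real r ^ j) - 2 * (real r ^ i - 1))"
proof (induction i)
  case 0
  show ?case
    using assms by (simp add: power_mult_distrib powr_diff powr_minus powr_powr[symmetric] powr_realpow
        field_simps flip: powr_realpow)
next
  case (Suc i)
  define e where "e = real r ^ i * (real v - \<theta> * real l) - \<theta> * (\<Sum>j<i. real r ^ j) - 2 * (real r ^ i - 1)"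
  define a where "a = l * r ^ i + (\<Sum>j<i. r ^ j)"
  have a: "Suc (a * r) = l * r ^ Suc i + (\<Sum>j<Suc i. r ^ j)"
    by (simp add: a_def sum.lessThan_Suc_shift sum_distrib_left algebra_simps del: sum.lessThan_Suc)
  have s: "(\<Sum>j<Suc i. real r ^ j) = 1 + real r * (\<Sum>j<i. real r ^ j)"
    by (simp add: sum.lessThan_Suc_shift sum_distrib_left del: sum.lessThan_Suc)
  have e: "(2 - \<theta>) + real r * (e - 2) = real r ^ Suc i * (real v - \<theta> * real l)
      - \<theta> * (\<Sum>j<Suc i. real r ^ j) - 2 * (real r ^ Suc i - 1)"
    unfolding s by (simp add: e_def algebra_simps)
  have "stage r \<theta> v l x g (Suc i) = g * x powr (2 - \<theta>) * (g ^ a * (x powr e / x powr 2)) ^ r"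
    using assms Suc by (simp add: a_def e_def)
  also have "\<dots> = g ^ Suc (a * r) * (x powr (2 - \<theta>) * (x powr (e - 2)) ^ r)"
    using assms by (simp add: power_mult_distrib power_mult powr_diff power_divide)
  also have "(x powr (e - 2)) ^ r = x powr (real r * (e - 2))"
    using assms by (simp add: powr_powr mult.commute flip: powr_realpow)
  also have "x powr (2 - \<theta>) * x powr (real r * (e - 2)) = x powr ((2 - \<theta>) + real r * (e - 2))"
    by (simp add: powr_add)
  finally show ?case unfolding e a .
qed

text \<open>The exponent of \<open>x\<close> in \<open>stage_eq\<close> vanishes at stage
  \<open>s\<close>; the equation is written without dividing by the denominator of
  \<open>\<theta>\<close>.\<close>

definition balanced_exponent :: "nat \<Rightarrow> nat \<Rightarrow> nat \<Rightarrow> nat \<Rightarrow> real \<Rightarrow> bool" where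
  "balanced_exponent r v l s \<theta> \<longleftrightarrow>
     \<theta> * (real r ^ s * real l + (\<Sum>j<s. real r ^ j)) = real r ^ s * (real v - 2) + 2"

lemma stage_last:
  assumes "x > 0" "g > 0" "balanced_exponent r v l s \<theta>"
  shows "stage r \<theta> v l x g s = g ^ (l * r ^ s + (\<Sum>j<s. r ^ j))"
proof -
  have "real r ^ s * (real v - \<theta> * real l) - \<theta> * (\<Sum>j<s. real r ^ j) - 2 * (real r ^ s - 1) = 0"
    using assms(3) by (simp add: balanced_exponent_def algebra_simps)
  then show ?thesis using assms by (simp add: stage_eq)
qed

lemma real_choose_two: "real (n choose 2) = real n * (real n - 1) / 2"
  by (cases n) (simp_all add: choose_two real_of_nat_div algebra_simps)

lemma eventually_pairs_ge: "\<forall>\<^sub>F n in sequentially. real n ^ 2 / 4 \<le> real (n choose 2)"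
proof -
  have "real n ^ 2 / 4 \<le> real (n choose 2)" if "n \<ge> 2" for n
  proof -
    have "real n * 2 \<le> real n * real n" using that by (intro mult_left_mono) auto
    then show ?thesis by (simp add: real_choose_two power2_eq_square algebra_simps)
  qed
  then show ?thesis by (auto intro: eventually_sequentiallyI[of 2])
qed

lemma pairs_le: "real (n choose 2) \<le> real n ^ 2 / 2"
proof -
  have "real (n choose 2) \<le> real (n * (n - 1)) / 2"
    using of_nat_div_le_of_nat[of "n * (n - 1)" 2, where 'a = real] by (simp add: choose_two)
  also have "real (n * (n - 1)) \<le> real (n * n)"
    by (intro of_nat_mono mult_left_mono) auto
  finally show ?thesis by (simp add: power2_eq_square)
qed

section \<open>Survival below the threshold\<close>

context pattern
begin

text \<open>The bounds \<open>b i\<close> are the stages for \<open>g * M\<close> rounds, while the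
  game has at most \<open>g^2 * M\<close> rounds. The spare factor \<open>g\<close> enters every
  term of \<open>prob_lost_cautious_le\<close>, and all of them tend to 0.\<close>

lemma cautious_player_survives:
  fixes m :: "nat \<Rightarrow> nat"
  assumes r: "r > 0" and s: "s < card E" and \<theta>: "0 \<le> \<theta>" "\<theta> < 2"
    and bal: "balanced_exponent r v (card E - s) s \<theta>"
    and small: "(\<lambda>n. real (m n)) \<in> o(\<lambda>n. real n powr (2 - \<theta>))"
  shows "(\<lambda>n. prob_survive ({..<v}, E) r (cautious_strategy n s) (m n) n) \<longlonglongrightarrow> 1"
proof -
  define k where "k = card E"
  define l where "l = k - s"
  define M where "M = (\<lambda>n::nat. real n powr (2 - \<theta>))"
  \<comment> \<open>The square root provides the spare factor: \<open>g\<close> tends to 0 and still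
    \<open>m \<le> g^2 * M\<close>. Adding 1 keeps \<open>g\<close> positive when
    \<open>m n = 0\<close>, as \<open>stage_pos\<close> requires.\<close>
  define g where "g = (\<lambda>n. sqrt ((real (m n) + 1) / M n))"
  have "(\<lambda>n. real (m n) / M n) \<longlonglongrightarrow> 0"
    using small unfolding M_def by (rule smalloD_tendsto)
  moreover have "(\<lambda>n. 1 / M n) \<longlonglongrightarrow> 0"
    unfolding M_def using \<theta> by real_asymp
  ultimately have "(\<lambda>n. real (m n) / M n + 1 / M n) \<longlonglongrightarrow> 0 + 0" by (rule tendsto_add)
  then have g0: "g \<longlonglongrightarrow> 0"
    using tendsto_real_sqrt[of "\<lambda>n. real (m n) / M n + 1 / M n" 0] by (simp add: g_def add_divide_distrib)
  \<comment> \<open>With at least \<open>x^2 / 4\<close> pairs and at most \<open>x^2 / 8\<close>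
    rounds, at least \<open>x^2 / 8\<close> pairs stay free.\<close>
  have ev_m: "\<forall>\<^sub>F n in sequentially. real (m n) \<le> (1/8) * M n"
    using landau_o.smallD[OF small, of "1/8"] by (simp add: M_def)
  have ev_g: "\<forall>\<^sub>F n in sequentially. g n < 1"
    using g0 by (rule order_tendstoD) simp
  define F where "F = (\<lambda>n. 2 ^ k * (8 * real r * g n) ^ l + real s * (real r * g n * (8 * real k) ^ r))"
  have "F \<longlonglongrightarrow> 2 ^ k * (8 * real r * 0) ^ l + real s * (real r * 0 * (8 * real k) ^ r)"
    unfolding F_def by (intro tendsto_intros g0)
  \<comment> \<open>The exponent \<open>l\<close> is positive because \<open>s < card E\<close>; for
    \<open>l = 0\<close> the first term would be the constant \<open>2 ^ k\<close>.\<close>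
  then have F0: "F \<longlonglongrightarrow> 0" using s by (simp add: l_def k_def power_0_left)
  have bound: "\<forall>\<^sub>F n in sequentially. prob_lose ({..<v}, E) r (cautious_strategy n s) (m n) n \<le> F n"
    using ev_m ev_g eventually_pairs_ge eventually_gt_at_top[of 0]
  proof eventually_elim
    case (elim n)
    define x where "x = real n"
    define G where "G = g n"
    define L where "L = real ((n choose 2) - m n)"
    have x: "x \<ge> 1" using elim by (simp add: x_def)
    have Mx: "M n = x powr (2 - \<theta>)" "0 < M n" using x by (simp_all add: M_def x_def)
    have "M n \<le> x powr 2" unfolding Mx using x \<theta> by (intro powr_mono) auto
    then have mx: "real (m n) \<le> x ^ 2 / 8" using elim x by simp
    have x2: "x ^ 2 / 4 \<le> real (n choose 2)" using elim by (simp add: x_def)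
    have "x ^ 2 > 0" using x by simp
    then have mN: "m n < n choose 2" using mx x2 by linarith
    then have L: "x ^ 2 / 8 \<le> L" using mx x2 by (simp add: L_def of_nat_diff)
    have L0: "L > 0" using L \<open>x ^ 2 > 0\<close> by linarith
    have G: "G > 0" "G < 1" "G ^ 2 = (real (m n) + 1) / M n"
      using Mx elim by (auto simp: G_def g_def divide_pos_pos)
    then have mG: "real (m n) \<le> G ^ 2 * M n" using Mx by (simp add: field_simps)
    define b where "b = (\<lambda>i. stage r \<theta> v l x G (s - i))"
    have b: "b i > 0" for i unfolding b_def using x G by (intro stage_pos) auto
    have "b 0 \<le> 1"
      using stage_last[of x G r v l s \<theta>] bal x G by (simp add: b_def l_def k_def power_le_one)
    from prob_lost_cautious_le[OF r s mN, of b, OF b this]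
    have "prob_lose ({..<v}, E) r (cautious_strategy n s) (m n) n \<le>
      2 ^ k * x ^ v * (real (m n) * (real r / L)) ^ l / b s +
      (\<Sum>i<s. real (m n) * (real r * (real k * b (s - i) / L) ^ r) / b (s - Suc i))"
      by (simp add: prob_lose_def k_def l_def x_def L_def)
    also have "\<dots> \<le> 2 ^ k * (8 * real r * G) ^ l + (\<Sum>i<s. real r * G * (8 * real k) ^ r)"
    proof (intro add_mono sum_mono)
      have "x powr (2 - \<theta>) = x ^ 2 * x powr (- \<theta>)"
        using x by (simp add: powr_diff powr_minus field_simps)
      with mG Mx have "real (m n) \<le> 8 * (x ^ 2 / 8) * (G * x powr (- \<theta>)) * G"
        by (simp add: power2_eq_square algebra_simps)
      also have "\<dots> \<le> 8 * L * (G * x powr (- \<theta>)) * G"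
        using L L0 G by (intro mult_mono) auto
      finally have "real (m n) * (real r / L) \<le> (8 * L * (G * x powr (- \<theta>)) * G) * (real r / L)"
        using L0 by (intro mult_right_mono) auto
      also have "\<dots> = (G * x powr (- \<theta>)) * (8 * real r * G)" using L0 by simp
      finally have "(real (m n) * (real r / L)) ^ l \<le> ((G * x powr (- \<theta>)) * (8 * real r * G)) ^ l"
        using L0 by (intro power_mono) auto
      then have "2 ^ k * x ^ v * (real (m n) * (real r / L)) ^ l \<le>
          2 ^ k * x ^ v * ((G * x powr (- \<theta>)) * (8 * real r * G)) ^ l"
        using x by (intro mult_left_mono) auto
      also have "\<dots> = 2 ^ k * (8 * real r * G) ^ l * b s"
        by (simp add: b_def power_mult_distrib)
      finally show "2 ^ k * x ^ v * (real (m n) * (real r / L)) ^ l / b s \<le> 2 ^ k * (8 * real r * G) ^ l"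
        using b by (simp add: pos_divide_le_eq)
    next
      fix i assume "i \<in> {..<s}"
      then have i: "s - (s - i) = i" "s - (s - Suc i) = Suc i" by auto
      define w where "w = stage r \<theta> v l x G i"
      have w: "w > 0" unfolding w_def using x G by (intro stage_pos) auto
      have bw: "b (s - i) = w" "b (s - Suc i) = G * M n * (w / x ^ 2) ^ r"
        using i by (simp_all add: b_def w_def Mx)
      have "1 / L \<le> 8 / x ^ 2" using frac_le[of 1 1 "x ^ 2 / 8" L] L \<open>x ^ 2 > 0\<close> by simp
      then have "real k * w * (1 / L) \<le> real k * w * (8 / x ^ 2)"
        using w by (intro mult_left_mono) auto
      then have "real k * w / L \<le> 8 * real k * (w / x ^ 2)" by (simp add: mult_ac)
      then have "(real k * w / L) ^ r \<le> (8 * real k * (w / x ^ 2)) ^ r"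
        using w L0 by (intro power_mono) auto
      then have "real (m n) * (real r * (real k * w / L) ^ r) \<le>
         (G ^ 2 * M n) * (real r * (8 * real k * (w / x ^ 2)) ^ r)"
        using mG L0 w by (intro mult_mono) auto
      also have "\<dots> = (real r * G * (8 * real k) ^ r) * (G * M n * (w / x ^ 2) ^ r)"
        by (simp add: power_mult_distrib power2_eq_square power_divide)
      finally show "real (m n) * (real r * (real k * b (s - i) / L) ^ r) / b (s - Suc i) \<le>
          real r * G * (8 * real k) ^ r"
        using b[of "s - Suc i"] unfolding bw by (simp only: pos_divide_le_eq)
    qed
    also have "\<dots> = F n" by (simp add: F_def G_def)
    finally show ?case .
  qed
  have lose0: "(\<lambda>n. prob_lose ({..<v}, E) r (cautious_strategy n s) (m n) n) \<longlonglongrightarrow> 0"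
    by (rule tendsto_sandwich[OF _ bound tendsto_const F0]) (simp add: prob_lose_def)
  have "prob_survive ({..<v}, E) r (cautious_strategy n s) (m n) n =
      1 - prob_lose ({..<v}, E) r (cautious_strategy n s) (m n) n" for n
    unfolding prob_survive_def prob_lose_def
    by (subst measure_pmf.prob_compl[symmetric]) (auto intro!: arg_cong2[where f = measure])
  then show ?thesis using tendsto_diff[OF tendsto_const[of 1] lose0] by simp
qed

end

section \<open>Second moments\<close>

text \<open>Values taken less than half as often as \<open>card X / N\<close> account for at most
  half of \<open>X\<close>. On the others Cauchy-Schwarz compares the sum of the multiplicities
  \<open>d\<close> with the sum of their squares, which counts colliding pairs: few collisions force
  many popular values.\<close>

lemma popular_values:
  fixes f :: "'a \<Rightarrow> 'b" and N :: real
  assumes "finite X" "finite T" "f ` X \<subseteq> T" "real (card T) \<le> N" "N > 0"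
  defines "d \<equiv> \<lambda>t. real (card {x \<in> X. f x = t})"
  shows "real (card X) ^ 2 \<le> 4 * real (card {t \<in> T. real (card X) \<le> 2 * N * d t}) *
           real (card {(x, x') \<in> X \<times> X. f x = f x'})"
proof -
  define A where "A = {t \<in> T. real (card X) \<le> 2 * N * d t}"
  have A: "A \<subseteq> T" "finite A" using assms(2) by (auto simp: A_def)
  have "card X = (\<Sum>t\<in>T. card {x \<in> X. f x = t})"
    using assms(1-3) sum.group[of X T f "\<lambda>_. 1 :: nat"] by simp
  then have "real (card X) = (\<Sum>t\<in>T. d t)" by (simp add: d_def)
  also have "\<dots> = (\<Sum>t\<in>T - A. d t) + (\<Sum>t\<in>A. d t)"
    using A assms(2) by (intro sum.subset_diff) auto
  also have "(\<Sum>t\<in>T - A. d t) \<le> (\<Sum>t\<in>T - A. real (card X) / (2 * N))"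
    using assms(5) by (intro sum_mono) (auto simp: A_def field_simps)
  also have "\<dots> = real (card (T - A)) * (real (card X) / (2 * N))" by simp
  also have "\<dots> \<le> N * (real (card X) / (2 * N))"
    using assms(2,4,5) card_mono[of T "T - A"] by (intro mult_right_mono) auto
  also have "\<dots> = real (card X) / 2" using assms(5) by simp
  finally have half: "real (card X) \<le> 2 * (\<Sum>t\<in>A. d t)" by simp
  have "(\<Sum>t\<in>A. (d t) ^ 2) \<le> (\<Sum>t\<in>T. (d t) ^ 2)"
    using A assms(2) by (intro sum_mono2) auto
  also have "\<dots> = real (card (SIGMA t:T. {x \<in> X. f x = t} \<times> {x \<in> X. f x = t}))"
    using assms(1,2) by (simp add: d_def power2_eq_square card_cartesian_product)
  also have "card (SIGMA t:T. {x \<in> X. f x = t} \<times> {x \<in> X. f x = t}) = card {(x, x') \<in> X \<times> X. f x = f x'}"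
    using assms(3) by (intro bij_betw_same_card[where f = snd])
      (auto simp: bij_betw_def inj_on_def image_iff)
  finally have squares: "(\<Sum>t\<in>A. (d t) ^ 2) \<le> real (card {(x, x') \<in> X \<times> X. f x = f x'})" .
  have "real (card X) ^ 2 \<le> (2 * (\<Sum>t\<in>A. d t)) ^ 2"
    using half by (intro power_mono) auto
  also have "\<dots> = 4 * (\<Sum>t\<in>A. d t * 1) ^ 2" by (simp add: power_mult_distrib)
  also have "\<dots> \<le> 4 * ((\<Sum>t\<in>A. (d t) ^ 2) * (\<Sum>t\<in>A. 1 ^ 2))"
    by (intro mult_left_mono Cauchy_Schwarz_ineq_sum) auto
  also have "\<dots> = 4 * real (card A) * (\<Sum>t\<in>A. (d t) ^ 2)" by simp
  also have "\<dots> \<le> 4 * real (card A) * real (card {(x, x') \<in> X \<times> X. f x = f x'})"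
    using squares by (intro mult_left_mono) auto
  finally show ?thesis unfolding A_def .
qed

text \<open>Most points have at most twice the average number of conflicts, and a maximal
  conflict-free set of such points must be in conflict with all of them.\<close>

lemma conflict_free_subset:
  assumes "finite X" "\<And>x. x \<in> X \<Longrightarrow> Q x x" "\<And>x y. Q x y \<Longrightarrow> Q y x"
  shows "\<exists>Y\<subseteq>X. (\<forall>x\<in>Y. \<forall>y\<in>Y. Q x y \<longrightarrow> x = y) \<and>
           (card X) ^ 2 \<le> 4 * card {(x, x') \<in> X \<times> X. Q x x'} * card Y"
proof (cases "X = {}")
  case False
  define deg where "deg = (\<lambda>x. card {x' \<in> X. Q x x'})"
  define K where "K = card {(x, x') \<in> X \<times> X. Q x x'}"
  define B where "B = {x \<in> X. deg x * card X \<le> 2 * K}"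
  have "K = card (SIGMA x:X. {x' \<in> X. Q x x'})"
    unfolding K_def by (rule arg_cong[where f = card]) blast
  then have K: "K = (\<Sum>x\<in>X. deg x)" unfolding deg_def using assms(1) by (subst (asm) card_SigmaI) auto
  obtain x0 where "x0 \<in> X" using False by blast
  then have "(x0, x0) \<in> {(x, x') \<in> X \<times> X. Q x x'}" by (simp add: assms(2))
  moreover have "finite {(x, x') \<in> X \<times> X. Q x x'}"
    by (rule finite_subset[of _ "X \<times> X"]) (use assms(1) in auto)
  ultimately have K0: "K > 0" by (auto simp: K_def card_gt_0_iff)
  have "card (X - B) * (2 * K) = (\<Sum>x\<in>X - B. 2 * K)" by simp
  also have "\<dots> \<le> (\<Sum>x\<in>X - B. deg x * card X)"
    by (intro sum_mono) (auto simp: B_def)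
  also have "\<dots> \<le> (\<Sum>x\<in>X. deg x * card X)" using assms(1) by (intro sum_mono2) auto
  also have "\<dots> = K * card X" by (simp add: K sum_distrib_right)
  finally have "2 * card (X - B) \<le> card X" using K0 by simp
  moreover have "card (X - B) = card X - card B"
    using assms(1) by (intro card_Diff_subset) (auto simp: B_def)
  ultimately have B: "card X \<le> 2 * card B" by simp
  define I where "I = {Y. Y \<subseteq> B \<and> (\<forall>x\<in>Y. \<forall>y\<in>Y. Q x y \<longrightarrow> x = y)}"
  have "finite I" by (rule finite_subset[of I "Pow X"]) (use assms(1) in \<open>auto simp: I_def B_def\<close>)
  moreover have "{} \<in> I" by (auto simp: I_def)
  ultimately obtain Y where Y: "Y \<in> I" and max: "\<And>Z. Z \<in> I \<Longrightarrow> Y \<subseteq> Z \<Longrightarrow> Y = Z"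
    using finite_has_maximal[of I] by blast
  have "B \<subseteq> (\<Union>y\<in>Y. {x' \<in> X. Q y x'})"
  proof
    fix x assume x: "x \<in> B"
    show "x \<in> (\<Union>y\<in>Y. {x' \<in> X. Q y x'})"
    proof (rule ccontr)
      assume no: "x \<notin> (\<Union>y\<in>Y. {x' \<in> X. Q y x'})"
      with x have "\<not> Q y x" if "y \<in> Y" for y using that by (auto simp: B_def)
      with x Y assms(3) have "insert x Y \<in> I" by (auto simp: I_def)
      with max have "x \<in> Y" by blast
      with no x assms(2) show False by (auto simp: B_def)
    qed
  qed
  then have "card B \<le> card (\<Union>y\<in>Y. {x' \<in> X. Q y x'})"
    using assms(1) Y by (intro card_mono) (auto simp: I_def B_def intro: finite_subset)
  also have "\<dots> \<le> (\<Sum>y\<in>Y. deg y)"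
    unfolding deg_def using assms(1) Y by (intro card_UN_le) (auto simp: I_def B_def intro: finite_subset)
  finally have "card B * card X \<le> (\<Sum>y\<in>Y. deg y) * card X" by simp
  also have "\<dots> \<le> (\<Sum>y\<in>Y. 2 * K)"
    unfolding sum_distrib_right using Y by (intro sum_mono) (auto simp: I_def B_def)
  finally have "2 * (card B * card X) \<le> 4 * K * card Y" by (simp add: mult_ac)
  moreover have "card X * card X \<le> 2 * card B * card X" using B by (rule mult_right_mono) simp
  ultimately have "(card X) ^ 2 \<le> 4 * K * card Y" unfolding power2_eq_square by linarith
  with Y show ?thesis unfolding K_def by (intro exI[of _ Y]) (auto simp: I_def B_def)
qed auto

text \<open>Boundedness in probability: one constant \<open>c\<close> serves all large
  \<open>n\<close>, but it may depend on the failure probability \<open>\<delta>\<close>. A smaller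
  \<open>c\<close> is meant to be the weaker demand; this is not built in and is supplied where two
  constants are merged.\<close>

definition tight :: "(nat \<Rightarrow> 'a pmf) \<Rightarrow> (nat \<Rightarrow> real \<Rightarrow> 'a \<Rightarrow> bool) \<Rightarrow> bool" where
  "tight p R \<longleftrightarrow> (\<forall>\<delta>>0. \<exists>c>0. \<forall>\<^sub>F n in sequentially. measure (p n) {x. \<not> R n c x} \<le> \<delta>)"

lemma tight_bounded_expectation:
  fixes X :: "nat \<Rightarrow> 'a \<Rightarrow> real" and p :: "nat \<Rightarrow> 'a pmf"
  assumes "\<forall>\<^sub>F n in sequentially. (\<integral>\<^sup>+x. X n x \<partial>p n) \<le> ennreal (C * w n)"
    and w: "\<forall>\<^sub>F n in sequentially. w n > 0" and C: "C > 0"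
  shows "tight p (\<lambda>n c x. X n x \<le> w n / c)"
  unfolding tight_def
proof (intro allI impI)
  fix \<delta> :: real assume \<delta>: "\<delta> > 0"
  have "\<forall>\<^sub>F n in sequentially. measure (p n) {x. \<not> X n x \<le> w n / (\<delta> / C)} \<le> \<delta>"
    using assms(1) w
  proof eventually_elim
    case (elim n)
    have "measure (p n) {x. \<not> X n x \<le> w n / (\<delta> / C)} \<le> measure (p n) {x \<in> UNIV. w n / (\<delta> / C) \<le> X n x}"
      by (intro measure_pmf.finite_measure_mono) auto
    also have "\<dots> \<le> C * w n / (w n / (\<delta> / C))"
      using elim C \<delta> by (intro markov_pmf) auto
    also have "\<dots> = \<delta>" using elim C by simp
    finally show ?case .
  qed
  then show "\<exists>c>0. \<forall>\<^sub>F n in sequentially. measure (p n) {x. \<not> X n x \<le> w n / c} \<le> \<delta>"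
    using \<delta> C by (intro exI[of _ "\<delta> / C"]) auto
qed

lemma tight_conj:
  assumes "tight p R" "tight p R'"
    and mono: "\<forall>\<^sub>F n in sequentially. \<forall>c c' x. 0 < c' \<longrightarrow> c' \<le> c \<longrightarrow> R n c x \<longrightarrow> R n c' x"
    and mono': "\<forall>\<^sub>F n in sequentially. \<forall>c c' x. 0 < c' \<longrightarrow> c' \<le> c \<longrightarrow> R' n c x \<longrightarrow> R' n c' x"
  shows "tight p (\<lambda>n c x. R n c x \<and> R' n c x)"
  unfolding tight_def
proof (intro allI impI)
  fix \<delta> :: real assume "\<delta> > 0"
  then have \<delta>: "\<delta> / 2 > 0" by simp
  obtain c where c: "c > 0" "\<forall>\<^sub>F n in sequentially. measure (p n) {x. \<not> R n c x} \<le> \<delta> / 2"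
    using assms(1) \<delta> unfolding tight_def by blast
  obtain c' where c': "c' > 0" "\<forall>\<^sub>F n in sequentially. measure (p n) {x. \<not> R' n c' x} \<le> \<delta> / 2"
    using assms(2) \<delta> unfolding tight_def by blast
  define c0 where "c0 = min c c'"
  have "\<forall>\<^sub>F n in sequentially. measure (p n) {x. \<not> (R n c0 x \<and> R' n c0 x)} \<le> \<delta>"
    using c(2) c'(2) mono mono'
  proof eventually_elim
    case (elim n)
    have "0 < c0" "c0 \<le> c" "c0 \<le> c'" using c(1) c'(1) by (auto simp: c0_def)
    then have "measure (p n) {x. \<not> (R n c0 x \<and> R' n c0 x)} \<le> measure (p n) ({x. \<not> R n c x} \<union> {x. \<not> R' n c' x})"
      using elim(3,4) by (intro measure_pmf.finite_measure_mono) auto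
    also have "\<dots> \<le> measure (p n) {x. \<not> R n c x} + measure (p n) {x. \<not> R' n c' x}"
      by (rule measure_subadditive) (auto simp: measure_pmf.emeasure_eq_measure)
    finally show ?case using elim by simp
  qed
  then show "\<exists>c>0. \<forall>\<^sub>F n in sequentially. measure (p n) {x. \<not> (R n c x \<and> R' n c x)} \<le> \<delta>"
    using c c' by (intro exI[of _ c0]) (auto simp: c0_def)
qed

lemma measure_bind_pmf_le:
  fixes p :: "'a pmf" and q :: "'a \<Rightarrow> 'b pmf"
  assumes "\<delta> \<ge> 0" "\<And>x. x \<in> set_pmf p \<Longrightarrow> R x \<Longrightarrow> measure (q x) B \<le> \<delta>"
  shows "measure_pmf.prob (p \<bind> q) B \<le> measure p {x. \<not> R x} + \<delta>"
proof -
  have "emeasure (measure_pmf (p \<bind> q)) B = (\<integral>\<^sup>+x. emeasure (q x) B \<partial>p)"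
    by (simp add: emeasure_bind_pmf)
  also have "\<dots> \<le> (\<integral>\<^sup>+x. indicator {x. \<not> R x} x + ennreal \<delta> \<partial>p)"
  proof (rule nn_integral_pmf_mono)
    fix x assume x: "x \<in> set_pmf p"
    show "emeasure (q x) B \<le> indicator {x. \<not> R x} x + ennreal \<delta>"
    proof (cases "R x")
      case True
      with assms x show ?thesis by (simp add: measure_pmf.emeasure_eq_measure)
    next
      case False
      have "emeasure (q x) B \<le> 1" by (rule measure_pmf.emeasure_le_1)
      with False show ?thesis by (simp add: add_increasing2)
    qed
  qed
  also have "\<dots> = ennreal (measure p {x. \<not> R x} + \<delta>)"
    using assms(1) by (simp add: nn_integral_add measure_pmf.emeasure_eq_measure)
  finally show ?thesis
    using assms(1) by (simp add: measure_pmf.emeasure_eq_measure ennreal_plus[symmetric] del: ennreal_plus)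
qed

text \<open>The order of quantifiers is essential: \<open>c'\<close> depends on \<open>c\<close> but
  not on \<open>\<delta>\<close>. Half of the failure probability fixes \<open>c\<close>, and then
  the other half can be demanded of the continuation with the same \<open>c'\<close>.\<close>

lemma tight_bind:
  fixes p :: "nat \<Rightarrow> 'a pmf" and q :: "nat \<Rightarrow> 'a \<Rightarrow> 'b pmf"
  assumes "tight p R"
    and "\<And>c. c > 0 \<Longrightarrow> \<exists>c'>0. \<forall>\<delta>>0. \<forall>\<^sub>F n in sequentially. \<forall>x\<in>set_pmf (p n). R n c x \<longrightarrow>
           measure (q n x) {y. \<not> R' n c' y} \<le> \<delta>"
  shows "tight (\<lambda>n. p n \<bind> q n) R'"
  unfolding tight_def
proof (intro allI impI)
  fix \<delta> :: real assume "\<delta> > 0"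
  then have \<delta>: "\<delta> / 2 > 0" by simp
  obtain c where c: "c > 0" "\<forall>\<^sub>F n in sequentially. measure (p n) {x. \<not> R n c x} \<le> \<delta> / 2"
    using assms(1) \<delta> unfolding tight_def by blast
  obtain c' where c': "c' > 0" "\<forall>\<delta>>0. \<forall>\<^sub>F n in sequentially. \<forall>x\<in>set_pmf (p n). R n c x \<longrightarrow>
           measure (q n x) {y. \<not> R' n c' y} \<le> \<delta>" using assms(2)[OF c(1)] by blast
  from c'(2) \<delta> have "\<forall>\<^sub>F n in sequentially. \<forall>x\<in>set_pmf (p n). R n c x \<longrightarrow>
           measure (q n x) {y. \<not> R' n c' y} \<le> \<delta> / 2" by blast
  with c(2) have "\<forall>\<^sub>F n in sequentially. measure_pmf.prob (p n \<bind> q n) {y. \<not> R' n c' y} \<le> \<delta>"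
  proof eventually_elim
    case (elim n)
    have "measure_pmf.prob (p n \<bind> q n) {y. \<not> R' n c' y} \<le> measure (p n) {x. \<not> R n c x} + \<delta> / 2"
      using elim \<delta> by (intro measure_bind_pmf_le) auto
    with elim show ?case by simp
  qed
  with c' show "\<exists>c>0. \<forall>\<^sub>F n in sequentially. measure_pmf.prob (p n \<bind> q n) {y. \<not> R' n c y} \<le> \<delta>" by blast
qed

section \<open>Pairs of overlapping copies\<close>

context pattern
begin

definition copies :: "nat \<Rightarrow> edge set \<Rightarrow> edge set \<Rightarrow> (nat \<Rightarrow> nat) set" where
  "copies n F C = {\<phi> \<in> embeddings v n. (`) \<phi> ` F \<subseteq> C}"

definition conflicts :: "nat \<Rightarrow> edge set \<Rightarrow> edge set \<Rightarrow> edge set \<Rightarrow> ((nat \<Rightarrow> nat) \<times> (nat \<Rightarrow> nat)) set" where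
  "conflicts n K F C = {(\<phi>, \<psi>) \<in> copies n F C \<times> copies n F C. \<exists>e\<in>K. \<phi> ` e = \<psi> ` e}"

lemma finite_copies [simp]: "finite (copies n F C)"
  by (rule finite_subset[of _ "embeddings v n"]) (auto simp: copies_def)

definition overlap :: "(nat \<Rightarrow> nat) \<Rightarrow> (nat \<Rightarrow> nat) \<Rightarrow> nat set" where
  "overlap \<phi> \<psi> = {u. u < v \<and> \<psi> u \<in> \<phi> ` {..<v}}"

text \<open>Given \<open>\<phi>\<close>, every vertex of \<open>J\<close> has at most
  \<open>v\<close> possible images under \<open>\<psi>\<close>, every other vertex at most
  \<open>n\<close>. Using \<open>Suc v\<close> keeps the base at least 1 when its exponent is
  enlarged.\<close>

lemma card_overlap_le:
  assumes J: "J \<subseteq> {..<v}"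
  shows "real (card {(\<phi>, \<psi>) \<in> embeddings v n \<times> embeddings v n. overlap \<phi> \<psi> = J})
    \<le> real (Suc v) ^ v * (real n ^ v * real n ^ (v - card J))"
proof -
  have fJ: "finite J" using finite_subset[OF J] by simp
  have "card {\<psi> \<in> embeddings v n. overlap \<phi> \<psi> = J} \<le> Suc v ^ v * n ^ (v - card J)" for \<phi>
  proof -
    have "card {\<psi> \<in> embeddings v n. overlap \<phi> \<psi> = J} \<le>
        card (PiE {..<v} (\<lambda>u. if u \<in> J then \<phi> ` {..<v} else {..<n}))"
      by (intro card_mono finite_PiE) (auto simp: embeddings_def overlap_def PiE_def Pi_def)
    also have "\<dots> = (\<Prod>u<v. if u \<in> J then card (\<phi> ` {..<v}) else n)"
      by (simp add: card_PiE if_distrib cong: if_cong)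
    also have "\<dots> = card (\<phi> ` {..<v}) ^ card J * n ^ (v - card J)"
      using J fJ by (subst prod.If_cases) (auto simp: Int_absorb1 Diff_eq[symmetric] card_Diff_subset)
    also have "\<dots> \<le> Suc v ^ v * n ^ (v - card J)"
    proof (intro mult_right_mono)
      have "card J \<le> v" using J card_mono[of "{..<v}" J] by simp
      moreover have "card (\<phi> ` {..<v}) \<le> Suc v" using card_image_le[of "{..<v}" \<phi>] by simp
      ultimately have "card (\<phi> ` {..<v}) ^ card J \<le> Suc v ^ card J" by (intro power_mono) auto
      also have "\<dots> \<le> Suc v ^ v" using \<open>card J \<le> v\<close> by (intro power_increasing) auto
      finally show "card (\<phi> ` {..<v}) ^ card J \<le> Suc v ^ v" .
    qed simp
    finally show ?thesis .
  qed
  then have "(\<Sum>\<phi>\<in>embeddings v n. card {\<psi> \<in> embeddings v n. overlap \<phi> \<psi> = J})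
      \<le> card (embeddings v n) * (Suc v ^ v * n ^ (v - card J))"
    using sum_bounded_above[of "embeddings v n"] by (metis (no_types, lifting) of_nat_id)
  also have "\<dots> \<le> n ^ v * (Suc v ^ v * n ^ (v - card J))"
    by (intro mult_right_mono card_embeddings_le) auto
  also have "(\<Sum>\<phi>\<in>embeddings v n. card {\<psi> \<in> embeddings v n. overlap \<phi> \<psi> = J}) =
      card (SIGMA \<phi>:embeddings v n. {\<psi> \<in> embeddings v n. overlap \<phi> \<psi> = J})"
    by simp
  also have "(SIGMA \<phi>:embeddings v n. {\<psi> \<in> embeddings v n. overlap \<phi> \<psi> = J}) =
      {(\<phi>, \<psi>) \<in> embeddings v n \<times> embeddings v n. overlap \<phi> \<psi> = J}" by auto
  finally have "real (card {(\<phi>, \<psi>) \<in> embeddings v n \<times> embeddings v n. overlap \<phi> \<psi> = J})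
    \<le> real (n ^ v * (Suc v ^ v * n ^ (v - card J)))" by (rule of_nat_mono)
  then show ?thesis by (simp add: mult_ac)
qed

text \<open>An edge in both images is the image under \<open>\<psi>\<close> of an edge with both
  ends in the overlap, so at most that many edges are counted twice.\<close>

lemma card_Un_images_ge:
  assumes "\<phi> \<in> embeddings v n" "\<psi> \<in> embeddings v n" "F \<subseteq> E"
  shows "2 * card F - card {f \<in> F. f \<subseteq> overlap \<phi> \<psi>} \<le> card ((`) \<phi> ` F \<union> (`) \<psi> ` F)"
proof -
  have fF: "finite F" using finite_subset[OF assms(3)] by simp
  have inj: "card ((`) \<phi> ` F) = card F" "card ((`) \<psi> ` F) = card F"
    using assms by (simp_all add: card_image[OF inj_on_subset[OF inj_on_edges]])
  have "(`) \<phi> ` F \<inter> (`) \<psi> ` F \<subseteq> (`) \<psi> ` {f \<in> F. f \<subseteq> overlap \<phi> \<psi>}"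
  proof
    fix x assume "x \<in> (`) \<phi> ` F \<inter> (`) \<psi> ` F"
    then obtain f f' where f: "f \<in> F" "f' \<in> F" "x = \<phi> ` f" "x = \<psi> ` f'" by blast
    then have "f \<subseteq> {..<v}" "f' \<subseteq> {..<v}" using assms(3) E by (auto simp: nsets_def)
    with f have "f' \<subseteq> overlap \<phi> \<psi>" by (fastforce simp: overlap_def)
    with f show "x \<in> (`) \<psi> ` {f \<in> F. f \<subseteq> overlap \<phi> \<psi>}" by blast
  qed
  then have "card ((`) \<phi> ` F \<inter> (`) \<psi> ` F) \<le> card {f \<in> F. f \<subseteq> overlap \<phi> \<psi>}"
    using fF by (intro surj_card_le) auto
  moreover have "card ((`) \<phi> ` F) + card ((`) \<psi> ` F) =
      card ((`) \<phi> ` F \<union> (`) \<psi> ` F) + card ((`) \<phi> ` F \<inter> (`) \<psi> ` F)"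
    using fF by (intro card_Un_Int) auto
  ultimately show ?thesis using inj by linarith
qed

text \<open>Sort the pairs of copies by their overlap \<open>J\<close>. Agreement on some
  \<open>e\<close> in \<open>K\<close> puts \<open>e\<close> inside \<open>J\<close>, so a bound
  \<open>W\<close> for the contribution of such \<open>J\<close> suffices, and there are at most
  \<open>2 ^ v\<close> of them.\<close>

lemma nn_integral_conflicts_le:
  assumes r: "r > 0" and online: "online_strategy \<sigma>" and m: "i \<le> m" "m < n choose 2"
    and F: "F \<subseteq> E" and K: "K \<subseteq> E"
    and \<rho>: "real m * (real r / real ((n choose 2) - m)) \<le> \<rho>" "\<rho> \<le> 1"
    and W: "\<And>J. J \<subseteq> {..<v} \<Longrightarrow> \<exists>e\<in>K. e \<subseteq> J \<Longrightarrow>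
        real n ^ v * real n ^ (v - card J) * \<rho> ^ (2 * card F - card {f \<in> F. f \<subseteq> J}) \<le> W" "W \<ge> 0"
  shows "(\<integral>\<^sup>+h. real (card (conflicts n K F (chosen h))) \<partial>achlioptas n r \<sigma> i)
    \<le> ennreal (2 ^ v * real (Suc v) ^ v * W)"
proof -
  define X where "X = {(\<phi>, \<psi>) \<in> embeddings v n \<times> embeddings v n. \<exists>e\<in>K. \<phi> ` e = \<psi> ` e}"
  define G where "G = (\<lambda>J. \<rho> ^ (2 * card F - card {f \<in> F. f \<subseteq> J}))"
  have finX: "finite X" unfolding X_def by (rule finite_subset[of _ "embeddings v n \<times> embeddings v n"]) auto
  have finF: "finite F" using finite_subset[OF F] by simp
  have \<rho>0: "\<rho> \<ge> 0" by (rule order_trans[OF _ \<rho>(1)]) simp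
  have G0: "G J \<ge> 0" for J using \<rho>0 by (simp add: G_def)
  have prob: "emeasure (achlioptas n r \<sigma> i) {h. (`) \<phi> ` F \<subseteq> chosen h \<and> (`) \<psi> ` F \<subseteq> chosen h}
      \<le> ennreal (G (overlap \<phi> \<psi>))" if "(\<phi>, \<psi>) \<in> X" for \<phi> \<psi>
  proof -
    let ?A = "(`) \<phi> ` F \<union> (`) \<psi> ` F"
    have emb: "\<phi> \<in> embeddings v n" "\<psi> \<in> embeddings v n" using that by (auto simp: X_def)
    have "emeasure (achlioptas n r \<sigma> i) {h. ?A \<subseteq> chosen h} \<le>
        ennreal ((real i * (real r / real ((n choose 2) - m))) ^ card ?A)"
      using finF by (intro emeasure_subset_chosen_le[OF r online m]) auto
    also have "\<dots> \<le> ennreal (\<rho> ^ card ?A)"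
    proof (intro ennreal_leI power_mono)
      have "real i * (real r / real ((n choose 2) - m)) \<le> real m * (real r / real ((n choose 2) - m))"
        using m by (intro mult_right_mono) auto
      from order_trans[OF this \<rho>(1)] show "real i * (real r / real ((n choose 2) - m)) \<le> \<rho>" .
    qed simp
    \<comment> \<open>The number of edges in the union is known only from below, so
      \<open>\<rho> \<le> 1\<close> enters here.\<close>
    also have "\<dots> \<le> ennreal (G (overlap \<phi> \<psi>))"
      unfolding G_def using \<rho> \<rho>0 card_Un_images_ge[OF emb F] by (intro ennreal_leI power_decreasing) auto
    finally show ?thesis by simp
  qed
  have fiber: "(\<Sum>(\<phi>, \<psi>)\<in>{x \<in> X. case_prod overlap x = J}. G (overlap \<phi> \<psi>)) \<le> real (Suc v) ^ v * W"
    if J: "J \<in> Pow {..<v}" for J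
  proof (cases "{x \<in> X. case_prod overlap x = J} = {}")
    case True
    then show ?thesis using W(2) by (simp only: sum.empty) simp
  next
    case False
    then obtain \<phi> \<psi> e where e: "e \<in> K" "\<phi> ` e = \<psi> ` e" "overlap \<phi> \<psi> = J" by (auto simp: X_def)
    have "e \<subseteq> {..<v}" using e K E by (auto simp: nsets_def)
    with e(2) have "e \<subseteq> overlap \<phi> \<psi>" by (fastforce simp: overlap_def)
    with e have ex: "\<exists>e\<in>K. e \<subseteq> J" by blast
    have "(\<Sum>(\<phi>, \<psi>)\<in>{x \<in> X. case_prod overlap x = J}. G (overlap \<phi> \<psi>)) =
      real (card {x \<in> X. case_prod overlap x = J}) * G J"
      by (subst sum.cong[OF refl, where h = "\<lambda>_. G J"]) auto
    also have "card {x \<in> X. case_prod overlap x = J} \<le>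
        card {(\<phi>, \<psi>) \<in> embeddings v n \<times> embeddings v n. overlap \<phi> \<psi> = J}"
    proof (rule card_mono)
      show "finite {(\<phi>, \<psi>) \<in> embeddings v n \<times> embeddings v n. overlap \<phi> \<psi> = J}"
        by (rule finite_subset[of _ "embeddings v n \<times> embeddings v n"]) auto
    qed (auto simp: X_def)
    also have "real \<dots> \<le> real (Suc v) ^ v * (real n ^ v * real n ^ (v - card J))"
      using J by (intro card_overlap_le) auto
    finally have "(\<Sum>(\<phi>, \<psi>)\<in>{x \<in> X. case_prod overlap x = J}. G (overlap \<phi> \<psi>)) \<le>
        real (Suc v) ^ v * (real n ^ v * real n ^ (v - card J)) * G J"
      using G0 by (simp add: mult_right_mono)
    also have "\<dots> = real (Suc v) ^ v * (real n ^ v * real n ^ (v - card J) * G J)" by simp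
    also have "\<dots> \<le> real (Suc v) ^ v * W"
      unfolding G_def using J ex by (intro mult_left_mono W) auto
    finally show ?thesis .
  qed
  have "(\<integral>\<^sup>+h. real (card (conflicts n K F (chosen h))) \<partial>achlioptas n r \<sigma> i) =
     (\<integral>\<^sup>+h. (\<Sum>(\<phi>, \<psi>)\<in>X. indicator {h. (`) \<phi> ` F \<subseteq> chosen h \<and> (`) \<psi> ` F \<subseteq> chosen h} h) \<partial>achlioptas n r \<sigma> i)"
  proof (rule nn_integral_cong)
    fix h
    have "conflicts n K F (chosen h) = {x \<in> X. case x of (\<phi>, \<psi>) \<Rightarrow> (`) \<phi> ` F \<subseteq> chosen h \<and> (`) \<psi> ` F \<subseteq> chosen h}"
      by (auto simp: conflicts_def copies_def X_def)
    moreover have "(\<Sum>(\<phi>, \<psi>)\<in>X. indicator {h. (`) \<phi> ` F \<subseteq> chosen h \<and> (`) \<psi> ` F \<subseteq> chosen h} h :: ennreal) =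
      of_nat (card {x \<in> X. case x of (\<phi>, \<psi>) \<Rightarrow> (`) \<phi> ` F \<subseteq> chosen h \<and> (`) \<psi> ` F \<subseteq> chosen h})"
      using finX by (simp add: indicator_def case_prod_unfold sum.If_cases Int_def)
    ultimately show "ennreal (real (card (conflicts n K F (chosen h)))) =
      (\<Sum>(\<phi>, \<psi>)\<in>X. indicator {h. (`) \<phi> ` F \<subseteq> chosen h \<and> (`) \<psi> ` F \<subseteq> chosen h} h)"
      by (simp add: ennreal_of_nat_eq_real_of_nat)
  qed
  also have "\<dots> = (\<Sum>(\<phi>, \<psi>)\<in>X. emeasure (achlioptas n r \<sigma> i) {h. (`) \<phi> ` F \<subseteq> chosen h \<and> (`) \<psi> ` F \<subseteq> chosen h})"
    unfolding case_prod_unfold by (subst nn_integral_sum) simp_all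
  also have "\<dots> \<le> (\<Sum>(\<phi>, \<psi>)\<in>X. ennreal (G (overlap \<phi> \<psi>)))"
    using prob by (intro sum_mono) auto
  also have "\<dots> = ennreal (\<Sum>(\<phi>, \<psi>)\<in>X. G (overlap \<phi> \<psi>))"
    unfolding case_prod_unfold by (rule sum_ennreal) (rule G0)
  also have "\<dots> \<le> ennreal (2 ^ v * real (Suc v) ^ v * W)"
  proof (rule ennreal_leI)
    have "(\<Sum>(\<phi>, \<psi>)\<in>X. G (overlap \<phi> \<psi>)) =
      (\<Sum>J\<in>Pow {..<v}. \<Sum>(\<phi>, \<psi>)\<in>{x \<in> X. case_prod overlap x = J}. G (overlap \<phi> \<psi>))"
      using finX by (rule sum.group[symmetric]) (auto simp: overlap_def)
    also have "\<dots> \<le> (\<Sum>J\<in>Pow {..<v}. real (Suc v) ^ v * W)" by (intro sum_mono fiber)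
    also have "\<dots> = 2 ^ v * real (Suc v) ^ v * W" by (simp add: card_Pow)
    finally show "(\<Sum>(\<phi>, \<psi>)\<in>X. G (overlap \<phi> \<psi>)) \<le> 2 ^ v * real (Suc v) ^ v * W" .
  qed
  finally show ?thesis .
qed

end

section \<open>Forcing a copy in phases\<close>

lemma tight_weaken:
  assumes "tight p R" and "\<And>c. c > 0 \<Longrightarrow> \<exists>c'>0. \<forall>\<^sub>F n in sequentially. \<forall>x. R n c x \<longrightarrow> R' n c' x"
  shows "tight p R'"
  unfolding tight_def
proof (intro allI impI)
  fix \<delta> :: real assume "\<delta> > 0"
  then obtain c where c: "c > 0" "\<forall>\<^sub>F n in sequentially. measure (p n) {x. \<not> R n c x} \<le> \<delta>"
    using assms(1) unfolding tight_def by blast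
  obtain c' where c': "c' > 0" "\<forall>\<^sub>F n in sequentially. \<forall>x. R n c x \<longrightarrow> R' n c' x"
    using assms(2)[OF c(1)] by blast
  from c(2) c'(2) have "\<forall>\<^sub>F n in sequentially. measure (p n) {x. \<not> R' n c' x} \<le> \<delta>"
  proof eventually_elim
    case (elim n)
    have "measure (p n) {x. \<not> R' n c' x} \<le> measure (p n) {x. \<not> R n c x}"
      using elim by (intro measure_pmf.finite_measure_mono) auto
    with elim show ?case by linarith
  qed
  with c' show "\<exists>c>0. \<forall>\<^sub>F n in sequentially. measure (p n) {x. \<not> R' n c x} \<le> \<delta>" by blast
qed

lemma lost_mono:
  assumes "lost H n h" "chosen h \<subseteq> chosen h'"
  shows "lost H n h'"
proof -
  obtain H' where "subgraph H' (graph_of n h)" "graph_iso H H'"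
    using assms(1) by (auto simp: lost_def contains_copy_def)
  moreover from this(1) assms(2) have "subgraph H' (graph_of n h')"
    by (auto simp: subgraph_def graph_of_def)
  ultimately show ?thesis unfolding lost_def contains_copy_def by blast
qed

text \<open>Copies are never destroyed, so it is enough to analyse an initial part of the
  game.\<close>

lemma prob_unlost_antimono:
  assumes r: "r > 0" and online: "online_strategy \<sigma>" and ij: "i \<le> j" "j \<le> n choose 2"
  shows "measure (achlioptas n r \<sigma> j) {h. \<not> lost H n h} \<le> measure (achlioptas n r \<sigma> i) {h. \<not> lost H n h}"
proof -
  have "measure_pmf.prob (achlioptas n r \<sigma> i \<bind> continue n r \<sigma> (j - i)) {h. \<not> lost H n h}
     \<le> measure (achlioptas n r \<sigma> i) {h. \<not> lost H n h} + 0"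
  proof (rule measure_bind_pmf_le)
    fix h assume h: "h \<in> set_pmf (achlioptas n r \<sigma> i)" "lost H n h"
    have reach: "reachable n i h" using set_pmf_achlioptas[OF r online _ h(1)] ij by simp
    have "lost H n h'" if "h' \<in> set_pmf (continue n r \<sigma> (j - i) h)" for h'
      using set_pmf_continue[OF r online reach _ that] ij lost_mono[OF h(2)] by simp
    then have "measure (continue n r \<sigma> (j - i) h) {h. \<not> lost H n h} = 0"
      by (subst measure_pmf_zero_iff) auto
    then show "measure (continue n r \<sigma> (j - i) h) {h. \<not> lost H n h} \<le> 0" by simp
  qed simp
  then show ?thesis using achlioptas_add[of n r \<sigma> i "j - i"] ij by simp
qed

context pattern
begin

text \<open>Cut \<open>{..<n}\<close> into \<open>v\<close> blocks of length
  \<open>q = n div v\<close> and send vertex \<open>u\<close> into block \<open>u\<close>; such a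
  map is injective. Rounding costs at most a factor 2 because \<open>n \<ge> v\<close> gives
  \<open>q \<ge> 1\<close>.\<close>

lemma card_embeddings_ge:
  assumes "v > 0" "n \<ge> v"
  shows "(1 / (2 * real v)) ^ v * real n ^ v \<le> real (card (embeddings v n))"
proof -
  define q where "q = n div v"
  define P where "P = PiE {..<v} (\<lambda>u. {u * q..<u * q + q})"
  have block: "u = u'" if "x \<in> {u * q..<u * q + q}" "x \<in> {u' * q..<u' * q + q}" for u u' x
  proof -
    have "x div q = w" if "w * q \<le> x" "x < w * q + q" for w
      using that by (intro div_nat_eqI) (simp_all add: mult.commute)
    from this[of u] this[of u'] that show ?thesis by simp
  qed
  have "P \<subseteq> embeddings v n"
  proof
    fix \<phi> assume \<phi>: "\<phi> \<in> P"
    then have mem: "\<phi> u \<in> {u * q..<u * q + q}" if "u < v" for u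
      using PiE_mem[OF \<phi>[unfolded P_def], of u] that by simp
    have "\<phi> u < n" if "u < v" for u
    proof -
      have "u * q + q \<le> v * q" using that by (metis Suc_leI add.commute mult_Suc mult_le_mono1)
      also have "\<dots> \<le> n" by (simp add: q_def)
      finally show ?thesis using mem[OF that] by simp
    qed
    moreover have "inj_on \<phi> {..<v}"
    proof (rule inj_onI)
      fix u u' assume u: "u \<in> {..<v}" "u' \<in> {..<v}" "\<phi> u = \<phi> u'"
      with mem[of u] mem[of u'] show "u = u'" using block by simp
    qed
    ultimately show "\<phi> \<in> embeddings v n"
      using \<phi> by (auto simp: embeddings_def P_def PiE_def)
  qed
  then have "card P \<le> card (embeddings v n)" by (intro card_mono) auto
  moreover have "card P = q ^ v" by (simp add: P_def card_PiE)
  ultimately have "real q ^ v \<le> real (card (embeddings v n))"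
    by (metis of_nat_le_iff of_nat_power)
  moreover have "real n / (2 * real v) \<le> real q"
  proof -
    have "n = q * v + n mod v" by (simp add: q_def)
    moreover have "n mod v < v" using assms by simp
    moreover have "q \<ge> 1" using assms by (simp add: q_def Suc_le_eq div_greater_zero_iff)
    then have "v \<le> q * v" by simp
    ultimately have "n \<le> 2 * (q * v)" by linarith
    then have "real n \<le> 2 * (real q * real v)" by (metis of_nat_le_iff of_nat_mult of_nat_numeral)
    then show ?thesis using assms by (simp add: field_simps)
  qed
  then have "(real n / (2 * real v)) ^ v \<le> real q ^ v" by (intro power_mono) auto
  ultimately have "(real n / (2 * real v)) ^ v \<le> real (card (embeddings v n))" by linarith
  then show ?thesis by (simp add: power_divide)
qed

end

text \<open>The density \<open>p\<close> will lie between \<open>n powr (- \<theta>)\<close> and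
  \<open>n powr (- (\<theta> - \<epsilon>))\<close>. Then \<open>dense\<close> says
  \<open>n^(|J| - 2) * p^a \<ge> 1\<close> for the \<open>a\<close> earlier edges inside
  \<open>J\<close>, so overlaps do not dominate the second moment. Next, \<open>sparse\<close> says
  \<open>n^(v - |J|) * p^(l - a) \<le> 1\<close>, so pairs of copies sharing a removed pair are no
  more frequent than single copies. Finally \<open>few_pairs\<close> says
  \<open>n^v * p^l \<le> n^2\<close>. Lower bounds on \<open>p\<close> use \<open>\<theta>\<close>;
  upper bounds need the slack \<open>\<epsilon>\<close>.\<close>

locale forced_play = pattern +
  fixes r :: nat and es ms :: "edge list" and \<theta> \<epsilon> :: real and g :: "nat \<Rightarrow> real"
    and \<sigma> :: "nat \<Rightarrow> strategy"
  assumes r: "r > 0" and v: "v > 0" and online: "\<And>n. online_strategy (\<sigma> n)"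
    and split: "set es \<union> set ms = E" "set es \<inter> set ms = {}" "distinct es" "distinct ms" "ms \<noteq> []"
    and \<theta>: "0 < \<epsilon>" "\<epsilon> < \<theta>" "\<theta> < 2"
    and dense: "\<And>j J. j < length es \<Longrightarrow> J \<subseteq> {..<v} \<Longrightarrow> es ! j \<subseteq> J \<Longrightarrow>
       \<theta> * real (card {f \<in> set (take j es). f \<subseteq> J}) \<le> real (card J) - 2"
    and sparse: "\<And>e J. J \<subseteq> {..<v} \<Longrightarrow> J \<noteq> {..<v} \<Longrightarrow> e \<in> set ms \<Longrightarrow> e \<subseteq> J \<Longrightarrow>
       real v - real (card J) \<le> (\<theta> - \<epsilon>) * (real (length es) - real (card {f \<in> set es. f \<subseteq> J}))"
    and few_pairs: "real v - 2 \<le> (\<theta> - \<epsilon>) * real (length es)"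
    and balanced: "balanced_exponent r v (length es) (length ms) \<theta>"
    and g: "\<forall>\<^sub>F n in sequentially. 1 \<le> g n" "\<forall>\<^sub>F n in sequentially. g n \<le> real n powr \<epsilon>"
      "filterlim g at_top sequentially"
begin

definition density :: "nat \<Rightarrow> real" where
  "density n = g n * real n powr (- \<theta>)"

definition phase :: "nat \<Rightarrow> nat" where
  "phase n = nat \<lfloor>density n * real n ^ 2 / real (card E)\<rfloor>"

text \<open>Everything needed of a large \<open>n\<close>, so that a phase can be analysed for one
  \<open>n\<close>. The bound \<open>1 / 8\<close> leaves \<open>n^2 / 8\<close> pairs free, the
  factor \<open>8 * r\<close> keeps \<open>\<rho>\<close> below 1, and the last condition lets the
  floor in \<open>phase\<close> lose at most a factor 2.\<close>

definition regular :: "nat \<Rightarrow> bool" where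
  "regular n \<longleftrightarrow> n \<ge> v \<and> n > 0 \<and> 1 \<le> g n \<and> g n \<le> real n powr \<epsilon> \<and> density n < 1 / 8 \<and>
     8 * real r * density n < 1 \<and> real n ^ 2 / 4 \<le> real (n choose 2) \<and>
     2 * real (card E) \<le> density n * real n ^ 2"

lemma card_E: "card E = length es + length ms" "card E > 0"
  using card_Un_disjoint[of "set es" "set ms"] split by (auto simp: distinct_card)

lemma ms_subset: "set ms \<subseteq> E" and es_subset: "set es \<subseteq> E"
  using split by auto

lemma density_le: "regular n \<Longrightarrow> density n \<le> real n powr (- (\<theta> - \<epsilon>))"
proof -
  assume "regular n"
  then have "density n \<le> real n powr \<epsilon> * real n powr (- \<theta>)"
    unfolding density_def by (intro mult_right_mono) (auto simp: regular_def)
  then show ?thesis by (simp add: powr_add[symmetric])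
qed

lemma density_square: "regular n \<Longrightarrow> density n * real n ^ 2 = g n * real n powr (2 - \<theta>)"
  by (simp add: density_def powr_diff powr_minus regular_def field_simps)

lemma eventually_small_density:
  assumes "c > 0"
  shows "\<forall>\<^sub>F n in sequentially. density n < c"
proof -
  have "((\<lambda>n. real n powr (- (\<theta> - \<epsilon>))) \<longlongrightarrow> 0) sequentially" using \<theta> by real_asymp
  then have "\<forall>\<^sub>F n in sequentially. real n powr (- (\<theta> - \<epsilon>)) < c" using assms by (rule order_tendstoD)
  with g(2) show ?thesis
  proof eventually_elim
    case (elim n)
    have "density n \<le> real n powr \<epsilon> * real n powr (- \<theta>)"
      unfolding density_def using elim by (intro mult_right_mono) auto
    with elim show ?case by (simp add: powr_add[symmetric])
  qed
qed

lemma filterlim_density_square: "filterlim (\<lambda>n. density n * real n ^ 2) at_top sequentially"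
proof (rule filterlim_at_top_mono)
  show "filterlim (\<lambda>n::nat. real n powr (2 - \<theta>)) at_top sequentially" using \<theta> by real_asymp
  show "\<forall>\<^sub>F n in sequentially. real n powr (2 - \<theta>) \<le> density n * real n ^ 2"
    using g(1) eventually_gt_at_top[of 0]
  proof eventually_elim
    case (elim n)
    have "1 * real n powr (2 - \<theta>) \<le> g n * real n powr (2 - \<theta>)"
      using elim by (intro mult_right_mono) auto
    also have "\<dots> = density n * real n ^ 2"
      using elim by (simp add: density_def powr_diff powr_minus field_simps)
    finally show ?case by simp
  qed
qed

lemma eventually_regular: "\<forall>\<^sub>F n in sequentially. regular n"
proof -
  have "\<forall>\<^sub>F n in sequentially. density n < min (1 / 8) (1 / (8 * real r))"
    using r by (intro eventually_small_density) auto
  moreover have "\<forall>\<^sub>F n in sequentially. 2 * real (card E) \<le> density n * real n ^ 2"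
    using filterlim_density_square by (simp add: filterlim_at_top)
  ultimately show ?thesis
    using g(1,2) eventually_pairs_ge eventually_ge_at_top[of v]
  proof eventually_elim
    case (elim n)
    have "8 * real r * density n < 1" using elim(1) r by (simp add: field_simps)
    with elim v show ?case by (simp add: regular_def)
  qed
qed

text \<open>The terms of the minimum are the two caps on \<open>y\<close> in
  \<open>phase_hits\<close> for a set of \<open>c^3 / 4 * n^2\<close> pairs: half of the set, and a
  quarter of a lower bound for the expected number of forced rounds. \<open>sparse_factor\<close>
  does the same for \<open>c * expected i\<close> pairs.\<close>

definition dense_factor :: "real \<Rightarrow> real" where
  "dense_factor c = min (c ^ 3 / 8) ((c ^ 3 / 4) ^ r / (8 * real (card E)))"

definition sparse_factor :: "real \<Rightarrow> real" where
  "sparse_factor c = min (c / 2) (c ^ r / (8 * real (card E)))"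

context
  fixes n :: nat
  assumes n: "regular n"
begin

lemma density_pos: "density n > 0"
  using n by (auto simp: density_def regular_def)

lemma phase_bounds:
  shows "density n * real n ^ 2 / (2 * real (card E)) \<le> real (phase n)"
    and "real (card E) * real (phase n) \<le> density n * real n ^ 2"
    and "real (card E * phase n) \<le> real n ^ 2 / 8"
    and "card E * phase n < n choose 2"
    and "real n ^ 2 / 8 \<le> real ((n choose 2) - card E * phase n)"
    and "real (card E * phase n) * (real r / real ((n choose 2) - card E * phase n)) \<le> 8 * real r * density n"
proof -
  define z where "z = density n * real n ^ 2 / real (card E)"
  have z: "z \<ge> 2" using n card_E(2) by (simp add: z_def regular_def field_simps)
  then have ph: "real (phase n) = of_int \<lfloor>z\<rfloor>" by (simp add: phase_def z_def)
  have "z / 2 \<le> real (phase n)" using z unfolding ph by linarith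
  then show "density n * real n ^ 2 / (2 * real (card E)) \<le> real (phase n)"
    by (simp add: z_def mult.commute)
  have "real (card E) * real (phase n) \<le> real (card E) * z"
    unfolding ph by (intro mult_left_mono) auto
  then show le: "real (card E) * real (phase n) \<le> density n * real n ^ 2"
    using card_E(2)[unfolded card_gt_0_iff] by (simp add: z_def)
  have x2: "real n ^ 2 > 0" using n by (simp add: regular_def)
  have "density n * real n ^ 2 \<le> (1 / 8) * real n ^ 2"
    using n by (intro mult_right_mono) (auto simp: regular_def)
  with le show m8: "real (card E * phase n) \<le> real n ^ 2 / 8" by simp
  have N: "real n ^ 2 / 4 \<le> real (n choose 2)" using n by (simp add: regular_def)
  show mN: "card E * phase n < n choose 2"
    using m8 N x2 by linarith
  then have "real ((n choose 2) - card E * phase n) = real (n choose 2) - real (card E * phase n)"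
    by (intro of_nat_diff) simp
  then show L: "real n ^ 2 / 8 \<le> real ((n choose 2) - card E * phase n)"
    using m8 N by linarith
  have "real (card E * phase n) * (real r / real ((n choose 2) - card E * phase n)) \<le>
      (density n * real n ^ 2) * (real r / (real n ^ 2 / 8))"
  proof (rule mult_mono)
    show "real r / real ((n choose 2) - card E * phase n) \<le> real r / (real n ^ 2 / 8)"
      using L x2 by (intro frac_le) auto
    show "real (card E * phase n) \<le> density n * (real n)\<^sup>2" using le by simp
  qed (use density_pos in auto)
  also have "\<dots> = 8 * real r * density n" using x2 by simp
  finally show "real (card E * phase n) * (real r / real ((n choose 2) - card E * phase n)) \<le> 8 * real r * density n" .
qed

lemma conflicts_expectation:
  assumes F: "F \<subseteq> E" and K: "K \<subseteq> E" and j: "j \<le> card E" and "w \<ge> 0"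
    and w: "\<And>J. J \<subseteq> {..<v} \<Longrightarrow> \<exists>e\<in>K. e \<subseteq> J \<Longrightarrow>
      real n ^ v * real n ^ (v - card J) * density n ^ (2 * card F - card {f \<in> F. f \<subseteq> J}) \<le> w"
  shows "(\<integral>\<^sup>+h. real (card (conflicts n K F (chosen h))) \<partial>achlioptas n r (\<sigma> n) (j * phase n))
    \<le> ennreal (2 ^ v * real (Suc v) ^ v * (8 * real r) ^ (2 * card F) * w)"
proof -
  let ?W = "(8 * real r) ^ (2 * card F) * w"
  have "(\<integral>\<^sup>+h. real (card (conflicts n K F (chosen h))) \<partial>achlioptas n r (\<sigma> n) (j * phase n))
    \<le> ennreal (2 ^ v * real (Suc v) ^ v * ?W)"
  proof (rule nn_integral_conflicts_le[OF r online _ phase_bounds(4) F K phase_bounds(6)])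
    show "j * phase n \<le> card E * phase n" using j by simp
    show "8 * real r * density n \<le> 1" using n by (simp add: regular_def)
    show "0 \<le> ?W" using assms by simp
    fix J assume J: "J \<subseteq> {..<v}" "\<exists>e\<in>K. e \<subseteq> J"
    let ?d = "2 * card F - card {f \<in> F. f \<subseteq> J}"
    have "(8 * real r) ^ ?d \<le> (8 * real r) ^ (2 * card F)"
      using r by (intro power_increasing) auto
    then have "(8 * real r) ^ ?d * (real n ^ v * real n ^ (v - card J) * density n ^ ?d) \<le>
        (8 * real r) ^ (2 * card F) * w"
      using w[OF J] density_pos by (intro mult_mono) auto
    then show "real n ^ v * real n ^ (v - card J) * (8 * real r * density n) ^ ?d \<le> ?W"
      by (simp add: power_mult_distrib mult_ac)
  qed
  then show ?thesis by (simp only: mult.assoc)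
qed

text \<open>Against the \<open>n^(2 * v) * p^(2 * j)\<close> expected for all ordered pairs, an
  overlap in \<open>J\<close> costs \<open>n^(-|J|)\<close> and gains \<open>p^(-a)\<close>; by
  \<open>dense\<close> the product is at most \<open>n^(-2)\<close>. So two partial copies agree on
  the next edge no more often than if its images were spread evenly over all pairs.\<close>

lemma few_popular_conflicts:
  assumes j: "j < length es" and J: "J \<subseteq> {..<v}" "es ! j \<subseteq> J"
  shows "real n ^ v * real n ^ (v - card J) * density n ^ (2 * j - card {f \<in> set (take j es). f \<subseteq> J})
     \<le> real n ^ (2 * v) / real n ^ 2 * density n ^ (2 * j)"
proof -
  define a where "a = card {f \<in> set (take j es). f \<subseteq> J}"
  define x where "x = real n"
  have x: "x \<ge> 1" using n by (simp add: regular_def x_def)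
  have "a \<le> card (set (take j es))" unfolding a_def by (intro card_mono) auto
  also have "\<dots> \<le> j" using card_length[of "take j es"] by simp
  finally have a: "a \<le> j" .
  have cJ: "card J \<le> v" using J card_mono[of "{..<v}" J] by simp
  have "x powr (- (real (card J) - 2)) \<le> x powr (- (\<theta> * real a))"
    using x dense[OF j J] by (intro powr_mono) (auto simp: a_def)
  also have "\<dots> = (x powr (- \<theta>)) ^ a"
    using x by (simp add: powr_powr flip: powr_realpow)
  also have "\<dots> \<le> density n ^ a"
  proof (rule power_mono)
    have "1 * x powr (- \<theta>) \<le> g n * x powr (- \<theta>)"
      using n by (intro mult_right_mono) (auto simp: regular_def)
    then show "x powr (- \<theta>) \<le> density n" by (simp add: density_def x_def)
  qed simp
  also have "x powr (- (real (card J) - 2)) = x ^ 2 / x ^ card J"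
    using x by (simp add: powr_diff powr_realpow)
  finally have "x ^ 2 \<le> x ^ card J * density n ^ a" using x by (simp add: field_simps)
  then have "(x ^ v * x ^ (v - card J) * density n ^ (2 * j - a)) * x ^ 2 \<le>
     (x ^ v * x ^ (v - card J) * density n ^ (2 * j - a)) * (x ^ card J * density n ^ a)"
    using x density_pos by (intro mult_left_mono) auto
  also have "\<dots> = x ^ v * (x ^ (v - card J) * x ^ card J) * (density n ^ (2 * j - a) * density n ^ a)"
    by simp
  also have "\<dots> = x ^ (2 * v) * density n ^ (2 * j)"
    using a cJ by (simp add: power_add[symmetric] mult_2)
  finally show ?thesis
    using x by (simp add: x_def a_def field_simps)
qed

text \<open>Full overlap gives exactly the number of single copies. For smaller \<open>J\<close>
  there is an additional factor \<open>n^(v - |J|) * p^(l - a)\<close>, at most 1 by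
  \<open>sparse\<close>.\<close>

lemma few_sparse_conflicts:
  assumes J: "J \<subseteq> {..<v}" and e: "e \<in> set ms" "e \<subseteq> J"
  shows "real n ^ v * real n ^ (v - card J) *
      density n ^ (2 * length es - card {f \<in> set es. f \<subseteq> J}) \<le> real n ^ v * density n ^ length es"
proof -
  define a where "a = card {f \<in> set es. f \<subseteq> J}"
  define l where "l = length es"
  define x where "x = real n"
  have x: "x \<ge> 1" using n by (simp add: regular_def x_def)
  have "a \<le> card (set es)" unfolding a_def by (intro card_mono) auto
  also have "\<dots> = l" using split by (simp add: l_def distinct_card)
  finally have a: "a \<le> l" .
  have cJ: "card J \<le> v" using J card_mono[of "{..<v}" J] by simp
  have "x ^ (v - card J) * density n ^ (l - a) \<le> 1"
  proof (cases "J = {..<v}")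
    case True
    have "{f \<in> set es. f \<subseteq> J} = set es"
      using True es_subset E by (auto simp: nsets_def)
    then have "a = l" using split by (simp add: a_def l_def distinct_card)
    with True show ?thesis by simp
  next
    case False
    have "density n ^ (l - a) \<le> (x powr (- (\<theta> - \<epsilon>))) ^ (l - a)"
      using density_le[OF n] density_pos by (intro power_mono) (auto simp: x_def)
    also have "\<dots> = x powr (- ((\<theta> - \<epsilon>) * (real l - real a)))"
      using x a by (simp add: powr_powr of_nat_diff algebra_simps flip: powr_realpow)
    also have "\<dots> \<le> x powr (- (real v - real (card J)))"
      using x sparse[OF J False e] by (intro powr_mono) (auto simp: l_def a_def)
    also have "\<dots> = 1 / x ^ (v - card J)"
    proof -
      have "x powr (real v - real (card J)) = x ^ (v - card J)"
        using x cJ by (simp add: of_nat_diff flip: powr_realpow)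
      then show ?thesis by (simp only: powr_minus_divide)
    qed
    finally show ?thesis using x by (simp add: field_simps)
  qed
  then have "(x ^ v * density n ^ l) * (x ^ (v - card J) * density n ^ (l - a)) \<le> (x ^ v * density n ^ l) * 1"
    using x density_pos by (intro mult_left_mono) auto
  moreover have "density n ^ l * density n ^ (l - a) = density n ^ (2 * l - a)"
    using a by (simp add: power_add[symmetric] mult_2)
  ultimately show ?thesis by (simp add: x_def l_def a_def mult_ac)
qed

lemma continue_chosen_mono:
  assumes "reachable n (j * phase n) h" "Suc j \<le> card E" "h' \<in> set_pmf (continue n r (\<sigma> n) (phase n) h)"
  shows "chosen h \<subseteq> chosen h'"
proof -
  have "Suc j * phase n \<le> card E * phase n" using assms(2) by (intro mult_right_mono) auto
  then have "j * phase n + phase n \<le> n choose 2" using phase_bounds(4) by simp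
  then show ?thesis using set_pmf_continue[OF r online assms(1) _ assms(3)] by blast
qed

text \<open>Since \<open>n choose 2 \<le> n^2 / 2\<close>, the number \<open>a\<close> is a lower
  bound for the base of the power in \<open>emeasure_few_chosen_le\<close>. The 8 is the 4 of that
  lemma times the 2 lost in rounding \<open>phase\<close>.\<close>

lemma phase_hits:
  assumes h: "reachable n (j * phase n) h" and j: "Suc j \<le> card E"
    and A: "A \<subseteq> vertex_pairs n" and a: "a \<ge> 0" "a * real n ^ 2 \<le> real (card A)"
    and y: "y \<le> real (card A) / 2" "y \<le> density n * real n ^ 2 * a ^ r / (8 * real (card E))"
    and B: "\<And>h'. chosen h \<subseteq> chosen h' \<Longrightarrow> y \<le> real (card (A \<inter> chosen h')) \<Longrightarrow> h' \<notin> B"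
  shows "measure (continue n r (\<sigma> n) (phase n) h) B \<le> exp (- y)"
proof -
  have "Suc j * phase n \<le> card E * phase n" using j by (intro mult_right_mono) auto
  then have jN: "j * phase n + phase n \<le> n choose 2" using phase_bounds(4) by simp
  have N0: "real (n choose 2) > 0" using phase_bounds(4) by linarith
  have "a \<le> real (card A) / real n ^ 2" using a n by (simp add: regular_def field_simps)
  also have "\<dots> \<le> real (card A) / (2 * real (n choose 2))"
    using N0 pairs_le[of n] by (intro divide_left_mono) (auto simp: zero_less_mult_iff)
  finally have "a ^ r \<le> (real (card A) / (2 * real (n choose 2))) ^ r"
    using a by (intro power_mono) auto
  then have "density n * real n ^ 2 / (2 * real (card E)) * a ^ r \<le>
      real (phase n) * (real (card A) / (2 * real (n choose 2))) ^ r"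
    using phase_bounds(1) density_pos a by (intro mult_mono) auto
  then have y': "y \<le> real (phase n) * (real (card A) / (2 * real (n choose 2))) ^ r / 4"
    using y(2) by simp
  have "measure (continue n r (\<sigma> n) (phase n) h) B \<le>
      measure (continue n r (\<sigma> n) (phase n) h) {h'. real (card (A \<inter> chosen h')) < y}"
  proof (rule measure_pmf.finite_measure_mono_AE, unfold AE_measure_pmf_iff, intro ballI impI)
    fix h' assume "h' \<in> set_pmf (continue n r (\<sigma> n) (phase n) h)" "h' \<in> B"
    then have "\<not> y \<le> real (card (A \<inter> chosen h'))" using continue_chosen_mono[OF h j] B by blast
    then show "h' \<in> {h'. real (card (A \<inter> chosen h')) < y}" by simp
  qed simp
  also have "\<dots> \<le> exp (- y)"
    using emeasure_few_chosen_le[OF r online A y(1) h jN y'] by (simp add: measure_pmf.emeasure_eq_measure)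
  finally show ?thesis .
qed

section \<open>Phases of the edges that are kept\<close>

definition dense_state :: "nat \<Rightarrow> real \<Rightarrow> history \<Rightarrow> bool" where
  "dense_state j c h \<longleftrightarrow>
     c * (real n ^ v * density n ^ j) \<le> real (card (copies n (set (take j es)) (chosen h)))"

text \<open>A constant times \<open>p * n^2\<close> popular pairs get chosen, and each extends at
  least \<open>card X / n^2\<close> partial copies: together this multiplies the count by a constant
  times \<open>p\<close>.\<close>

lemma dense_step:
  assumes j: "j < length es" and h: "reachable n (j * phase n) h" and c: "c > 0"
    and st: "dense_state j c h"
    and few: "real (card (conflicts n {es ! j} (set (take j es)) (chosen h)))
        \<le> real n ^ (2 * v) / real n ^ 2 * density n ^ (2 * j) / c"
  shows "measure (continue n r (\<sigma> n) (phase n) h) {h'. \<not> dense_state (Suc j) (dense_factor c * c) h'}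
    \<le> exp (- (dense_factor c * (density n * real n ^ 2)))"
proof -
  define x where "x = real n"
  define p where "p = density n"
  define X where "X = copies n (set (take j es)) (chosen h)"
  define f where "f = (\<lambda>\<phi> :: nat \<Rightarrow> nat. \<phi> ` (es ! j))"
  define K where "K = {(\<phi>, \<psi>) \<in> X \<times> X. f \<phi> = f \<psi>}"
  define d where "d = (\<lambda>t. real (card {\<phi> \<in> X. f \<phi> = t}))"
  define A where "A = {t \<in> vertex_pairs n. real (card X) \<le> 2 * (x ^ 2 / 2) * d t}"
  have x: "x \<ge> 1" using n by (simp add: regular_def x_def)
  have p: "0 < p" "p \<le> 1" using density_pos n by (auto simp: p_def regular_def)
  have e: "es ! j \<in> E" using j es_subset by auto
  have KE: "K = conflicts n {es ! j} (set (take j es)) (chosen h)"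
    by (auto simp: K_def X_def f_def conflicts_def)
  have kE: "real (card E) > 0" using card_E(2) by simp
  have "real (card X) ^ 2 \<le> 4 * real (card A) * real (card K)"
    unfolding A_def d_def K_def
  proof (rule popular_values)
    show "f ` X \<subseteq> vertex_pairs n" using edge_image_in_pairs[OF _ e] by (auto simp: X_def copies_def f_def)
    show "real (card (vertex_pairs n)) \<le> x\<^sup>2 / 2" using pairs_le[of n] by (simp add: card_vertex_pairs x_def)
  qed (use x in \<open>auto simp: X_def\<close>)
  moreover have cX: "c * (x ^ v * p ^ j) \<le> real (card X)"
    using st by (simp add: dense_state_def X_def x_def p_def)
  then have "(c * (x ^ v * p ^ j)) ^ 2 \<le> real (card X) ^ 2"
    using c x p by (intro power_mono) auto
  moreover have "4 * real (card A) * real (card K) \<le>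
      4 * real (card A) * (x ^ (2 * v) / x ^ 2 * p ^ (2 * j) / c)"
    using few unfolding KE[symmetric] x_def p_def by (intro mult_left_mono) auto
  ultimately have "(c * (x ^ v * p ^ j)) ^ 2 \<le> 4 * real (card A) * (x ^ (2 * v) / x ^ 2 * p ^ (2 * j) / c)"
    by linarith
  also have "(c * (x ^ v * p ^ j)) ^ 2 = c ^ 2 * (x ^ (2 * v) * p ^ (2 * j))"
    by (simp add: power_mult_distrib power_mult[symmetric] mult.commute)
  also have "4 * real (card A) * (x ^ (2 * v) / x ^ 2 * p ^ (2 * j) / c) =
      (4 * real (card A) / (x ^ 2 * c)) * (x ^ (2 * v) * p ^ (2 * j))"
    by simp
  finally have "c ^ 2 \<le> 4 * real (card A) / (x ^ 2 * c)"
    using x p by (subst (asm) mult_le_cancel_right_pos) auto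
  \<comment> \<open>The power \<open>c^3\<close> collects \<open>c^2\<close> from the square of the
    lower bound on \<open>card X\<close> and another \<open>c\<close> from the conflict
    bound.\<close>
  then have cA: "c ^ 3 / 4 * x ^ 2 \<le> real (card A)"
    using x c by (simp add: field_simps power2_eq_square power3_eq_cube)
  define y where "y = dense_factor c * (p * x ^ 2)"
  have "p * x ^ 2 \<le> x ^ 2" using p x by simp
  then have "y \<le> (c ^ 3 / 8) * x ^ 2"
    unfolding y_def dense_factor_def using c p x kE by (intro mult_mono) auto
  with cA have y1: "y \<le> real (card A) / 2" by simp
  have "y \<le> ((c ^ 3 / 4) ^ r / (8 * real (card E))) * (p * x ^ 2)"
    unfolding y_def dense_factor_def using p by (intro mult_right_mono) auto
  then have y2: "y \<le> p * x ^ 2 * (c ^ 3 / 4) ^ r / (8 * real (card E))" by (simp add: mult_ac)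
  show ?thesis
    unfolding x_def[symmetric] p_def[symmetric] y_def[symmetric]
  proof (rule phase_hits[OF h _ _ _ _ y1])
    show "Suc j \<le> card E" using j card_E(1) by simp
    show "A \<subseteq> vertex_pairs n" by (auto simp: A_def)
    show "c ^ 3 / 4 * real n ^ 2 \<le> real (card A)" using cA by (simp add: x_def)
    show "y \<le> density n * (real n)\<^sup>2 * (c ^ 3 / 4) ^ r / (8 * real (card E))"
      using y2 by (simp only: x_def p_def)
    show "0 \<le> c ^ 3 / 4" using c by simp
    fix h' assume mono: "chosen h \<subseteq> chosen h'" and hit: "y \<le> real (card (A \<inter> chosen h'))"
    \<comment> \<open>Each extended copy belongs to exactly one chosen pair, the image of
      \<open>es ! j\<close>, so the multiplicities \<open>d\<close> may be summed over the
      hits.\<close>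
    define S where "S = {\<phi> \<in> X. f \<phi> \<in> A \<inter> chosen h'}"
    have finX: "finite X" by (simp add: X_def)
    have "S \<subseteq> copies n (set (take (Suc j) es)) (chosen h')"
      using mono j by (auto simp: S_def X_def copies_def f_def take_Suc_conv_app_nth)
    then have SX: "card S \<le> card (copies n (set (take (Suc j) es)) (chosen h'))"
      by (intro card_mono) auto
    have "(\<Sum>t\<in>A \<inter> chosen h'. \<Sum>\<phi>\<in>{\<phi> \<in> S. f \<phi> = t}. 1) = (\<Sum>\<phi>\<in>S. 1 :: nat)"
      using finX by (intro sum.group) (auto simp: S_def)
    then have "(\<Sum>t\<in>A \<inter> chosen h'. card {\<phi> \<in> S. f \<phi> = t}) = card S" by simp
    moreover have "{\<phi> \<in> S. f \<phi> = t} = {\<phi> \<in> X. f \<phi> = t}" if "t \<in> A \<inter> chosen h'" for t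
      using that by (auto simp: S_def)
    ultimately have "(\<Sum>t\<in>A \<inter> chosen h'. card {\<phi> \<in> X. f \<phi> = t}) = card S" by simp
    then have S: "real (card S) = (\<Sum>t\<in>A \<inter> chosen h'. d t)" by (simp add: d_def flip: of_nat_sum)
    have "dense_factor c * c * (x ^ v * p ^ Suc j) = y * (c * (x ^ v * p ^ j) / x ^ 2)"
      using x by (simp add: y_def)
    also have "\<dots> \<le> real (card (A \<inter> chosen h')) * (real (card X) / x ^ 2)"
      using hit cX c x p by (intro mult_mono divide_right_mono) auto
    also have "\<dots> = (\<Sum>t\<in>A \<inter> chosen h'. real (card X) / x ^ 2)" by simp
    also have "\<dots> \<le> (\<Sum>t\<in>A \<inter> chosen h'. d t)"
      using x by (intro sum_mono) (auto simp: A_def field_simps)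
    also have "\<dots> \<le> real (card (copies n (set (take (Suc j) es)) (chosen h')))"
      using SX S by simp
    finally show "h' \<notin> {h'. \<not> dense_state (Suc j) (dense_factor c * c) h'}"
      by (simp add: dense_state_def x_def p_def)
  qed
qed

section \<open>Phases of the removed edges\<close>

abbreviation "expected i \<equiv> stage r \<theta> v (length es) (real n) (g n) i"

text \<open>Distinctness is kept for all removed edges, not just the next one, since later phases
  pass to subfamilies. It makes the pairs that extend the family exactly as numerous as its
  members.\<close>

definition sparse_state :: "nat \<Rightarrow> real \<Rightarrow> history \<Rightarrow> bool" where
  "sparse_state i c h \<longleftrightarrow>
     (\<exists>\<Psi>. \<Psi> \<subseteq> copies n (set es \<union> set (take i ms)) (chosen h) \<and>
        (\<forall>e\<in>set ms. inj_on (\<lambda>\<phi>. \<phi> ` e) \<Psi>) \<and> c * expected i \<le> real (card \<Psi>))"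

lemma expected_pos: "expected i > 0"
  using n by (intro stage_pos) (auto simp: regular_def)

lemma expected_Suc: "expected (Suc i) = density n * real n ^ 2 * (expected i / real n ^ 2) ^ r"
  using density_square[OF n] by simp

text \<open>As long as \<open>expected i \<le> n^2\<close>, the \<open>r\<close>-th power of
  \<open>expected i / n^2\<close> is at most the ratio itself, and \<open>density n \<le> 1\<close>
  makes the next stage no larger. Stage 0 is bounded through \<open>few_pairs\<close>.\<close>

lemma expected_antimono: "expected (Suc i) \<le> expected i \<and> expected i \<le> real n ^ 2"
proof -
  define x where "x = real n"
  have x: "x \<ge> 1" using n by (simp add: regular_def x_def)
  have step: "expected (Suc i) \<le> expected i" if "expected i \<le> real n ^ 2" for i
  proof -
    have w: "0 \<le> expected i / x ^ 2" "expected i / x ^ 2 \<le> 1"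
      using that expected_pos[of i] x by (auto simp: x_def divide_le_eq_1)
    have "(expected i / x ^ 2) ^ r \<le> (expected i / x ^ 2) ^ 1"
      using w r by (intro power_decreasing) auto
    moreover have "density n * x ^ 2 \<le> x ^ 2"
      using n x by (simp add: regular_def)
    ultimately have "density n * x ^ 2 * (expected i / x ^ 2) ^ r \<le> x ^ 2 * (expected i / x ^ 2) ^ 1"
      using density_pos w x by (intro mult_mono) auto
    then show ?thesis unfolding expected_Suc using x by (simp add: x_def)
  qed
  have "expected i \<le> real n ^ 2" for i
  proof (induction i)
    case 0
    have "density n ^ length es \<le> (x powr (- (\<theta> - \<epsilon>))) ^ length es"
      using density_le[OF n] density_pos by (intro power_mono) (auto simp: x_def)
    also have "\<dots> = x powr (- ((\<theta> - \<epsilon>) * real (length es)))"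
      using x by (simp add: powr_powr algebra_simps flip: powr_realpow)
    also have "\<dots> \<le> x powr (- (real v - 2))"
      using x few_pairs by (intro powr_mono) auto
    finally have "x ^ v * density n ^ length es \<le> x ^ v * x powr (- (real v - 2))"
      using x by (intro mult_left_mono) auto
    also have "\<dots> = x ^ 2" using x by (simp add: powr_diff powr_realpow)
    finally show ?case by (simp add: density_def x_def)
  next
    case (Suc i)
    then show ?case using step[of i] by linarith
  qed
  with step show ?thesis by blast
qed

text \<open>With \<open>w\<close> the expected number of copies, \<open>c * w\<close> copies with at
  most \<open>w / c\<close> conflicts contain a conflict-free family of size
  \<open>c^3 / 4 * w\<close>, still of the full order.\<close>

lemma sparse_base:
  assumes c: "c > 0" and st: "dense_state (length es) c h"
    and few: "real (card (conflicts n (set ms) (set es) (chosen h)))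
        \<le> real n ^ v * density n ^ length es / c"
  shows "sparse_state 0 (c ^ 3 / 4) h"
proof -
  define w where "w = real n ^ v * density n ^ length es"
  define X where "X = copies n (set es) (chosen h)"
  define Q where "Q = (\<lambda>\<phi> \<psi> :: nat \<Rightarrow> nat. \<exists>e\<in>set ms. \<phi> ` e = \<psi> ` e)"
  have w: "w > 0" using density_pos n by (simp add: w_def regular_def)
  \<comment> \<open>\<open>conflict_free_subset\<close> wants \<open>Q\<close> reflexive, which
    holds because \<open>ms\<close> is nonempty.\<close>
  obtain Y where Y: "Y \<subseteq> X" "\<And>\<phi> \<psi>. \<phi> \<in> Y \<Longrightarrow> \<psi> \<in> Y \<Longrightarrow> Q \<phi> \<psi> \<Longrightarrow> \<phi> = \<psi>"
    "(card X) ^ 2 \<le> 4 * card {(\<phi>, \<psi>) \<in> X \<times> X. Q \<phi> \<psi>} * card Y"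
    using conflict_free_subset[of X Q] split(5) unfolding X_def Q_def
    by (metis (no_types, lifting) finite_copies list.set_sel(1))
  have "{(\<phi>, \<psi>) \<in> X \<times> X. Q \<phi> \<psi>} = conflicts n (set ms) (set es) (chosen h)"
    by (auto simp: X_def Q_def conflicts_def)
  then have K: "real (card {(\<phi>, \<psi>) \<in> X \<times> X. Q \<phi> \<psi>}) \<le> w / c" using few by (simp add: w_def)
  have "(c * w) ^ 2 \<le> real (card X) ^ 2"
    using st c w by (intro power_mono) (auto simp: dense_state_def X_def w_def)
  also have "\<dots> \<le> 4 * real (card {(\<phi>, \<psi>) \<in> X \<times> X. Q \<phi> \<psi>}) * real (card Y)"
    using of_nat_mono[OF Y(3), where 'a = real] by simp
  also have "\<dots> \<le> 4 * (w / c) * real (card Y)"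
    using K by (intro mult_right_mono mult_left_mono) auto
  finally have "c ^ 3 / 4 * w \<le> real (card Y)"
    using w c by (simp add: field_simps power2_eq_square power3_eq_cube)
  moreover have "inj_on (\<lambda>\<phi>. \<phi> ` e) Y" if "e \<in> set ms" for e
    using Y(2) that by (auto simp: inj_on_def Q_def)
  ultimately show ?thesis
    unfolding sparse_state_def using Y(1) by (intro exI[of _ Y]) (auto simp: X_def w_def density_def)
qed

text \<open>Every chosen pair of \<open>A\<close> extends exactly one member of
  \<open>\<Psi>\<close>, so the new family is as large as the number of hits, and the hits are
  counted by the recursion of \<open>stage\<close> up to the constant.\<close>

lemma sparse_step:
  assumes i: "i < length ms" and h: "reachable n ((length es + i) * phase n) h" and c: "c > 0"
    and st: "sparse_state i c h"
  shows "measure (continue n r (\<sigma> n) (phase n) h) {h'. \<not> sparse_state (Suc i) (sparse_factor c) h'}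
    \<le> exp (- (sparse_factor c * expected (Suc i)))"
proof -
  obtain \<Psi> where \<Psi>: "\<Psi> \<subseteq> copies n (set es \<union> set (take i ms)) (chosen h)"
    "\<And>e. e \<in> set ms \<Longrightarrow> inj_on (\<lambda>\<phi>. \<phi> ` e) \<Psi>" "c * expected i \<le> real (card \<Psi>)"
    using st by (auto simp: sparse_state_def)
  define f where "f = (\<lambda>\<phi> :: nat \<Rightarrow> nat. \<phi> ` (ms ! i))"
  define A where "A = f ` \<Psi>"
  have e: "ms ! i \<in> set ms" "ms ! i \<in> E" using i ms_subset by auto
  have inj: "inj_on f \<Psi>" unfolding f_def by (rule \<Psi>(2)[OF e(1)])
  then have cA: "card A = card \<Psi>" by (simp add: A_def card_image)
  have kE: "real (card E) > 0" using card_E(2) by simp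
  define y where "y = sparse_factor c * expected (Suc i)"
  have "y \<le> c / 2 * expected i"
    unfolding y_def sparse_factor_def
    using expected_antimono[of i] expected_pos[of "Suc i"] c kE by (intro mult_mono) auto
  then have y1: "y \<le> real (card A) / 2" using \<Psi>(3) cA by simp
  have "y \<le> c ^ r / (8 * real (card E)) * expected (Suc i)"
    unfolding y_def sparse_factor_def using expected_pos[of "Suc i"] by (intro mult_right_mono) auto
  also have "\<dots> = density n * real n ^ 2 * (c * expected i / real n ^ 2) ^ r / (8 * real (card E))"
    unfolding expected_Suc by (simp add: power_mult_distrib power_divide mult_ac)
  finally have y2: "y \<le> density n * real n ^ 2 * (c * expected i / real n ^ 2) ^ r / (8 * real (card E))" .
  show ?thesis
    unfolding y_def[symmetric]
  proof (rule phase_hits[OF h _ _ _ _ y1 y2])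
    show "Suc (length es + i) \<le> card E" using i card_E(1) by simp
    show "A \<subseteq> vertex_pairs n"
      unfolding A_def f_def using \<Psi>(1) edge_image_in_pairs[OF _ e(2)]
      by (intro image_subsetI) (auto simp: copies_def)
    show "0 \<le> c * expected i / real n ^ 2"
      using c expected_pos[of i] by simp
    show "c * expected i / real n ^ 2 * real n ^ 2 \<le> real (card A)"
      using \<Psi>(3) cA n by (simp add: regular_def)
    fix h' assume mono: "chosen h \<subseteq> chosen h'" and hit: "y \<le> real (card (A \<inter> chosen h'))"
    define \<Psi>' where "\<Psi>' = {\<phi> \<in> \<Psi>. f \<phi> \<in> chosen h'}"
    have "A \<inter> chosen h' = f ` \<Psi>'" by (auto simp: A_def \<Psi>'_def)
    moreover have sub: "\<Psi>' \<subseteq> \<Psi>" by (auto simp: \<Psi>'_def)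
    ultimately have "card (A \<inter> chosen h') = card \<Psi>'" using inj by (simp add: card_image inj_on_subset)
    moreover have "\<Psi>' \<subseteq> copies n (set es \<union> set (take (Suc i) ms)) (chosen h')"
      using \<Psi>(1) mono i by (auto simp: \<Psi>'_def copies_def f_def take_Suc_conv_app_nth)
    moreover have "inj_on (\<lambda>\<phi>. \<phi> ` e) \<Psi>'" if "e \<in> set ms" for e
      using inj_on_subset[OF \<Psi>(2)[OF that] sub] .
    ultimately show "h' \<notin> {h'. \<not> sparse_state (Suc i) (sparse_factor c) h'}"
      using hit by (auto simp: sparse_state_def y_def)
  qed
qed

end

section \<open>Chaining the phases\<close>

lemma reachable_phase:
  assumes "regular n" "j \<le> card E" "h \<in> set_pmf (achlioptas n r (\<sigma> n) (j * phase n))"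
  shows "reachable n (j * phase n) h"
proof -
  have "j * phase n \<le> card E * phase n" using assms(2) by (intro mult_right_mono) auto
  then have "j * phase n \<le> n choose 2" using phase_bounds(4)[OF assms(1)] by linarith
  then show ?thesis using set_pmf_achlioptas[OF r online _ assms(3)] by blast
qed

lemma achlioptas_phase:
  "achlioptas n r (\<sigma> n) (Suc j * phase n) =
     achlioptas n r (\<sigma> n) (j * phase n) \<bind> continue n r (\<sigma> n) (phase n)"
  using achlioptas_add[of n r "\<sigma> n" "j * phase n" "phase n"] by (simp add: add.commute)

lemma eventually_exp_le:
  fixes f :: "nat \<Rightarrow> real"
  assumes "filterlim f at_top sequentially" "c > 0" "\<delta> > 0"
  shows "\<forall>\<^sub>F n in sequentially. exp (- (c * f n)) \<le> \<delta>"
proof -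
  have "filterlim (\<lambda>n. c * f n) at_top sequentially"
    using assms by (intro filterlim_tendsto_pos_mult_at_top[OF tendsto_const])
  then have "((\<lambda>n. exp (- (c * f n))) \<longlongrightarrow> 0) sequentially"
    by (intro filterlim_compose[OF exp_at_bot] filterlim_compose[OF filterlim_uminus_at_bot_at_top])
  then have "\<forall>\<^sub>F n in sequentially. exp (- (c * f n)) < \<delta>" using assms(3) by (rule order_tendstoD)
  then show ?thesis by (rule eventually_mono) simp
qed

lemma dense_state_antimono:
  "\<forall>\<^sub>F n in sequentially. \<forall>c c' h. 0 < c' \<longrightarrow> c' \<le> c \<longrightarrow> dense_state n j c h \<longrightarrow> dense_state n j c' h"
  using eventually_regular
proof eventually_elim
  case (elim n)
  note d = density_pos[OF elim]
  show ?case
  proof (intro allI impI)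
    fix c c' :: real and h
    assume c: "0 < c'" "c' \<le> c" and st: "dense_state n j c h"
    have "c' * (real n ^ v * density n ^ j) \<le> c * (real n ^ v * density n ^ j)"
      using c d by (intro mult_right_mono) auto
    with st show "dense_state n j c' h" by (simp add: dense_state_def[OF elim])
  qed
qed

abbreviation after_phases :: "nat \<Rightarrow> nat \<Rightarrow> history pmf" where
  "after_phases j n \<equiv> achlioptas n r (\<sigma> n) (j * phase n)"

text \<open>The next step needs many copies and few conflicts in the same history with the same
  constant, so the conflict bound is joined to the state \<open>R\<close>.\<close>

lemma tight_conflicts:
  assumes F: "F \<subseteq> E" and K: "K \<subseteq> E" and j: "j \<le> card E"
    and pos: "\<And>n. regular n \<Longrightarrow> 0 < w n"
    and w: "\<And>n J. regular n \<Longrightarrow> J \<subseteq> {..<v} \<Longrightarrow> \<exists>e\<in>K. e \<subseteq> J \<Longrightarrow>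
      real n ^ v * real n ^ (v - card J) * density n ^ (2 * card F - card {f \<in> F. f \<subseteq> J}) \<le> w n"
    and R: "tight (after_phases j) R"
    and R_mono: "\<forall>\<^sub>F n in sequentially. \<forall>c c' h. 0 < c' \<longrightarrow> c' \<le> c \<longrightarrow> R n c h \<longrightarrow> R n c' h"
  shows "tight (after_phases j) (\<lambda>n c h. R n c h \<and> real (card (conflicts n K F (chosen h))) \<le> w n / c)"
proof (rule tight_conj[OF R _ R_mono])
  have ev: "\<forall>\<^sub>F n in sequentially. 0 < w n"
    using eventually_regular by (rule eventually_mono) (rule pos)
  then show "\<forall>\<^sub>F n in sequentially. \<forall>c c' h. 0 < c' \<longrightarrow> c' \<le> c \<longrightarrow>
      real (card (conflicts n K F (chosen h))) \<le> w n / c \<longrightarrow>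
      real (card (conflicts n K F (chosen h))) \<le> w n / c'"
  proof (rule eventually_mono, intro allI impI)
    fix n c c' h
    assume "0 < w n" "0 < c'" "c' \<le> c" and le: "real (card (conflicts n K F (chosen h))) \<le> w n / c"
    then have "w n / c \<le> w n / c'" by (intro divide_left_mono) auto
    with le show "real (card (conflicts n K F (chosen h))) \<le> w n / c'" by linarith
  qed
  show "tight (after_phases j) (\<lambda>n c h. real (card (conflicts n K F (chosen h))) \<le> w n / c)"
  proof (rule tight_bounded_expectation[OF _ ev])
    show "0 < 2 ^ v * real (Suc v) ^ v * (8 * real r) ^ (2 * card F)" using r by simp
    show "\<forall>\<^sub>F n in sequentially. (\<integral>\<^sup>+h. real (card (conflicts n K F (chosen h))) \<partial>after_phases j n)
        \<le> ennreal (2 ^ v * real (Suc v) ^ v * (8 * real r) ^ (2 * card F) * w n)"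
      using eventually_regular
    proof eventually_elim
      case (elim n)
      then show ?case
        using w pos[OF elim] by (intro conflicts_expectation[OF elim F K j]) auto
    qed
  qed
qed

text \<open>For fixed \<open>c\<close> the failure probability of one phase tends to 0 because
  \<open>f\<close> tends to infinity; this is what \<open>tight_bind\<close> asks for.\<close>

lemma tight_phase:
  assumes "tight (after_phases j) R" and j: "Suc j \<le> card E" and f: "filterlim f at_top sequentially"
    and pos: "\<And>c. 0 < c \<Longrightarrow> 0 < \<kappa> c \<and> 0 < c' c"
    and step: "\<And>n c h. regular n \<Longrightarrow> 0 < c \<Longrightarrow> reachable n (j * phase n) h \<Longrightarrow> R n c h \<Longrightarrow>
      measure (continue n r (\<sigma> n) (phase n) h) {h'. \<not> R' n (c' c) h'} \<le> exp (- (\<kappa> c * f n))"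
  shows "tight (after_phases (Suc j)) R'"
  unfolding achlioptas_phase
proof (rule tight_bind[OF assms(1)], intro exI conjI allI impI)
  fix c \<delta> :: real
  assume c: "c > 0"
  then show "c' c > 0" using pos by simp
  assume "\<delta> > 0"
  from eventually_exp_le[OF f conjunct1[OF pos[OF c]] this] eventually_regular
  show "\<forall>\<^sub>F n in sequentially. \<forall>h\<in>set_pmf (after_phases j n). R n c h \<longrightarrow>
      measure (continue n r (\<sigma> n) (phase n) h) {h'. \<not> R' n (c' c) h'} \<le> \<delta>"
  proof eventually_elim
    case (elim n)
    have "j \<le> card E" using j by simp
    from step[OF elim(2) c reachable_phase[OF elim(2) this]] elim(1) show ?case
      by (meson order_trans)
  qed
qed

lemma tight_dense_state: "j \<le> length es \<Longrightarrow> tight (after_phases j) (\<lambda>n. dense_state n j)"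
proof (induction j)
  case 0
  have "\<forall>\<^sub>F n in sequentially. measure (after_phases 0 n) {h. \<not> dense_state n 0 ((1 / (2 * real v)) ^ v) h} = 0"
    using eventually_regular
  proof eventually_elim
    case (elim n)
    have "copies n {} C = embeddings v n" for C by (auto simp: copies_def)
    then have "{h. \<not> dense_state n 0 ((1 / (2 * real v)) ^ v) h} = {}"
      using card_embeddings_ge[OF v, of n] elim by (simp add: dense_state_def[OF elim] regular_def)
    then show ?case by simp
  qed
  then show ?case
    unfolding tight_def using v
    by (intro allI impI exI[of _ "(1 / (2 * real v)) ^ v"] conjI) (auto elim!: eventually_mono)
next
  case (Suc j)
  define F where "F = set (take j es)"
  define w where "w = (\<lambda>n. real n ^ (2 * v) / real n ^ 2 * density n ^ (2 * j))"
  have j: "j < length es" using Suc.prems by simp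
  have cF: "card F = j" using j split(3) by (simp add: F_def distinct_card)
  have "tight (after_phases j) (\<lambda>n c h. dense_state n j c h \<and>
      real (card (conflicts n {es ! j} F (chosen h))) \<le> w n / c)"
  proof (rule tight_conflicts[OF _ _ _ _ _ _ dense_state_antimono])
    show "F \<subseteq> E" using es_subset set_take_subset[of j es] by (auto simp: F_def)
    show "{es ! j} \<subseteq> E" "j \<le> card E" using es_subset j card_E(1) by auto
    show "tight (after_phases j) (\<lambda>n. dense_state n j)" using Suc by simp
    fix n assume n: "regular n"
    show "0 < w n" using density_pos[OF n] n by (simp add: w_def regular_def)
    fix J assume "J \<subseteq> {..<v}" "\<exists>e\<in>{es ! j}. e \<subseteq> J"
    then show "real n ^ v * real n ^ (v - card J) * density n ^ (2 * card F - card {f \<in> F. f \<subseteq> J}) \<le> w n"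
      using few_popular_conflicts[OF n j, of J] unfolding cF w_def F_def[symmetric] by simp
  qed
  then show ?case
  proof (rule tight_phase[OF _ _ filterlim_density_square])
    show "0 < dense_factor c \<and> 0 < dense_factor c * c" if "0 < c" for c
      using that card_E(2) by (simp add: dense_factor_def)
    show "measure (continue n r (\<sigma> n) (phase n) h) {h'. \<not> dense_state n (Suc j) (dense_factor c * c) h'}
        \<le> exp (- (dense_factor c * (density n * real n ^ 2)))"
      if "regular n" "0 < c" "reachable n (j * phase n) h"
        "dense_state n j c h \<and> real (card (conflicts n {es ! j} F (chosen h))) \<le> w n / c" for n c h
      using dense_step[OF that(1) j that(3,2)] that(4) by (simp add: w_def F_def)
  qed (use j card_E(1) in simp)
qed

text \<open>The stages decrease, so the last is the smallest, and balance makes it a positive power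
  of \<open>g\<close>. Hence the exponential failure bounds of all sparse phases vanish.\<close>

lemma filterlim_expected:
  assumes "i \<le> length ms"
  shows "filterlim (\<lambda>n. expected n i) at_top sequentially"
proof (rule filterlim_at_top_mono[OF g(3)])
  show "\<forall>\<^sub>F n in sequentially. g n \<le> expected n i"
    using eventually_regular
  proof eventually_elim
    case (elim n)
    define a where "a = length es * r ^ length ms + (\<Sum>j<length ms. r ^ j)"
    have "r ^ 0 \<le> (\<Sum>j<length ms. r ^ j)"
      using split(5) by (intro member_le_sum) auto
    then have "1 \<le> a" by (simp add: a_def)
    then have "g n ^ 1 \<le> g n ^ a" using elim by (intro power_increasing) (auto simp: regular_def)
    also have "\<dots> = expected n (length ms)"
      using stage_last[OF _ _ balanced, of "real n" "g n"] elim by (simp add: a_def regular_def)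
    also have "\<dots> \<le> expected n i"
      using assms expected_antimono[OF elim]
      by (induction rule: inc_induct) (auto intro: order_trans)
    finally show ?case by simp
  qed
qed

lemma tight_sparse_state: "i \<le> length ms \<Longrightarrow> tight (after_phases (length es + i)) (\<lambda>n. sparse_state n i)"
proof (induction i)
  case 0
  define w where "w = (\<lambda>n. real n ^ v * density n ^ length es)"
  have c_es: "card (set es) = length es" using split(3) by (simp add: distinct_card)
  have "tight (after_phases (length es)) (\<lambda>n c h. dense_state n (length es) c h \<and>
      real (card (conflicts n (set ms) (set es) (chosen h))) \<le> w n / c)"
  proof (rule tight_conflicts[OF es_subset ms_subset _ _ _ tight_dense_state[OF order_refl] dense_state_antimono])
    show "length es \<le> card E" using card_E(1) by simp
    fix n assume n: "regular n"
    show "0 < w n" using density_pos[OF n] n by (simp add: w_def regular_def)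
    fix J assume "J \<subseteq> {..<v}" "\<exists>e\<in>set ms. e \<subseteq> J"
    then show "real n ^ v * real n ^ (v - card J) *
        density n ^ (2 * card (set es) - card {f \<in> set es. f \<subseteq> J}) \<le> w n"
      using few_sparse_conflicts[OF n, of J] by (auto simp: c_es w_def)
  qed
  then have "tight (after_phases (length es)) (\<lambda>n. sparse_state n 0)"
  proof (rule tight_weaken)
    fix c :: real assume c: "c > 0"
    have "\<forall>\<^sub>F n in sequentially. \<forall>h. dense_state n (length es) c h \<and>
        real (card (conflicts n (set ms) (set es) (chosen h))) \<le> w n / c \<longrightarrow> sparse_state n 0 (c ^ 3 / 4) h"
      using eventually_regular
    proof eventually_elim
      case (elim n)
      then show ?case using sparse_base[OF elim c] by (auto simp: w_def)
    qed
    with c show "\<exists>c'>0. \<forall>\<^sub>F n in sequentially. \<forall>h. dense_state n (length es) c h \<and>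
        real (card (conflicts n (set ms) (set es) (chosen h))) \<le> w n / c \<longrightarrow> sparse_state n 0 c' h"
      by (intro exI[of _ "c ^ 3 / 4"]) auto
  qed
  then show ?case by simp
next
  case (Suc i)
  then have i: "i < length ms" by simp
  have "tight (after_phases (length es + i)) (\<lambda>n. sparse_state n i)" using Suc by simp
  then have "tight (after_phases (Suc (length es + i))) (\<lambda>n. sparse_state n (Suc i))"
  proof (rule tight_phase[OF _ _ filterlim_expected[OF Suc.prems]])
    show "0 < sparse_factor c \<and> 0 < sparse_factor c" if "0 < c" for c
      using that card_E(2) by (simp add: sparse_factor_def)
    show "measure (continue n r (\<sigma> n) (phase n) h) {h'. \<not> sparse_state n (Suc i) (sparse_factor c) h'}
        \<le> exp (- (sparse_factor c * expected n (Suc i)))"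
      if "regular n" "0 < c" "reachable n ((length es + i) * phase n) h" "sparse_state n i c h" for n c h
      using sparse_step[OF that(1) i that(3,2,4)] .
  qed (use i card_E(1) in simp)
  then show ?case by simp
qed

lemma eventually_lost:
  assumes "\<delta> > 0"
  shows "\<forall>\<^sub>F n in sequentially.
     measure (after_phases (card E) n) {h. \<not> lost ({..<v}, E) n h} \<le> \<delta>"
proof -
  obtain c where c: "c > 0" "\<forall>\<^sub>F n in sequentially. measure (after_phases (length es + length ms) n) {h. \<not> sparse_state n (length ms) c h} \<le> \<delta>"
    using tight_sparse_state[OF order_refl] assms unfolding tight_def by blast
  from c(2) eventually_regular show ?thesis
  proof eventually_elim
    case (elim n)
    have "lost ({..<v}, E) n h" if "sparse_state n (length ms) c h" for h
    proof -
      from that obtain \<Psi> where \<Psi>: "\<Psi> \<subseteq> copies n (set es \<union> set ms) (chosen h)"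
        "c * expected n (length ms) \<le> real (card \<Psi>)"
        by (auto simp: sparse_state_def[OF elim(2)])
      have "0 < c * expected n (length ms)" using c(1) expected_pos[OF elim(2)] by simp
      with \<Psi>(2) have "\<Psi> \<noteq> {}" by auto
      with \<Psi>(1) show ?thesis by (auto simp: lost_iff copies_def split(1))
    qed
    then have "measure (after_phases (card E) n) {h. \<not> lost ({..<v}, E) n h} \<le>
       measure (after_phases (card E) n) {h. \<not> sparse_state n (length ms) c h}"
      by (intro measure_pmf.finite_measure_mono) auto
    with elim(1) show ?case by (simp add: card_E(1))
  qed
qed

lemma phase_rounds_le:
  "regular n \<Longrightarrow> real (card E * phase n) \<le> g n * real n powr (2 - \<theta>)"
  using phase_bounds(2) density_square by simp

end

section \<open>From inequalities on subgraphs to the threshold\<close>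

lemma finite_pos_lower_bound:
  fixes f :: "'a \<Rightarrow> real"
  assumes "finite S" "\<And>x. x \<in> S \<Longrightarrow> 0 < f x"
  obtains d where "d > 0" "\<And>x. x \<in> S \<Longrightarrow> d \<le> f x"
proof
  \<comment> \<open>The extra 1 covers an empty \<open>S\<close>.\<close>
  show "0 < Min (insert 1 (f ` S))" using assms by simp
  show "Min (insert 1 (f ` S)) \<le> f x" if "x \<in> S" for x using assms(1) that by simp
qed

context pattern
begin

text \<open>Strict inequalities for finitely many \<open>J\<close> leave a common slack, from which
  \<open>\<epsilon>\<close> is cut. Capping \<open>g\<close> at \<open>n powr \<epsilon>\<close>
  keeps the density low enough for \<open>sparse\<close>, while \<open>g\<close> still tends to
  infinity; the rounds beyond the phases do no harm.\<close>

lemma player_loses: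
  fixes \<theta> :: real and m :: "nat \<Rightarrow> nat"
  assumes r: "r > 0" and v: "v > 0"
    and online: "\<And>n. online_strategy (\<sigma> n)"
    and split: "set es \<union> set ms = E" "set es \<inter> set ms = {}" "distinct es" "distinct ms" "ms \<noteq> []"
    and \<theta>: "0 < \<theta>" "\<theta> < 2"
    and dense: "\<And>j J. j < length es \<Longrightarrow> J \<subseteq> {..<v} \<Longrightarrow> es ! j \<subseteq> J \<Longrightarrow>
       \<theta> * real (card {f \<in> set (take j es). f \<subseteq> J}) \<le> real (card J) - 2"
    and sparse: "\<And>e J. J \<subseteq> {..<v} \<Longrightarrow> J \<noteq> {..<v} \<Longrightarrow> e \<in> set ms \<Longrightarrow> e \<subseteq> J \<Longrightarrow>
       real v - real (card J) < \<theta> * (real (length es) - real (card {f \<in> set es. f \<subseteq> J}))"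
    and few_pairs: "real v - 2 < \<theta> * real (length es)"
    and balanced: "balanced_exponent r v (length es) (length ms) \<theta>"
    and m: "\<And>n. m n \<le> n choose 2"
    and large: "(\<lambda>n. real n powr (2 - \<theta>)) \<in> o(\<lambda>n. real (m n))"
  shows "(\<lambda>n. prob_lose ({..<v}, E) r (\<sigma> n) (m n) n) \<longlonglongrightarrow> 1"
proof -
  define l where "l = real (length es)"
  define M where "M = (\<lambda>n::nat. real n powr (2 - \<theta>))"
  define slack where "slack = (\<lambda>J. \<theta> * (l - real (card {f \<in> set es. f \<subseteq> J})) - (real v - real (card J)))"
  define S where "S = {J. J \<subseteq> {..<v} \<and> J \<noteq> {..<v} \<and> (\<exists>e\<in>set ms. e \<subseteq> J)}"
  have "finite S" unfolding S_def by (rule finite_subset[of _ "Pow {..<v}"]) auto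
  then obtain d where d: "d > 0" "\<And>J. J \<in> S \<Longrightarrow> d \<le> slack J"
  proof (rule finite_pos_lower_bound)
    show "0 < slack J" if "J \<in> S" for J
      using that sparse[of J] by (auto simp: S_def slack_def l_def)
  qed auto
  define d' where "d' = min (min d (\<theta> * l - (real v - 2))) (\<theta> / 2)"
  have d': "d' > 0" "d' \<le> d" "d' \<le> \<theta> * l - (real v - 2)" "d' < \<theta>"
    using d(1) few_pairs \<theta> by (auto simp: d'_def l_def)
  \<comment> \<open>Dividing by \<open>l + 1\<close> bounds both \<open>\<epsilon>\<close> and
    \<open>\<epsilon> * z\<close> for \<open>z \<le> l\<close> by \<open>d'\<close>; the term
    \<open>\<theta> / 2\<close> in \<open>d'\<close> then gives
    \<open>\<epsilon> < \<theta>\<close>.\<close>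
  define \<epsilon> where "\<epsilon> = d' / (l + 1)"
  have l: "l \<ge> 0" by (simp add: l_def)
  have \<epsilon>: "\<epsilon> > 0" using d' l by (simp add: \<epsilon>_def)
  have "\<epsilon> * 1 \<le> \<epsilon> * (l + 1)" using \<epsilon> l by (intro mult_left_mono) auto
  then have \<epsilon>': "\<epsilon> < \<theta>" using d' l by (simp add: \<epsilon>_def)
  have \<epsilon>_le: "\<epsilon> * z \<le> d'" if "z \<le> l" for z
  proof -
    have "\<epsilon> * z \<le> \<epsilon> * (l + 1)" using that \<epsilon> by (intro mult_left_mono) auto
    then show ?thesis using l by (simp add: \<epsilon>_def)
  qed
  define g where "g = (\<lambda>n. min (real (m n) / M n) (real n powr \<epsilon>))"
  have g_top: "filterlim g at_top sequentially"
    unfolding filterlim_at_top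
  proof
    fix Z :: real
    have "filterlim (\<lambda>n::nat. real n powr \<epsilon>) at_top sequentially" using \<epsilon> by real_asymp
    then have "\<forall>\<^sub>F n in sequentially. Z \<le> real n powr \<epsilon>" by (simp add: filterlim_at_top)
    moreover have "\<forall>\<^sub>F n in sequentially. norm (M n) \<le> (1 / (\<bar>Z\<bar> + 1)) * norm (real (m n))"
      using large unfolding M_def by (rule landau_o.smallD) auto
    ultimately show "\<forall>\<^sub>F n in sequentially. Z \<le> g n" using eventually_gt_at_top[of 0]
    proof eventually_elim
      case (elim n)
      have Mn: "M n > 0" using elim by (simp add: M_def)
      have "(\<bar>Z\<bar> + 1) * M n \<le> real (m n)" using elim Mn by (simp add: field_simps)
      then have "\<bar>Z\<bar> + 1 \<le> real (m n) / M n" using Mn by (simp add: field_simps)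
      with elim show ?case by (simp add: g_def)
    qed
  qed
  have g1: "\<forall>\<^sub>F n in sequentially. 1 \<le> g n"
    using g_top by (simp add: filterlim_at_top)
  have g2: "\<forall>\<^sub>F n in sequentially. g n \<le> real n powr \<epsilon>"
    by (simp add: g_def)
  have sparse': "real v - real (card J) \<le> (\<theta> - \<epsilon>) * (real (length es) - real (card {f \<in> set es. f \<subseteq> J}))"
    if "J \<subseteq> {..<v}" "J \<noteq> {..<v}" "e \<in> set ms" "e \<subseteq> J" for e J
  proof -
    have "J \<in> S" using that by (auto simp: S_def)
    then have "d' \<le> slack J" using d(2) d'(2) by force
    moreover have "\<epsilon> * (l - real (card {f \<in> set es. f \<subseteq> J})) \<le> d'" by (rule \<epsilon>_le) simp
    ultimately show ?thesis by (simp add: slack_def l_def algebra_simps)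
  qed
  have few_pairs': "real v - 2 \<le> (\<theta> - \<epsilon>) * real (length es)"
    using \<epsilon>_le[OF order_refl] d'(3) by (simp add: l_def algebra_simps)
  interpret play: forced_play v E r es ms \<theta> \<epsilon> g \<sigma>
  proof unfold_locales
    show "\<theta> * real (card {f \<in> set (take j es). f \<subseteq> J}) \<le> real (card J) - 2"
      if "j < length es" "J \<subseteq> {..<v}" "es ! j \<subseteq> J" for j J by (rule dense[OF that])
    show "real v - real (card J) \<le> (\<theta> - \<epsilon>) * (real (length es) - real (card {f \<in> set es. f \<subseteq> J}))"
      if "J \<subseteq> {..<v}" "J \<noteq> {..<v}" "e \<in> set ms" "e \<subseteq> J" for e J by (rule sparse'[OF that])
  qed (use r v online split \<epsilon> \<epsilon>' \<theta>(2) few_pairs' balanced g1 g2 g_top in auto)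
  have lost: "\<forall>\<^sub>F n in sequentially. measure (achlioptas n r (\<sigma> n) (m n)) {h. \<not> lost ({..<v}, E) n h} \<le> \<delta>"
    if "\<delta> > 0" for \<delta>
    using play.eventually_lost[OF that] play.eventually_regular
  proof eventually_elim
    case (elim n)
    define j where "j = card E * play.phase n"
    have "M n > 0" using elim(2) by (simp add: M_def play.regular_def)
    have "real j \<le> g n * M n"
      using play.phase_rounds_le[OF elim(2)] by (simp add: M_def j_def)
    also have "\<dots> \<le> (real (m n) / M n) * M n"
      using \<open>M n > 0\<close> by (intro mult_right_mono) (auto simp: g_def)
    also have "\<dots> = real (m n)" using \<open>M n > 0\<close> by simp
    finally have "j \<le> m n" by simp
    from prob_unlost_antimono[OF r online this m] elim(1) show ?case
      unfolding j_def by (rule order_trans)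
  qed
  have compl: "prob_lose ({..<v}, E) r (\<sigma> n) (m n) n =
      1 - measure (achlioptas n r (\<sigma> n) (m n)) {h. \<not> lost ({..<v}, E) n h}" for n
    unfolding prob_lose_def
    by (subst measure_pmf.prob_compl[symmetric]) (auto intro!: arg_cong2[where f = measure])
  have "(\<lambda>n. measure (achlioptas n r (\<sigma> n) (m n)) {h. \<not> lost ({..<v}, E) n h}) \<longlonglongrightarrow> 0"
  proof (rule tendstoI)
    fix e :: real assume "e > 0"
    then have "\<forall>\<^sub>F n in sequentially. measure (achlioptas n r (\<sigma> n) (m n)) {h. \<not> lost ({..<v}, E) n h} \<le> e / 2"
      by (intro lost) simp
    then show "\<forall>\<^sub>F n in sequentially. dist (measure (achlioptas n r (\<sigma> n) (m n)) {h. \<not> lost ({..<v}, E) n h}) 0 < e"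
      by (rule eventually_mono) (use \<open>e > 0\<close> in \<open>simp add: dist_real_def\<close>)
  qed
  from tendsto_diff[OF tendsto_const[of 1] this] show ?thesis by (simp add: compl)
qed

text \<open>Any order of the kept edges will do: those before \<open>es ! j\<close> lie in
  \<open>E - M\<close> without \<open>es ! j\<close> itself, which is the subtracted 1 in
  \<open>dense\<close>. The bound \<open>few_pairs\<close> is \<open>sparse\<close> for
  \<open>J = e\<close>, since no other edge fits into two vertices.\<close>

theorem avoidance_threshold_pattern:
  assumes r: "r > 0" and v: "v \<ge> 3" and M: "M \<subseteq> E" "M \<noteq> {}" "M \<noteq> E" and \<theta>: "0 < \<theta>" "\<theta> < 2"
    and dense: "\<And>e J. J \<subseteq> {..<v} \<Longrightarrow> e \<in> E - M \<Longrightarrow> e \<subseteq> J \<Longrightarrow>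
       \<theta> * (real (card {f \<in> E - M. f \<subseteq> J}) - 1) \<le> real (card J) - 2"
    and sparse: "\<And>e J. J \<subseteq> {..<v} \<Longrightarrow> J \<noteq> {..<v} \<Longrightarrow> e \<in> M \<Longrightarrow> e \<subseteq> J \<Longrightarrow>
       real v - real (card J) < \<theta> * (real (card (E - M)) - real (card {f \<in> E - M. f \<subseteq> J}))"
    and balanced: "balanced_exponent r v (card (E - M)) (card M) \<theta>"
  shows "avoidance_threshold r ({..<v}, E) (\<lambda>n. real n powr (2 - \<theta>))"
proof -
  have fin: "finite M" "finite (E - M)" using M(1) finite_subset[of M E] by auto
  obtain ms where ms: "set ms = M" "distinct ms" using finite_distinct_list[OF fin(1)] by blast
  obtain es where es: "set es = E - M" "distinct es" using finite_distinct_list[OF fin(2)] by blast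
  have len: "length es = card (E - M)" "length ms = card M"
    using distinct_card[OF es(2)] distinct_card[OF ms(2)] es ms by auto
  have cM: "card M < card E" using M by (intro psubset_card_mono) auto
  have cEM: "card (E - M) = card E - card M" using M fin by (intro card_Diff_subset) auto
  have dense': "\<theta> * real (card {f \<in> set (take j es). f \<subseteq> J}) \<le> real (card J) - 2"
    if "j < length es" "J \<subseteq> {..<v}" "es ! j \<subseteq> J" for j J
  proof -
    have e: "es ! j \<in> E - M" using that es(1) nth_mem by blast
    have "es ! j \<notin> set (take j es)"
      using es(2) that(1) by (auto simp: in_set_conv_nth nth_eq_iff_index_eq)
    then have "insert (es ! j) {f \<in> set (take j es). f \<subseteq> J} \<subseteq> {f \<in> E - M. f \<subseteq> J}"
      using e that(3) es(1) set_take_subset[of j es] by auto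
    then have "card (insert (es ! j) {f \<in> set (take j es). f \<subseteq> J}) \<le> card {f \<in> E - M. f \<subseteq> J}"
      using fin by (intro card_mono) auto
    then have "Suc (card {f \<in> set (take j es). f \<subseteq> J}) \<le> card {f \<in> E - M. f \<subseteq> J}"
      using \<open>es ! j \<notin> set (take j es)\<close> by simp
    then have "real (card {f \<in> set (take j es). f \<subseteq> J}) \<le> real (card {f \<in> E - M. f \<subseteq> J}) - 1" by linarith
    then have "\<theta> * real (card {f \<in> set (take j es). f \<subseteq> J}) \<le> \<theta> * (real (card {f \<in> E - M. f \<subseteq> J}) - 1)"
      using \<theta> by (intro mult_left_mono) auto
    with dense[OF that(2) e that(3)] show ?thesis by linarith
  qed
  have few_pairs: "real v - 2 < \<theta> * real (length es)"
  proof -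
    obtain e where e: "e \<in> M" using M(2) by blast
    have e2: "e \<subseteq> {..<v}" "card e = 2" "finite e" using e M(1) E by (auto simp: nsets_def)
    have "{f \<in> E - M. f \<subseteq> e} = {}"
    proof (safe, goal_cases)
      case (1 f)
      then have "f = e" using E e2 by (intro card_subset_eq) (auto simp: nsets_def)
      with 1 e show ?case by simp
    qed
    then have "card {f \<in> E - M. f \<subseteq> e} = 0" by (simp only: card.empty)
    moreover have "e \<noteq> {..<v}" using e2(2) v by auto
    ultimately show ?thesis using sparse[OF e2(1) _ e order_refl] e2(2) by (simp only: len) simp
  qed
  show ?thesis
    unfolding avoidance_threshold_def
  proof (intro conjI allI impI)
    fix m :: "nat \<Rightarrow> nat"
    assume small: "(\<lambda>n. real (m n)) \<in> o(\<lambda>n. real n powr (2 - \<theta>))"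
    have "balanced_exponent r v (card E - card M) (card M) \<theta>" using balanced by (simp add: cEM)
    from cautious_player_survives[OF r cM _ \<theta>(2) this small] \<theta>(1) online_cautious_strategy[OF cM]
    show "\<exists>\<sigma>. (\<forall>n. online_strategy (\<sigma> n)) \<and> (\<lambda>n. prob_survive ({..<v}, E) r (\<sigma> n) (m n) n) \<longlonglongrightarrow> 1"
      by (intro exI[of _ "\<lambda>n. cautious_strategy n (card M)"]) auto
  next
    fix m :: "nat \<Rightarrow> nat" and \<sigma> :: "nat \<Rightarrow> strategy"
    assume m: "\<forall>n. m n \<le> n choose 2" and large: "(\<lambda>n. real n powr (2 - \<theta>)) \<in> o(\<lambda>n. real (m n))"
      and online: "\<forall>n. online_strategy (\<sigma> n)"
    show "(\<lambda>n. prob_lose ({..<v}, E) r (\<sigma> n) (m n) n) \<longlonglongrightarrow> 1"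
    proof (rule player_loses[where es = es and ms = ms])
      show "real v - real (card J) < \<theta> * (real (length es) - real (card {f \<in> set es. f \<subseteq> J}))"
        if "J \<subseteq> {..<v}" "J \<noteq> {..<v}" "e \<in> set ms" "e \<subseteq> J" for e J
        using sparse[OF that(1,2) _ that(4)] that(3) by (simp add: len es ms)
      show "\<theta> * real (card {f \<in> set (take j es). f \<subseteq> J}) \<le> real (card J) - 2"
        if "j < length es" "J \<subseteq> {..<v}" "es ! j \<subseteq> J" for j J by (rule dense'[OF that])
      show "set es \<union> set ms = E" "set es \<inter> set ms = {}" "ms \<noteq> []"
        using M es(1) ms(1) by auto
    qed (use r v \<theta> es(2) ms(2) m large online balanced few_pairs in \<open>simp_all add: len\<close>)
  qed
qed

end

section \<open>Exponents of cliques and complete bipartite graphs\<close>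

lemma concave_nonneg:
  fixes p q c A B C :: real
  assumes f: "\<And>x. f x = A + B * x - C * x ^ 2" and C: "C \<ge> 0"
    and ends: "f p \<ge> 0" "f q \<ge> 0" and c: "p \<le> c" "c \<le> q"
  shows "f c \<ge> 0"
proof (cases "p = q")
  case True
  with ends c show ?thesis by simp
next
  case False
  \<comment> \<open>A concave function lies above its chord; the last summand is the excess,
    multiplied by \<open>q - p\<close>.\<close>
  have "(q - p) * f c = (q - c) * f p + (c - p) * f q + C * ((q - p) * ((c - p) * (q - c)))"
    unfolding f by (simp add: algebra_simps power2_eq_square)
  moreover have "0 \<le> (q - c) * f p" "0 \<le> (c - p) * f q" "0 \<le> C * ((q - p) * ((c - p) * (q - c)))"
    using ends C c by auto
  ultimately have "0 \<le> (q - p) * f c" by linarith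
  with False c show ?thesis by (auto simp: zero_le_mult_iff)
qed

lemma concave_pos:
  fixes p q c A B C :: real
  assumes f: "\<And>x. f x = A + B * x - C * x ^ 2" and C: "C \<ge> 0"
    and ends: "f p \<ge> 0" "f q > 0" and c: "p < c" "c \<le> q"
  shows "f c > 0"
proof -
  have "(q - p) * f c = (q - c) * f p + (c - p) * f q + C * ((q - p) * ((c - p) * (q - c)))"
    unfolding f by (simp add: algebra_simps power2_eq_square)
  moreover have "0 \<le> (q - c) * f p" "0 < (c - p) * f q" "0 \<le> C * ((q - p) * ((c - p) * (q - c)))"
    using ends C c by auto
  ultimately have "0 < (q - p) * f c" by linarith
  with c show ?thesis by (simp add: zero_less_mult_iff)
qed

text \<open>Here \<open>\<theta> = P / D\<close>, \<open>b\<close> is the size of \<open>J\<close>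
  and \<open>\<mu>\<close> the number of removed edges inside. A vertex outside \<open>J\<close>
  destroys at most one edge of the matching. For \<open>b \<le> t - s\<close> it suffices that
  \<open>\<mu> \<ge> 0\<close>; for larger \<open>b\<close> inserting
  \<open>\<mu> \<ge> s - (t - b)\<close> leaves a concave quadratic in \<open>d = t - b\<close>,
  checked at \<open>d = 0\<close> and \<open>d = s\<close>.\<close>

lemma clique_dense_ineq:
  fixes t s Q G b \<mu> :: real
  assumes t: "4 \<le> t" and s: "1 \<le> s" "2 * s \<le> t" and Q: "1 \<le> Q"
    and G: "t - s + 1 \<le> Q + G" "t * (t - 1) - 2 * s - 2 \<le> (t - 2) * (Q + G)"
    and D: "D = Q * (t * (t - 1) / 2 - s) + G" and P: "P = Q * (t - 2) + 2"
    and b: "2 \<le> b" "b \<le> t" and \<mu>: "0 \<le> \<mu>" "s - (t - b) \<le> \<mu>"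
  shows "P * (b * (b - 1) / 2 - \<mu> - 1) \<le> (b - 2) * D"
proof -
  have P0: "P \<ge> 0" using P Q t by simp
  have "0 \<le> s * (t - 4)" using s t by simp
  then have "Q * 2 \<le> Q * (s * (t - 4) + 2)" using Q by (intro mult_left_mono) auto
  \<comment> \<open>Since \<open>b * (b - 1) / 2 - 1 = (b - 2) * (b + 1) / 2\<close>, this is the
    case \<open>b = t - s\<close> with \<open>b - 2\<close> cancelled, the worst one in the first
    range.\<close>
  then have *: "P * (t - s + 1) \<le> 2 * D"
    using G s unfolding P D by (simp add: field_simps)
  have far: "P * (b * (b - 1) / 2 - 1) \<le> (b - 2) * D" if "2 \<le> b" "b \<le> t - s" for b
  proof -
    have "P * (b + 1) \<le> P * (t - s + 1)" using that P0 by (intro mult_left_mono) auto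
    with * have "P * (b + 1) \<le> 2 * D" by linarith
    then have "(b - 2) * (P * (b + 1)) \<le> (b - 2) * (2 * D)" using that by (intro mult_left_mono) auto
    then show ?thesis by (simp add: field_simps)
  qed
  show ?thesis
  proof (cases "b \<le> t - s")
    case True
    have "P * (b * (b - 1) / 2 - \<mu> - 1) \<le> P * (b * (b - 1) / 2 - 1)"
      using P0 \<mu> by (intro mult_left_mono) auto
    with far[OF b(1) True] show ?thesis by linarith
  next
    case False
    define f where "f = (\<lambda>d. (t - d - 2) * D - P * ((t - d) * (t - d - 1) / 2 - 1 - s + d))"
    have "f 0 = (t - 2) * (Q + G) - 2 * (t * (t - 1) / 2 - s - 1)"
      unfolding f_def P D by (simp add: field_simps)
    also have "\<dots> = (t - 2) * (Q + G) - (t * (t - 1) - 2 * s - 2)" by (simp add: field_simps)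
    finally have f0: "f 0 \<ge> 0" using G(2) by linarith
    have fs: "f s \<ge> 0"
      using far[of "t - s"] s t by (simp add: f_def algebra_simps)
    have "f (t - b) \<ge> 0"
    proof (rule concave_nonneg[where f = f and p = 0 and q = s, OF _ _ f0 fs])
      show "f x = (t - 2) * D - P * (t * (t - 1) / 2 - 1 - s) + (P * (t - 3 / 2) - D) * x - P / 2 * x ^ 2" for x
        unfolding f_def by (simp add: field_simps power2_eq_square)
    qed (use P0 b False in auto)
    moreover have "P * (b * (b - 1) / 2 - \<mu> - 1) \<le> P * (b * (b - 1) / 2 - (s - (t - b)) - 1)"
      using P0 \<mu> by (intro mult_left_mono) auto
    ultimately show ?thesis by (simp add: f_def algebra_simps)
  qed
qed

text \<open>Now \<open>a\<close> vertices lie outside \<open>J\<close>,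
  \<open>a * (2 * t - a - 1) / 2\<close> pairs of the clique are not inside \<open>J\<close>, and
  \<open>q\<close> removed edges are broken; at least one is not, so \<open>q \<le> s - 1\<close>.
  For \<open>a \<le> s - 1\<close> use \<open>q \<le> a\<close> and cancel \<open>a\<close>; beyond,
  a concave quadratic is checked at \<open>s - 1\<close> and at \<open>t - 2\<close>, where
  \<open>J\<close> is a single edge.\<close>

lemma clique_sparse_ineq:
  fixes t s Q G a q :: real
  assumes t: "4 \<le> t" and s: "1 \<le> s" "2 * s \<le> t" and Q: "1 \<le> Q" and G: "0 \<le> G" "G \<le> t"
    and small: "(t - 2) * G < t * (t - 1) - 2 * s" "G < 2 * t - s - 2"
    and D: "D = Q * (t * (t - 1) / 2 - s) + G" and P: "P = Q * (t - 2) + 2"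
    and a: "1 \<le> a" "a \<le> t - 2" and q: "q \<le> a" "q \<le> s - 1"
  shows "a * D < P * (a * (2 * t - a - 1) / 2 - q)"
proof -
  have P0: "P \<ge> 0" using P Q t by simp
  have "0 \<le> (t - 4) * (t - 1 - s)" using s t by simp
  then have "0 \<le> Q * ((t - 4) * (t - 1 - s))" by (rule mult_nonneg_nonneg[rotated]) (use Q in simp)
  then have *: "2 * D < P * (2 * t - s - 2)"
    using small unfolding P D by (simp add: field_simps)
  have near: "a * D < P * (a * (2 * t - a - 1) / 2 - a)" if "a \<le> s - 1" "0 < a" for a
  proof -
    have "P * (2 * t - s - 2) \<le> P * (2 * t - a - 3)" using that P0 by (intro mult_left_mono) auto
    with * have "2 * D < P * (2 * t - a - 3)" by linarith
    then have "a * (2 * D) < a * (P * (2 * t - a - 3))" using that by (intro mult_strict_left_mono) auto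
    then show ?thesis by (simp add: field_simps)
  qed
  show ?thesis
  proof (cases "a \<le> s - 1")
    case True
    have "P * (a * (2 * t - a - 1) / 2 - a) \<le> P * (a * (2 * t - a - 1) / 2 - q)"
      using P0 q by (intro mult_left_mono) auto
    with near[OF True] a show ?thesis by linarith
  next
    case False
    define f where "f = (\<lambda>a. P * (a * (2 * t - a - 1) / 2 - (s - 1)) - a * D)"
    have fs: "f (s - 1) \<ge> 0"
    \<comment> \<open>For \<open>s = 1\<close> the left end is \<open>a = 0\<close>, where
      \<open>f\<close> vanishes and \<open>near\<close> does not apply.\<close>
    proof (cases "s = 1")
      case False
      then show ?thesis using near[of "s - 1"] s by (simp add: f_def)
    qed (simp add: f_def)
    have "f (t - 2) = (t * (t - 1) - 2 * s) - (t - 2) * G"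
      unfolding f_def P D by (simp add: field_simps)
    moreover have "0 < (t * (t - 1) - 2 * s) - (t - 2) * G" using small(1) by simp
    ultimately have ft: "f (t - 2) > 0" by (simp only:)
    have "f a > 0"
    proof (rule concave_pos[where f = f and p = "s - 1" and q = "t - 2", OF _ _ fs ft])
      show "f x = - (P * (s - 1)) + (P * (t - 1 / 2) - D) * x - P / 2 * x ^ 2" for x
        unfolding f_def by (simp add: field_simps power2_eq_square)
    qed (use P0 a False in auto)
    moreover have "P * (a * (2 * t - a - 1) / 2 - (s - 1)) \<le> P * (a * (2 * t - a - 1) / 2 - q)"
      using P0 q by (intro mult_left_mono) auto
    ultimately show ?thesis by (simp add: f_def)
  qed
qed

section \<open>The inequalities for complete bipartite graphs\<close>

lemma product_le_square_mean: "x * y \<le> (x + y) ^ 2 / (4 :: real)"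
  using zero_le_power2[of "x - y"] by (simp add: power2_eq_square algebra_simps)

text \<open>\<open>x\<close> and \<open>y\<close> count the vertices of \<open>J\<close> on the two
  sides. Replacing \<open>x * y\<close> by the square of their mean leaves the single variable
  \<open>w\<close>, and the two ranges of the clique case return with border
  \<open>w = 2 * t - s\<close>.\<close>

lemma biclique_dense_ineq:
  fixes t s Q G x y \<mu> :: real
  assumes t: "3 \<le> t" and s: "1 \<le> s" "s \<le> t - 1" and Q: "1 \<le> Q" and G: "0 \<le> G" "t + 1 \<le> Q + G"
    and D: "D = Q * (t ^ 2 - s) + G" and P: "P = Q * (2 * t - 2) + 2"
    and w: "2 \<le> x + y" "x + y \<le> 2 * t" and \<mu>: "0 \<le> \<mu>" "s - (2 * t - (x + y)) \<le> \<mu>"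
  shows "P * (x * y - \<mu> - 1) \<le> (x + y - 2) * D"
proof -
  define w where "w = x + y"
  have w: "2 \<le> w" "w \<le> 2 * t" and \<mu>: "0 \<le> \<mu>" "s - (2 * t - w) \<le> \<mu>"
    using w \<mu> by (simp_all add: w_def)
  have P0: "P \<ge> 0" using P Q t by simp
  have "0 \<le> s * (t - 3)" using s t by simp
  then have "Q * 4 \<le> Q * (2 * (s * (t - 3)) + 4)" using Q by (intro mult_left_mono) auto
  then have *: "P * (2 * t - s + 2) \<le> 4 * D"
    using G s unfolding P D by (simp add: algebra_simps power2_eq_square)
  have far: "P * (w ^ 2 / 4 - 1) \<le> (w - 2) * D" if "2 \<le> w" "w \<le> 2 * t - s" for w
  proof -
    have "P * (w + 2) \<le> P * (2 * t - s + 2)" using that P0 by (intro mult_left_mono) auto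
    with * have "P * (w + 2) \<le> 4 * D" by linarith
    then have "(w - 2) * (P * (w + 2)) \<le> (w - 2) * (4 * D)" using that by (intro mult_left_mono) auto
    then show ?thesis by (simp add: algebra_simps power2_eq_square)
  qed
  have xy: "P * (x * y - \<mu> - 1) \<le> P * (w ^ 2 / 4 - \<mu> - 1)"
    using P0 product_le_square_mean[of x y] unfolding w_def by (intro mult_left_mono) auto
  have "P * (w ^ 2 / 4 - \<mu> - 1) \<le> (w - 2) * D"
  proof (cases "w \<le> 2 * t - s")
    case True
    have "P * (w ^ 2 / 4 - \<mu> - 1) \<le> P * (w ^ 2 / 4 - 1)"
      using P0 \<mu> by (intro mult_left_mono) auto
    with far[OF w(1) True] show ?thesis by linarith
  next
    case False
    define f where "f = (\<lambda>d. (2 * t - d - 2) * D - P * ((2 * t - d) ^ 2 / 4 - 1 - s + d))"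
    have "f 0 = (2 * t - 2) * (Q + G) - 2 * (t ^ 2 - s - 1)"
      unfolding f_def P D by (simp add: field_simps power2_eq_square)
    moreover have "(2 * t - 2) * (t + 1) \<le> (2 * t - 2) * (Q + G)" using G t by (intro mult_left_mono) auto
    ultimately have f0: "f 0 \<ge> 0" using s by (simp add: field_simps power2_eq_square)
    have fs: "f s \<ge> 0"
      using far[of "2 * t - s"] s t by (simp add: f_def algebra_simps)
    have "f (2 * t - w) \<ge> 0"
    proof (rule concave_nonneg[where f = f and p = 0 and q = s, OF _ _ f0 fs])
      show "f x = (2 * t - 2) * D - P * (t ^ 2 - 1 - s) + (P * (t - 1) - D) * x - P / 4 * x ^ 2" for x
        unfolding f_def by (simp add: field_simps power2_eq_square)
    qed (use P0 w False in auto)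
    moreover have "P * (w ^ 2 / 4 - \<mu> - 1) \<le> P * (w ^ 2 / 4 - (s - (2 * t - w)) - 1)"
      using P0 \<mu> by (intro mult_left_mono) auto
    ultimately show ?thesis by (simp add: f_def algebra_simps)
  qed
  with xy show ?thesis unfolding w_def by linarith
qed

text \<open>The same reduction in terms of the number \<open>d\<close> of vertices outside
  \<open>J\<close>: at least \<open>t * d - d^2 / 4\<close> edges of the complete bipartite graph
  are not inside \<open>J\<close>, which is again concave.\<close>

lemma biclique_sparse_ineq:
  fixes t s Q G x y q :: real
  assumes t: "3 \<le> t" and s: "1 \<le> s" "s \<le> t - 1" and Q: "1 \<le> Q" and G: "0 \<le> G" "G \<le> t"
    and D: "D = Q * (t ^ 2 - s) + G" and P: "P = Q * (2 * t - 2) + 2"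
    and d: "d = 2 * t - (x + y)" "1 \<le> d" "d \<le> 2 * t - 2" and q: "q \<le> d" "q \<le> s - 1"
  shows "d * D < P * (t ^ 2 - x * y - q)"
proof -
  have P0: "P \<ge> 0" using P Q t by simp
  have "0 \<le> (t - 3) * (2 * t - 1 - s)" using s t by (intro mult_nonneg_nonneg) auto
  then have "0 \<le> Q * ((t - 3) * (2 * t - 1 - s))" by (rule mult_nonneg_nonneg[rotated]) (use Q in simp)
  then have *: "4 * D < P * (4 * t - s - 3)"
    using G s t unfolding P D by (simp add: algebra_simps power2_eq_square)
  have near: "d * D < P * (t * d - d ^ 2 / 4 - d)" if "d \<le> s - 1" "0 < d" for d
  proof -
    have "P * (4 * t - s - 3) \<le> P * (4 * t - d - 4)" using that P0 by (intro mult_left_mono) auto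
    with * have "4 * D < P * (4 * t - d - 4)" by linarith
    then have "d * (4 * D) < d * (P * (4 * t - d - 4))" using that by (intro mult_strict_left_mono) auto
    then show ?thesis by (simp add: algebra_simps power2_eq_square)
  qed
  have main: "d * D < P * (t * d - d ^ 2 / 4 - q)"
  proof (cases "d \<le> s - 1")
    case True
    have "P * (t * d - d ^ 2 / 4 - d) \<le> P * (t * d - d ^ 2 / 4 - q)"
      using P0 q by (intro mult_left_mono) auto
    with near[OF True] d show ?thesis by linarith
  next
    case False
    define f where "f = (\<lambda>d. P * (t * d - d ^ 2 / 4 - (s - 1)) - d * D)"
    have fs: "f (s - 1) \<ge> 0"
    proof (cases "s = 1")
      case False
      then show ?thesis using near[of "s - 1"] s by (simp add: f_def)
    qed (simp add: f_def)
    have "(t - 1) * G \<le> (t - 1) * t" using G t by (intro mult_left_mono) auto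
    moreover have "f (2 * t - 2) = 2 * (t ^ 2 - s) - 2 * ((t - 1) * G)"
      unfolding f_def P D by (simp add: field_simps power2_eq_square)
    ultimately have ft: "f (2 * t - 2) > 0" using s by (simp add: algebra_simps power2_eq_square)
    have "f d > 0"
    proof (rule concave_pos[where f = f and p = "s - 1" and q = "2 * t - 2", OF _ _ fs ft])
      show "f x = - (P * (s - 1)) + (P * t - D) * x - P / 4 * x ^ 2" for x
        unfolding f_def by (simp add: field_simps power2_eq_square)
    qed (use P0 d False in auto)
    moreover have "P * (t * d - d ^ 2 / 4 - (s - 1)) \<le> P * (t * d - d ^ 2 / 4 - q)"
      using P0 q by (intro mult_left_mono) auto
    ultimately show ?thesis by (simp add: f_def)
  qed
  have "t * d - d ^ 2 / 4 = t ^ 2 - (x + y) ^ 2 / 4"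
    unfolding d(1) by (simp add: field_simps power2_eq_square)
  then have "t * d - d ^ 2 / 4 - q \<le> t ^ 2 - x * y - q"
    using product_le_square_mean[of x y] by linarith
  then have "P * (t * d - d ^ 2 / 4 - q) \<le> P * (t ^ 2 - x * y - q)"
    using P0 by (intro mult_left_mono) auto
  with main show ?thesis by linarith
qed

section \<open>The number of removed edges\<close>

lemma geometric_sum_mult:
  assumes "r \<ge> 2"
  shows "(\<Sum>j<s. real r ^ j) * (real r - 1) = real r ^ s - 1"
  using assms by (simp add: geometric_sum)

text \<open>\<open>s\<close> is the largest number with \<open>(r^s - 1) / (r - 1) \<le> t\<close>,
  that is, \<open>r^s \<le> (r - 1) * t + 1\<close>. The logarithm is at least 1, so
  \<open>nat\<close> changes nothing.\<close>

lemma log_floor_bounds: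
  fixes t r :: nat
  assumes r: "r \<ge> 2" and t: "t \<ge> 2" and s: "s = nat \<lfloor>log (real r) ((real r - 1) * real t + 1)\<rfloor>"
  shows "1 \<le> s" "(\<Sum>j<s. r ^ j) \<le> t" "t < (\<Sum>j<Suc s. r ^ j)"
proof -
  define z where "z = (real r - 1) * real t + 1"
  have "(real r - 1) * 1 \<le> (real r - 1) * real t" using r t by (intro mult_left_mono) auto
  then have z: "z \<ge> real r" by (simp add: z_def)
  then have "log (real r) z \<ge> log (real r) (real r)" using r by (subst log_le_cancel_iff) auto
  then have log1: "log (real r) z \<ge> 1" using r by simp
  then have s': "of_int \<lfloor>log (real r) z\<rfloor> = real s" by (simp add: s z_def[symmetric])
  have "real s \<le> log (real r) z" using s' by linarith
  moreover have "log (real r) z < real s + 1" using s' by linarith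
  moreover show "1 \<le> s" using log1 by (simp add: s z_def[symmetric] le_nat_iff)
  ultimately have "real r powr real s \<le> z" "z < real r powr (real s + 1)"
    using r z by (simp_all add: le_log_iff log_less_iff)
  then have bounds: "real r ^ s \<le> z" "z < real r ^ Suc s"
    using r by (simp_all add: powr_realpow powr_add mult.commute)
  have r1: "real r - 1 > 0" using r by simp
  have "real (\<Sum>j<s. r ^ j) * (real r - 1) \<le> real t * (real r - 1)"
    using bounds(1) geometric_sum_mult[OF r, of s] by (simp add: z_def mult.commute)
  then have "real (\<Sum>j<s. r ^ j) \<le> real t" using r1 by (rule mult_right_le_imp_le)
  then show "(\<Sum>j<s. r ^ j) \<le> t" unfolding of_nat_le_iff .
  have "real t * (real r - 1) < real (\<Sum>j<Suc s. r ^ j) * (real r - 1)"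
    using bounds(2) geometric_sum_mult[OF r, of "Suc s"]
    by (simp add: z_def mult.commute del: sum.lessThan_Suc)
  then have "real t < real (\<Sum>j<Suc s. r ^ j)" using r1 by (simp only: mult_less_cancel_right_pos)
  then show "t < (\<Sum>j<Suc s. r ^ j)" unfolding of_nat_less_iff .
qed

text \<open>Used to get \<open>2^s \<le> t + 1\<close>, which for \<open>s \<ge> 3\<close> forces
  \<open>2 * s < t\<close>, so that a matching of \<open>s\<close> edges fits.\<close>

lemma geometric_sum_ge_power2:
  assumes "(r::nat) \<ge> 2"
  shows "2 ^ s \<le> Suc (\<Sum>j<s. r ^ j)"
proof -
  have "(2::nat) ^ s = Suc (\<Sum>j<s. 2 ^ j)" by (induction s) auto
  also have "\<dots> \<le> Suc (\<Sum>j<s. r ^ j)"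
    using assms by (simp add: sum_mono power_mono)
  finally show ?thesis .
qed

text \<open>A vertex outside \<open>J\<close> destroys at most one edge of a matching.\<close>

lemma card_matching_inside_ge:
  assumes V: "finite V" "\<Union>M \<subseteq> V" "J \<subseteq> V" and M: "finite M"
    and disj: "\<And>e f. e \<in> M \<Longrightarrow> f \<in> M \<Longrightarrow> e \<noteq> f \<Longrightarrow> e \<inter> f = {}"
  shows "real (card M) - real (card {f \<in> M. f \<subseteq> J}) \<le> real (card V) - real (card J)"
proof -
  define pick where "pick = (\<lambda>f. SOME x. x \<in> f - J)"
  have pick: "pick f \<in> f - J" if "f \<in> {f \<in> M. \<not> f \<subseteq> J}" for f
    unfolding pick_def using that someI_ex[of "\<lambda>x. x \<in> f - J"] by blast
  have "card {f \<in> M. \<not> f \<subseteq> J} \<le> card (V - J)"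
  proof (rule card_inj_on_le)
    show "inj_on pick {f \<in> M. \<not> f \<subseteq> J}"
    proof (rule inj_onI)
      fix e f assume ef: "e \<in> {f \<in> M. \<not> f \<subseteq> J}" "f \<in> {f \<in> M. \<not> f \<subseteq> J}" "pick e = pick f"
      then have "pick e \<in> e \<inter> f" using pick[of e] pick[of f] by auto
      with disj[of e f] ef show "e = f" by auto
    qed
    show "pick ` {f \<in> M. \<not> f \<subseteq> J} \<subseteq> V - J" using pick V by blast
    show "finite (V - J)" using V by simp
  qed
  moreover have "card (V - J) = card V - card J" "card J \<le> card V"
    using V finite_subset[OF V(3)] by (auto simp: card_Diff_subset card_mono)
  moreover have "card M = card ({f \<in> M. f \<subseteq> J} \<union> {f \<in> M. \<not> f \<subseteq> J})"
    by (rule arg_cong[where f = card]) auto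
  then have "card M = card {f \<in> M. f \<subseteq> J} + card {f \<in> M. \<not> f \<subseteq> J}"
    using M by (subst (asm) card_Un_disjoint) auto
  ultimately show ?thesis by linarith
qed

section \<open>Thresholds of the concrete graphs\<close>

lemma doubleton_in_nsets: "a \<in> A \<Longrightarrow> b \<in> A \<Longrightarrow> a \<noteq> b \<Longrightarrow> {a, b} \<in> nsets A 2"
  by (auto simp: nsets_def)

text \<open>The conditions on \<open>Q\<close> and \<open>G\<close> are assumed instead of derived
  from the logarithm, because one exceptional clique is treated with a smaller \<open>s\<close>.
  \<open>dense\<close> and \<open>small\<close> contain the comparison of copies with pairs for
  \<open>s + 1\<close> and for \<open>s\<close> missing edges.\<close>

lemma clique_threshold:
  fixes t r s :: nat
  defines "Q \<equiv> real r ^ s" and "G \<equiv> \<Sum>j<s. real r ^ j"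
  defines "P \<equiv> Q * (real t - 2) + 2" and "D \<equiv> Q * (real (t choose 2) - real s) + G"
  assumes t: "4 \<le> t" and r: "2 \<le> r" and s: "1 \<le> s" "2 * s \<le> t"
    and G_le: "G \<le> real t"
    and dense: "real t - real s + 1 \<le> Q + G"
      "real t * (real t - 1) - 2 * real s - 2 \<le> (real t - 2) * (Q + G)"
    and small: "(real t - 2) * G < real t * (real t - 1) - 2 * real s" "G < 2 * real t - real s - 2"
  shows "avoidance_threshold r (simple_complete_graph t) (\<lambda>n. real n powr (2 - P / D))"
proof -
  define E where "E = nsets {..<t} 2"
  define pair where "pair = (\<lambda>i. {2 * i, Suc (2 * i)})"
  define M where "M = pair ` {..<s}"
  interpret pattern t E by unfold_locales (simp add: E_def)
  have D: "D = Q * (real t * (real t - 1) / 2 - real s) + G" by (simp add: D_def real_choose_two)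
  have Q1: "1 \<le> Q" using r by (simp add: Q_def)
  have G0: "0 \<le> G" by (simp add: G_def sum_nonneg)
  have t': "4 \<le> real t" and s': "1 \<le> real s" "2 * real s \<le> real t" using t s by simp_all
  have "real t * 3 \<le> real t * (real t - 1)" using t' by (intro mult_left_mono) auto
  then have big: "real t * (real t - 1) / 2 - real s \<ge> real t" using s' by linarith
  then have "Q * real t \<le> Q * (real t * (real t - 1) / 2 - real s)" using Q1 by (intro mult_left_mono) auto
  then have QD: "Q * real t \<le> D" unfolding D by (rule add_increasing2[OF G0])
  have "0 < Q * real t" using Q1 t' by simp
  then have D0: "D > 0" using QD by linarith
  have P0: "P > 0" using Q1 t' by (simp add: P_def add_nonneg_pos)
  have "P \<le> Q * real t" using Q1 by (simp add: P_def algebra_simps)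
  then have P2D: "P < 2 * D" using QD D0 by linarith
  have inj: "inj_on pair {..<s}" by (auto simp: inj_on_def pair_def doubleton_eq_iff)
  have cM: "card M = s" by (simp add: M_def card_image inj)
  have ME: "M \<subseteq> E"
    using s(2) by (auto simp: M_def E_def pair_def intro!: doubleton_in_nsets)
  have finM: "finite M" by (simp add: M_def)
  have cE: "card E = t choose 2" by (simp add: E_def card_nsets)
  have cEM: "real (card (E - M)) = real t * (real t - 1) / 2 - real s"
    using ME finM cM cE card_mono[OF finite_E ME]
    by (simp add: card_Diff_subset of_nat_diff real_choose_two)
  have disj: "e \<inter> f = {}" if "e \<in> M" "f \<in> M" "e \<noteq> f" for e f
  proof -
    from that obtain i j where ij: "e = pair i" "f = pair j" "i \<noteq> j" by (auto simp: M_def)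
    have "2 * i \<noteq> Suc (2 * j)" "Suc (2 * i) \<noteq> 2 * j" by presburger+
    with ij(3) show ?thesis unfolding ij(1,2) pair_def by simp
  qed
  have inside: "real (card {f \<in> E - M. f \<subseteq> J}) = real (card J) * (real (card J) - 1) / 2 - real (card {f \<in> M. f \<subseteq> J})"
    and broken: "real s - real (card {f \<in> M. f \<subseteq> J}) \<le> real t - real (card J)"
    and cJ: "card J \<le> t"
    if J: "J \<subseteq> {..<t}" for J
  proof -
    have finJ: "finite J" using finite_subset[OF J] by simp
    show cJ: "card J \<le> t" using card_mono[OF _ J] by simp
    have "{f \<in> E - M. f \<subseteq> J} = nsets J 2 - {f \<in> M. f \<subseteq> J}"
      using J by (auto simp: E_def nsets_def)
    moreover have sub: "{f \<in> M. f \<subseteq> J} \<subseteq> nsets J 2"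
      using ME by (auto simp: E_def nsets_def)
    moreover have "finite (nsets J 2)" using finJ by (rule finite_imp_finite_nsets)
    ultimately show "real (card {f \<in> E - M. f \<subseteq> J}) =
        real (card J) * (real (card J) - 1) / 2 - real (card {f \<in> M. f \<subseteq> J})"
      using card_mono[of "nsets J 2" "{f \<in> M. f \<subseteq> J}"] finM
      by (simp add: card_Diff_subset of_nat_diff card_nsets real_choose_two)
    have "\<Union>M \<subseteq> {..<t}" using ME by (auto simp: E_def nsets_def)
    from card_matching_inside_ge[OF _ this J finM disj]
    show "real s - real (card {f \<in> M. f \<subseteq> J}) \<le> real t - real (card J)" by (simp add: cM)
  qed
  have edge2: "2 \<le> card J" if "e \<in> E" "e \<subseteq> J" "J \<subseteq> {..<t}" for e J
    using that card_mono[of J e] finite_subset[OF that(3)] by (auto simp: E_def nsets_def)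
  have "avoidance_threshold r ({..<t}, E) (\<lambda>n. real n powr (2 - P / D))"
  proof (rule avoidance_threshold_pattern[where M = M])
    show "0 < P / D" using P0 D0 by simp
    show "P / D < 2" using P2D D0 by (simp add: divide_less_eq)
    show "M \<noteq> {}" using s by (auto simp: M_def lessThan_empty_iff)
    show "M \<noteq> E"
    proof
      assume "M = E"
      then have "card (E - M) = 0" by simp
      with cEM big t' show False by simp
    qed
    show "balanced_exponent r t (card (E - M)) (card M) (P / D)"
    proof -
      have "real r ^ s * real (card (E - M)) + (\<Sum>j<s. real r ^ j) = D"
        unfolding cEM D Q_def G_def by simp
      then show ?thesis using D0 by (simp add: balanced_exponent_def cM P_def Q_def)
    qed
    show "P / D * (real (card {f \<in> E - M. f \<subseteq> J}) - 1) \<le> real (card J) - 2"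
      if J: "J \<subseteq> {..<t}" "e \<in> E - M" "e \<subseteq> J" for e J
    proof -
      have "P * (real (card J) * (real (card J) - 1) / 2 - real (card {f \<in> M. f \<subseteq> J}) - 1) \<le> (real (card J) - 2) * D"
      proof (rule clique_dense_ineq[OF t' s' Q1 dense D P_def[THEN meta_eq_to_obj_eq]])
        show "2 \<le> real (card J)" using edge2[OF _ J(3,1)] J(2) by simp
        show "real (card J) \<le> real t" using cJ[OF J(1)] by simp
        show "real s - (real t - real (card J)) \<le> real (card {f \<in> M. f \<subseteq> J})" using broken[OF J(1)] by simp
      qed simp
      then show ?thesis unfolding inside[OF J(1)] using D0 by (simp add: field_simps)
    qed
    show "real t - real (card J) < P / D * (real (card (E - M)) - real (card {f \<in> E - M. f \<subseteq> J}))"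
      if J: "J \<subseteq> {..<t}" "J \<noteq> {..<t}" "e \<in> M" "e \<subseteq> J" for e J
    proof -
      define a where "a = real t - real (card J)"
      define q where "q = real s - real (card {f \<in> M. f \<subseteq> J})"
      have "card J < t" using psubset_card_mono[of "{..<t}" J] J(1,2) by auto
      then have a1: "1 \<le> a" by (simp add: a_def)
      have "card {f \<in> M. f \<subseteq> J} > 0" using J(3,4) finM by (auto simp: card_gt_0_iff)
      then have q1: "q \<le> real s - 1" by (simp add: q_def)
      have "2 \<le> card J" using edge2[OF _ J(4,1)] J(3) ME by auto
      then have a2: "a \<le> real t - 2" by (simp add: a_def)
      have qa: "q \<le> a" using broken[OF J(1)] by (simp add: q_def a_def)
      have "a * D < P * (a * (2 * real t - a - 1) / 2 - q)"
        by (rule clique_sparse_ineq[OF t' s' Q1 G0 G_le small D P_def[THEN meta_eq_to_obj_eq] a1 a2 qa q1])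
      moreover have "real (card (E - M)) - real (card {f \<in> E - M. f \<subseteq> J}) = a * (2 * real t - a - 1) / 2 - q"
        unfolding cEM inside[OF J(1)] by (simp add: a_def q_def field_simps)
      ultimately have "a * D < P * (real (card (E - M)) - real (card {f \<in> E - M. f \<subseteq> J}))"
        by (simp only:)
      then show ?thesis using D0 by (simp only: a_def[symmetric] times_divide_eq_left pos_less_divide_eq)
    qed
  qed (use r t ME in auto)
  then show ?thesis by (simp add: simple_complete_graph_def E_def)
qed

lemma biclique_threshold:
  fixes t r s :: nat
  defines "Q \<equiv> real r ^ s" and "G \<equiv> \<Sum>j<s. real r ^ j"
  defines "P \<equiv> Q * (2 * real t - 2) + 2" and "D \<equiv> Q * (real t ^ 2 - real s) + G"
  assumes t: "3 \<le> t" and r: "2 \<le> r" and s: "1 \<le> s" "s < t"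
    and G: "G \<le> real t" "real t + 1 \<le> Q + G"
  shows "avoidance_threshold r (complete_bipartite_graph t t) (\<lambda>n. real n powr (2 - P / D))"
proof -
  define edge where "edge = (\<lambda>(i, j). {i, t + j})"
  define E where "E = edge ` ({..<t} \<times> {..<t})"
  define M where "M = (\<lambda>i. {i, t + i}) ` {..<s}"
  have edges: "E \<subseteq> nsets {..<t + t} 2"
    by (auto simp: E_def edge_def intro!: doubleton_in_nsets)
  interpret pattern "t + t" E by unfold_locales (rule edges)
  have Q1: "1 \<le> Q" using r by (simp add: Q_def)
  have G0: "0 \<le> G" by (simp add: G_def sum_nonneg)
  have t': "3 \<le> real t" and s': "1 \<le> real s" "real s \<le> real t - 1" using t s by auto
  have "real t * 3 \<le> real t ^ 2" using t' unfolding power2_eq_square by (intro mult_left_mono) auto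
  then have big: "real t ^ 2 - real s \<ge> 2 * real t" using s' by linarith
  then have "Q * (2 * real t) \<le> Q * (real t ^ 2 - real s)" using Q1 by (intro mult_left_mono) auto
  then have QD: "Q * (2 * real t) \<le> D" unfolding D_def by (rule add_increasing2[OF G0])
  have "0 < Q * (2 * real t)" using Q1 t' by simp
  then have D0: "D > 0" using QD by linarith
  have P0: "P > 0" using Q1 t' by (simp add: P_def add_nonneg_pos)
  have "P \<le> Q * (2 * real t)" using Q1 by (simp add: P_def algebra_simps)
  then have P2D: "P < 2 * D" using QD D0 by linarith
  have inj: "inj_on edge ({..<t} \<times> {..<t})" by (auto simp: inj_on_def edge_def doubleton_eq_iff)
  have cE: "card E = t * t" by (simp add: E_def card_image inj)
  have cM: "card M = s"
    unfolding M_def using s by (subst card_image) (auto simp: inj_on_def doubleton_eq_iff)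
  have "(\<lambda>i. {i, t + i}) ` {..<s} \<subseteq> edge ` ({..<t} \<times> {..<t})"
  proof (rule image_subsetI)
    fix i assume "i \<in> {..<s}"
    then show "{i, t + i} \<in> edge ` ({..<t} \<times> {..<t})"
      using s by (intro image_eqI[of _ _ "(i, i)"]) (auto simp: edge_def)
  qed
  then have ME: "M \<subseteq> E" by (simp add: M_def E_def)
  have finM: "finite M" by (simp add: M_def)
  have cEM: "real (card (E - M)) = real t ^ 2 - real s"
    using ME finM cM cE card_mono[OF finite_E ME]
    by (simp add: card_Diff_subset of_nat_diff power2_eq_square)
  have disj: "e \<inter> f = {}" if "e \<in> M" "f \<in> M" "e \<noteq> f" for e f
    using that s by (auto simp: M_def)
  define X where "X = (\<lambda>J. {i. i < t \<and> i \<in> J})"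
  define Y where "Y = (\<lambda>J. {j. j < t \<and> t + j \<in> J})"
  have fin: "finite (X J)" "finite (Y J)" for J by (simp_all add: X_def Y_def)
  have cJ: "card J = card (X J) + card (Y J)" if J: "J \<subseteq> {..<t + t}" for J
  proof -
    have "J = X J \<union> (\<lambda>j. t + j) ` Y J"
    proof (intro equalityI subsetI)
      fix x assume x: "x \<in> J"
      show "x \<in> X J \<union> (\<lambda>j. t + j) ` Y J"
      proof (cases "x < t")
        case False
        then have "x - t \<in> Y J" "x = t + (x - t)" using x J by (auto simp: Y_def)
        then show ?thesis by blast
      qed (use x in \<open>simp add: X_def\<close>)
    qed (auto simp: X_def Y_def)
    moreover have "card (X J \<union> (\<lambda>j. t + j) ` Y J) = card (X J) + card ((\<lambda>j. t + j) ` Y J)"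
      using fin by (intro card_Un_disjoint) (auto simp: X_def)
    ultimately show ?thesis by (simp add: card_image)
  qed
  have inside: "real (card {f \<in> E - M. f \<subseteq> J}) = real (card (X J)) * real (card (Y J)) - real (card {f \<in> M. f \<subseteq> J})" for J
  proof -
    have eq: "{f \<in> E. f \<subseteq> J} = edge ` (X J \<times> Y J)"
      by (auto simp: E_def edge_def X_def Y_def)
    have card_edge: "card (edge ` (X J \<times> Y J)) = card (X J) * card (Y J)"
      using inj by (subst card_image) (auto simp: X_def Y_def card_cartesian_product intro: inj_on_subset)
    have sub: "{f \<in> M. f \<subseteq> J} \<subseteq> edge ` (X J \<times> Y J)" using ME unfolding eq[symmetric] by auto
    have "card {f \<in> M. f \<subseteq> J} \<le> card (edge ` (X J \<times> Y J))"
      by (rule card_mono[OF _ sub]) (simp add: fin)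
    moreover have "{f \<in> E - M. f \<subseteq> J} = edge ` (X J \<times> Y J) - {f \<in> M. f \<subseteq> J}"
      unfolding eq[symmetric] by auto
    ultimately show ?thesis
      using sub finM by (simp add: card_Diff_subset of_nat_diff card_edge)
  qed
  have broken: "real s - real (card {f \<in> M. f \<subseteq> J}) \<le> 2 * real t - real (card J)"
    if J: "J \<subseteq> {..<t + t}" for J
  proof -
    have "\<Union>M \<subseteq> {..<t + t}" using s by (auto simp: M_def)
    from card_matching_inside_ge[OF _ this J finM disj] show ?thesis by (simp add: cM)
  qed
  have edge2: "2 \<le> card J" if "e \<in> E" "e \<subseteq> J" "J \<subseteq> {..<t + t}" for e J
    using that edges card_mono[of J e] finite_subset[OF that(3)] by (auto simp: nsets_def)
  have "avoidance_threshold r ({..<t + t}, E) (\<lambda>n. real n powr (2 - P / D))"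
  proof (rule avoidance_threshold_pattern[where M = M])
    show "0 < P / D" using P0 D0 by simp
    show "P / D < 2" using P2D D0 by (simp add: divide_less_eq)
    show "M \<noteq> {}" using s by (auto simp: M_def lessThan_empty_iff)
    show "M \<noteq> E"
    proof
      assume "M = E"
      then have "card (E - M) = 0" by simp
      with cEM have "real t ^ 2 - real s = 0" by (simp only: of_nat_0)
      with big t' show False by linarith
    qed
    show "balanced_exponent r (t + t) (card (E - M)) (card M) (P / D)"
    proof -
      have "real r ^ s * real (card (E - M)) + (\<Sum>j<s. real r ^ j) = D"
        unfolding cEM D_def Q_def G_def by simp
      then show ?thesis using D0 by (simp add: balanced_exponent_def cM P_def Q_def)
    qed
    show "P / D * (real (card {f \<in> E - M. f \<subseteq> J}) - 1) \<le> real (card J) - 2"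
      if J: "J \<subseteq> {..<t + t}" "e \<in> E - M" "e \<subseteq> J" for e J
    proof -
      note cJ' = cJ[OF J(1)]
      have "2 \<le> card J" using edge2[OF _ J(3,1)] J(2) by simp
      moreover have "card J \<le> t + t" using card_mono[OF _ J(1)] by simp
      ultimately have w: "2 \<le> real (card (X J)) + real (card (Y J))" "real (card (X J)) + real (card (Y J)) \<le> 2 * real t"
        using cJ' by linarith+
      have "P * (real (card (X J)) * real (card (Y J)) - real (card {f \<in> M. f \<subseteq> J}) - 1) \<le>
          (real (card (X J)) + real (card (Y J)) - 2) * D"
        by (rule biclique_dense_ineq[OF t' s' Q1 G0 G(2) D_def[THEN meta_eq_to_obj_eq] P_def[THEN meta_eq_to_obj_eq] w])
          (use broken[OF J(1)] cJ' in auto)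
      then show ?thesis unfolding inside using D0 cJ' by (simp add: field_simps)
    qed
    show "real (t + t) - real (card J) < P / D * (real (card (E - M)) - real (card {f \<in> E - M. f \<subseteq> J}))"
      if J: "J \<subseteq> {..<t + t}" "J \<noteq> {..<t + t}" "e \<in> M" "e \<subseteq> J" for e J
    proof -
      note cJ' = cJ[OF J(1)]
      define d where "d = 2 * real t - (real (card (X J)) + real (card (Y J)))"
      define q where "q = real s - real (card {f \<in> M. f \<subseteq> J})"
      have "card J < t + t" using psubset_card_mono[of "{..<t + t}" J] J(1,2) by auto
      then have d1: "1 \<le> d" using cJ' by (simp add: d_def)
      have "card {f \<in> M. f \<subseteq> J} > 0" using J(3,4) finM by (auto simp: card_gt_0_iff)
      then have q1: "q \<le> real s - 1" by (simp add: q_def)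
      have "2 \<le> card J" using edge2[OF _ J(4,1)] J(3) ME by auto
      then have d2: "d \<le> 2 * real t - 2" using cJ' by (simp add: d_def)
      have qd: "q \<le> d" using broken[OF J(1)] cJ' by (simp add: q_def d_def)
      have "d * D < P * (real t ^ 2 - real (card (X J)) * real (card (Y J)) - q)"
        by (rule biclique_sparse_ineq[OF t' s' Q1 G0 G(1) D_def[THEN meta_eq_to_obj_eq] P_def[THEN meta_eq_to_obj_eq] d_def d1 d2 qd q1])
      moreover have "real (card (E - M)) - real (card {f \<in> E - M. f \<subseteq> J}) =
          real t ^ 2 - real (card (X J)) * real (card (Y J)) - q"
        unfolding cEM inside by (simp add: q_def)
      ultimately have "d * D < P * (real (card (E - M)) - real (card {f \<in> E - M. f \<subseteq> J}))"
        by (simp only:)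
      moreover have "real (t + t) - real (card J) = d" using cJ' by (simp add: d_def)
      ultimately show ?thesis using D0 by (simp only: times_divide_eq_left pos_less_divide_eq)
    qed
  qed (use r t ME in auto)
  moreover have "complete_bipartite_graph t t = ({..<t + t}, E)"
    by (auto simp: complete_bipartite_graph_def E_def edge_def)
  ultimately show ?thesis by simp
qed

text \<open>Removing one edge leaves a path, in which \<open>J\<close> induces at most
  \<open>card J - 1\<close> edges; as \<open>\<theta> \<le> 1\<close>, density is no obstacle. If
  \<open>J\<close> contains both ends of the path but not all of it, it splits into at least two
  pieces and one more edge is lost.\<close>

lemma cycle_threshold:
  fixes t r :: nat
  defines "P \<equiv> (real t - 2) * real r + 2" and "D \<equiv> (real t - 1) * real r + 1"
  assumes t: "3 \<le> t" and r: "2 \<le> r"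
  shows "avoidance_threshold r (cycle_graph t) (\<lambda>n. real n powr (2 - P / D))"
proof -
  define step where "step = (\<lambda>i::nat. {i, Suc i})"
  define F where "F = step ` {..<t - 1}"
  define e0 where "e0 = {t - 1, 0}"
  define E where "E = insert e0 F"
  have e0F: "e0 \<notin> F" using t by (auto simp: e0_def F_def step_def doubleton_eq_iff)
  have edges: "E \<subseteq> nsets {..<t} 2"
    using t by (auto simp: E_def F_def e0_def step_def intro!: doubleton_in_nsets)
  interpret pattern t E by unfold_locales (rule edges)
  have EM: "E - {e0} = F" using e0F by (auto simp: E_def)
  have inj: "inj_on step A" for A by (auto simp: inj_on_def step_def doubleton_eq_iff)
  have cF: "real (card F) = real t - 1" using t by (simp add: F_def card_image[OF inj] of_nat_diff)
  have t': "3 \<le> real t" and r': "2 \<le> real r" using t r by simp_all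
  have tr: "1 * 2 \<le> (real t - 2) * real r" using t' r' by (intro mult_mono) auto
  have D: "D = (real t - 2) * real r + real r + 1" by (simp add: D_def algebra_simps)
  have P0: "P > 0" using tr by (simp add: P_def)
  have D0: "D > 0" using tr r' unfolding D by linarith
  have PD: "P \<le> D" using r' unfolding P_def D by simp
  have inside: "{f \<in> F. f \<subseteq> J} = step ` {i. i < t - 1 \<and> i \<in> J \<and> Suc i \<in> J}" for J
    by (auto simp: F_def step_def)
  have c_inside: "card {f \<in> F. f \<subseteq> J} = card {i. i < t - 1 \<and> i \<in> J \<and> Suc i \<in> J}" for J
    unfolding inside by (rule card_image[OF inj])
  have "avoidance_threshold r ({..<t}, E) (\<lambda>n. real n powr (2 - P / D))"
  proof (rule avoidance_threshold_pattern[where M = "{e0}"])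
    show "0 < P / D" using P0 D0 by simp
    show "P / D < 2" using PD P0 D0 by (simp add: divide_less_eq)
    show "{e0} \<noteq> E" using EM cF t' by auto
    show "balanced_exponent r t (card (E - {e0})) (card {e0}) (P / D)"
      using D0 by (simp add: balanced_exponent_def EM cF D_def P_def mult.commute)
    show "P / D * (real (card {f \<in> E - {e0}. f \<subseteq> J}) - 1) \<le> real (card J) - 2"
      if J: "J \<subseteq> {..<t}" "e \<in> E - {e0}" "e \<subseteq> J" for e J
    proof -
      have finJ: "finite J" using finite_subset[OF J(1)] by simp
      have "J \<noteq> {}" using J by (auto simp: EM F_def step_def)
      then have max: "Max J \<in> J" using finJ by simp
      \<comment> \<open>Edges of the path are identified with their lower end, which cannot be the
        maximum of \<open>J\<close>.\<close>
      have "{i. i < t - 1 \<and> i \<in> J \<and> Suc i \<in> J} \<subseteq> J - {Max J}"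
        by (auto dest: Max_ge[OF finJ])
      then have "card {f \<in> F. f \<subseteq> J} \<le> card (J - {Max J})"
        unfolding c_inside using finJ by (intro card_mono) auto
      then have "card {f \<in> F. f \<subseteq> J} \<le> card J - 1" using max by simp
      moreover have e: "e \<in> {f \<in> F. f \<subseteq> J}" using J EM by auto
      then have c1: "card {f \<in> F. f \<subseteq> J} \<ge> 1"
        using card_mono[of "{f \<in> F. f \<subseteq> J}" "{e}"] by (simp add: F_def)
      ultimately have le: "real (card {f \<in> F. f \<subseteq> J}) - 1 \<le> real (card J) - 2" by linarith
      have "P / D * (real (card {f \<in> F. f \<subseteq> J}) - 1) \<le> 1 * (real (card {f \<in> F. f \<subseteq> J}) - 1)"
        using PD D0 c1 by (intro mult_right_mono) (auto simp: divide_le_eq)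
      with le show ?thesis unfolding EM by (simp only: mult_1_left)
    qed
    show "real t - real (card J) < P / D * (real (card (E - {e0})) - real (card {f \<in> E - {e0}. f \<subseteq> J}))"
      if J: "J \<subseteq> {..<t}" "J \<noteq> {..<t}" "e \<in> {e0}" "e \<subseteq> J" for e J
    proof -
      have finJ: "finite J" using finite_subset[OF J(1)] by simp
      have ends: "0 \<in> J" "t - 1 \<in> J" using J(3,4) by (auto simp: e0_def)
      have "\<exists>i. i \<in> J \<and> i < t - 1 \<and> Suc i \<notin> J"
      proof (rule ccontr)
        assume no: "\<not> ?thesis"
        have "i < t \<longrightarrow> i \<in> J" for i
          by (induction i) (use ends no in auto)
        with J(1,2) show False by auto
      qed
      then obtain i where i: "i \<in> J" "i < t - 1" "Suc i \<notin> J" by blast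
      \<comment> \<open>Neither \<open>i\<close>, whose successor is missing, nor the last vertex is
        the lower end of an edge inside \<open>J\<close>.\<close>
      have "{i. i < t - 1 \<and> i \<in> J \<and> Suc i \<in> J} \<subseteq> J - {i, t - 1}" using i by auto
      then have "card {f \<in> F. f \<subseteq> J} \<le> card (J - {i, t - 1})"
        unfolding c_inside using finJ by (intro card_mono) auto
      also have "\<dots> = card J - 2" using i ends by (subst card_Diff_subset) auto
      finally have 1: "card {f \<in> F. f \<subseteq> J} \<le> card J - 2" .
      have "card {i, t - 1} \<le> card J" using i ends finJ by (intro card_mono) auto
      then have cJ: "2 \<le> card J" using i by simp
      define a where "a = real t - real (card J)"
      have a: "a \<le> real t - 2" using cJ by (simp add: a_def)
      \<comment> \<open>Because \<open>D - P = r - 1\<close>, the claim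
        \<open>a * D < P * (a + 1)\<close> amounts to \<open>a * (r - 1) < P\<close>.\<close>
      have "a * (real r - 1) \<le> (real t - 2) * (real r - 1)" using a r' by (intro mult_right_mono) auto
      then have "a * D < P * (a + 1)"
        using t' unfolding P_def D_def by (simp add: algebra_simps)
      then have "a < P / D * (a + 1)" using D0 by (simp add: field_simps)
      also have "\<dots> \<le> P / D * (real (card F) - real (card {f \<in> F. f \<subseteq> J}))"
      proof (rule mult_left_mono)
        have "real (card {f \<in> F. f \<subseteq> J}) \<le> real (card J) - 2" using 1 cJ by linarith
        then show "a + 1 \<le> real (card F) - real (card {f \<in> F. f \<subseteq> J})" unfolding cF a_def by linarith
      qed (use P0 D0 in auto)
      finally show ?thesis unfolding EM a_def .
    qed
  qed (use r t in \<open>auto simp: E_def\<close>)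
  moreover have "{{i, Suc i mod t} | i. i < t} = E"
  proof (intro equalityI subsetI)
    fix f assume "f \<in> {{i, Suc i mod t} | i. i < t}"
    then obtain i where i: "i < t" "f = {i, Suc i mod t}" by blast
    show "f \<in> E"
    proof (cases "Suc i = t")
      case True
      then have "f = e0" using i by (auto simp: e0_def)
      then show ?thesis by (simp add: E_def)
    next
      case False
      then have "f = step i" "i < t - 1" using i by (auto simp: step_def)
      then show ?thesis by (simp add: E_def F_def)
    qed
  next
    fix f assume "f \<in> E"
    then consider "f = e0" | i where "i < t - 1" "f = step i" by (auto simp: E_def F_def)
    then show "f \<in> {{i, Suc i mod t} | i. i < t}"
    proof cases
      case 1
      then show ?thesis using t by (intro CollectI exI[of _ "t - 1"]) (auto simp: e0_def)
    next
      case 2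
      then show ?thesis by (intro CollectI exI[of _ i]) (auto simp: step_def)
    qed
  qed
  ultimately show ?thesis by (simp add: cycle_graph_def)
qed

lemma Suc_double_less_power2: "3 \<le> s \<Longrightarrow> Suc (2 * s) < 2 ^ (s :: nat)"
  by (induction s rule: dec_induct) auto

lemma removed_edges_bounds:
  fixes t r :: nat
  assumes r: "r \<ge> 2" and t: "t \<ge> 2" and s: "s = nat \<lfloor>log (real r) ((real r - 1) * real t + 1)\<rfloor>"
    and G: "G = (\<Sum>j<s. r ^ j)"
  shows "1 \<le> s" "G \<le> t" "t + 1 \<le> r ^ s + G" "s = 1 \<or> s = 2 \<and> 3 \<le> t \<or> 3 \<le> s \<and> 2 * s < t"
    "(real r ^ s - 1) / (real r - 1) = (\<Sum>j<s. real r ^ j)"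
proof -
  note bounds = log_floor_bounds[OF r t s]
  show s1: "1 \<le> s" and Gt: "G \<le> t" and "t + 1 \<le> r ^ s + G" using bounds by (simp_all add: G)
  have "2 ^ s \<le> Suc t" using geometric_sum_ge_power2[OF r, of s] Gt by (simp add: G)
  moreover have "s = 1 \<or> s = 2 \<or> 3 \<le> s" using s1 by linarith
  ultimately show "s = 1 \<or> s = 2 \<and> 3 \<le> t \<or> 3 \<le> s \<and> 2 * s < t"
    using Suc_double_less_power2[of s] by auto
  show "(real r ^ s - 1) / (real r - 1) = (\<Sum>j<s. real r ^ j)"
    using geometric_sum_mult[OF r, of s] r by (simp add: field_simps)
qed

theorem theorem1p1:
  shows "(\<forall>t r :: nat. t \<ge> 3 \<longrightarrow> r \<ge> 2 \<longrightarrow>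
            avoidance_threshold r (cycle_graph t)
              (\<lambda>n. real n powr
                 (2 - ((real t - 2) * real r + 2) / ((real t - 1) * real r + 1))))
       \<and> (\<forall>t r :: nat. t \<ge> 4 \<longrightarrow> r \<ge> 2 \<longrightarrow>
            (let s = nat \<lfloor>log (real r) ((real r - 1) * real t + 1)\<rfloor>;
                 \<theta> = (real r ^ s * (real t - 2) + 2) /
                     (real r ^ s * (real (t choose 2) - real s) + (real r ^ s - 1) / (real r - 1))
             in avoidance_threshold r (simple_complete_graph t) (\<lambda>n. real n powr (2 - \<theta>))))
       \<and> (\<forall>t r :: nat. t \<ge> 3 \<longrightarrow> r \<ge> 2 \<longrightarrow>
            (let s = nat \<lfloor>log (real r) ((real r - 1) * real t + 1)\<rfloor>;
                 \<theta> = (real r ^ s * (2 * real t - 2) + 2) /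
                     (real r ^ s * (real t ^ 2 - real s) + (real r ^ s - 1) / (real r - 1))
             in avoidance_threshold r (complete_bipartite_graph t t) (\<lambda>n. real n powr (2 - \<theta>))))"
proof (intro conjI allI impI)
  fix t r :: nat
  assume "t \<ge> 3" "r \<ge> 2"
  then show "avoidance_threshold r (cycle_graph t)
      (\<lambda>n. real n powr (2 - ((real t - 2) * real r + 2) / ((real t - 1) * real r + 1)))"
    by (rule cycle_threshold)
next
  fix t r :: nat
  assume t: "t \<ge> 4" and r: "r \<ge> 2"
  define s where "s = nat \<lfloor>log (real r) ((real r - 1) * real t + 1)\<rfloor>"
  define G where "G = (\<Sum>j<s. r ^ j)"
  have "t \<ge> 2" using t by simp
  note s = removed_edges_bounds[OF r this s_def G_def]
  \<comment> \<open>The exception is \<open>K_4\<close> with a perfect matching removed.\<close>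
  have st: "2 * s < t \<or> s = 2 \<and> t = 4" using s(4) t by auto
  have G_real: "(\<Sum>j<s. real r ^ j) = real G" by (simp add: G_def)
  have "avoidance_threshold r (simple_complete_graph t) (\<lambda>n. real n powr (2 -
      (real r ^ s * (real t - 2) + 2) / (real r ^ s * (real (t choose 2) - real s) + (\<Sum>j<s. real r ^ j))))"
  \<comment> \<open>For \<open>s = 2\<close> and \<open>t = 4\<close> the strict inequalities
    \<open>small\<close> hold exactly when \<open>G < 4\<close>.\<close>
  proof (cases "2 * s < t \<or> G < t")
    case True
    have Q: "real t + 1 \<le> real r ^ s + real G"
      using of_nat_mono[OF s(3), where 'a = real] by simp
    have Gr: "real G \<le> real t" using s(2) by simp
    have t': "4 \<le> real t" and s': "1 \<le> real s" using t s(1) by simp_all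
    have "(real t - 2) * (real t + 1) \<le> (real t - 2) * (real r ^ s + real G)"
      using Q t' by (intro mult_left_mono) auto
    then have dense: "real t * (real t - 1) - 2 * real s - 2 \<le> (real t - 2) * (real r ^ s + real G)"
      using s' by (simp add: algebra_simps)
    have small: "(real t - 2) * real G < real t * (real t - 1) - 2 * real s" "real G < 2 * real t - real s - 2"
    proof -
      show "real G < 2 * real t - real s - 2" using True st s(2) t by auto
      show "(real t - 2) * real G < real t * (real t - 1) - 2 * real s"
      proof (cases "2 * s < t")
        case True
        have "(real t - 2) * real G \<le> (real t - 2) * real t" using Gr t' by (intro mult_left_mono) auto
        moreover have "2 * real s < real t" using True by linarith
        ultimately show ?thesis by (simp add: algebra_simps)
      next
        case False
        with \<open>2 * s < t \<or> G < t\<close> st have "s = 2" "t = 4" "G \<le> 3" by auto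
        then show ?thesis by simp
      qed
    qed
    show ?thesis
      using st dense small Q Gr s' unfolding G_real[symmetric]
      by (intro clique_threshold t r s(1)) auto
  next
    case False
    \<comment> \<open>Here \<open>r = 3\<close>, and removing one edge gives the same exponent \<open>\<theta> = 1 / 2\<close> as removing
      two. With two removed, copies would already cover all pairs.\<close>
    with st have s2: "s = 2" and t4: "t = 4" by auto
    with False s(2) have "G = 4" by simp
    then have r3: "r = 3" using s2 by (simp add: G_def numeral_2_eq_2)
    have "avoidance_threshold r (simple_complete_graph t) (\<lambda>n. real n powr (2 -
      (real r ^ 1 * (real t - 2) + 2) / (real r ^ 1 * (real (t choose 2) - real 1) + (\<Sum>j<1. real r ^ j))))"
      by (rule clique_threshold) (simp_all add: t4 r3)
    moreover have "(\<Sum>j<2. (3 :: real) ^ j) = 4" by (simp add: numeral_2_eq_2)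
    ultimately show ?thesis by (simp add: t4 r3 s2 real_choose_two)
  qed
  then show "let s = nat \<lfloor>log (real r) ((real r - 1) * real t + 1)\<rfloor>;
                 \<theta> = (real r ^ s * (real t - 2) + 2) /
                     (real r ^ s * (real (t choose 2) - real s) + (real r ^ s - 1) / (real r - 1))
             in avoidance_threshold r (simple_complete_graph t) (\<lambda>n. real n powr (2 - \<theta>))"
    by (simp only: Let_def s_def[symmetric] s(5))
next
  fix t r :: nat
  assume t: "t \<ge> 3" and r: "r \<ge> 2"
  define s where "s = nat \<lfloor>log (real r) ((real r - 1) * real t + 1)\<rfloor>"
  define G where "G = (\<Sum>j<s. r ^ j)"
  have "t \<ge> 2" using t by simp
  note s = removed_edges_bounds[OF r this s_def G_def]
  have st: "s < t" using s(4) t by auto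
  have G_real: "(\<Sum>j<s. real r ^ j) = real G" by (simp add: G_def)
  have "real t + 1 \<le> real r ^ s + real G"
    using of_nat_mono[OF s(3), where 'a = real] by simp
  then have "avoidance_threshold r (complete_bipartite_graph t t) (\<lambda>n. real n powr (2 -
      (real r ^ s * (2 * real t - 2) + 2) / (real r ^ s * (real t ^ 2 - real s) + (\<Sum>j<s. real r ^ j))))"
    using s(2) unfolding of_nat_le_iff[where 'a = real, symmetric] G_real[symmetric]
    by (intro biclique_threshold t r s(1) st)
  then show "let s = nat \<lfloor>log (real r) ((real r - 1) * real t + 1)\<rfloor>;
                 \<theta> = (real r ^ s * (2 * real t - 2) + 2) /
                     (real r ^ s * (real t ^ 2 - real s) + (real r ^ s - 1) / (real r - 1))
             in avoidance_threshold r (complete_bipartite_graph t t) (\<lambda>n. real n powr (2 - \<theta>))"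
    by (simp only: Let_def s_def[symmetric] s(5))
qed

end
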